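(* Let $R\ge 0$, let $V\colon\mathbb R\to\mathbb R$ with $V \in L^1(\mathbb R)$ be supported in $[-R,R]$, and for $h>0$ let $P=-h^2\partial_x^2+V$. Then $$ \left\|\mathbf 1_{|x|>R}(1 + |x|)^{- \frac {1 + \delta}2}(P - E-i\varepsilon)^{-1}(1+|x|)^{- \frac {1 + \delta}2}\mathbf 1_{|x|>R}\right\|_{L^2(\mathbb R) \to L^2(\mathbb R)} \le \frac{8(1+R)^{-\delta}\,\delta^{-1} E^{- 1/2}}{h} $$ for any real numbers $E,\varepsilon,\delta,h$ with $E \ge 2 \varepsilon>0$, $\delta>0$ and $h >0$.
   Context: $L^2(\mathbb R)$ is the space of complex-valued square-integrable functions on $\mathbb R$. $\mathbf 1_{|x|>R}$ is the characteristic function of $\{x\in\mathbb R \colon |x|>R\}$, and functions of $x$ in the operator expression act as multiplication operators. For real-valued $V\in L^1(\mathbb R)$ and $h>0$, $P u= -h^2 u''+Vu$ is regarded as the self-adjoint operator on $L^2(\mathbb R)$ whose domain $\mathcal D$ is the set of all $u \in L^2(\mathbb R)\cap L^\infty(\mathbb R)$ such that $u' \in L^2(\mathbb R)\cap L^\infty(\mathbb R)$ and $Pu \in L^2(\mathbb R)$ (derivatives in the sense of distributions). In particular $P-z\colon\mathcal D\to L^2(\mathbb R)$ is bijective for $z\in\mathbb C\setminus\mathbb R$, and $(P-z)^{-1}$ denotes its inverse. *)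

theory Defs
  imports "HOL-Analysis.Analysis"
begin

section \<open>The Hilbert space of square-integrable functions on the real line\<close>

definition square_integrable :: "(real \<Rightarrow> complex) \<Rightarrow> bool" where
  "square_integrable f \<longleftrightarrow>
     f \<in> borel_measurable lebesgue \<and> integrable lebesgue (\<lambda>x. (cmod (f x))\<^sup>2)"

lemma square_integrable_zero: "square_integrable (\<lambda>_. 0)"
  by (simp add: square_integrable_def)

lemma square_integrable_mult_bounded:
  assumes f: "square_integrable f" and m: "m \<in> borel_measurable lebesgue" "bounded (range m)"
  shows "square_integrable (\<lambda>x. m x * f x)"
proof -
  obtain C where C: "cmod (m x) \<le> C" for x
    using m(2) by (auto simp: bounded_iff)
  have "0 \<le> C" using C[of 0] norm_ge_zero order_trans by blast
  have [measurable]: "f \<in> borel_measurable lebesgue" "m \<in> borel_measurable lebesgue"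
    using f m by (auto simp: square_integrable_def)
  have "integrable lebesgue (\<lambda>x. (cmod (m x * f x))\<^sup>2)"
  proof (rule Bochner_Integration.integrable_bound)
    show "integrable lebesgue (\<lambda>x. C\<^sup>2 * (cmod (f x))\<^sup>2)"
      using f by (auto simp: square_integrable_def)
    have "(cmod (m x * f x))\<^sup>2 \<le> C\<^sup>2 * (cmod (f x))\<^sup>2" for x
      using power_mono[OF C norm_ge_zero, of x 2]
      by (simp add: norm_mult power_mult_distrib mult_right_mono)
    then show "AE x in lebesgue. norm ((cmod (m x * f x))\<^sup>2) \<le> norm (C\<^sup>2 * (cmod (f x))\<^sup>2)"
      by simp
  qed measurable
  then show ?thesis by (simp add: square_integrable_def)
qed

lemma square_integrable_scaleR:
  "square_integrable f \<Longrightarrow> square_integrable (\<lambda>x. r *\<^sub>R f x)"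
  using square_integrable_mult_bounded[of f "\<lambda>_. of_real r"]
  by (simp add: scaleR_conv_of_real)

lemma square_integrable_add:
  assumes f: "square_integrable f" and g: "square_integrable g"
  shows "square_integrable (\<lambda>x. f x + g x)"
proof -
  have [measurable]: "f \<in> borel_measurable lebesgue" "g \<in> borel_measurable lebesgue"
    using f g by (auto simp: square_integrable_def)
  have "integrable lebesgue (\<lambda>x. (cmod (f x + g x))\<^sup>2)"
  proof (rule Bochner_Integration.integrable_bound)
    show "integrable lebesgue (\<lambda>x. 2 * (cmod (f x))\<^sup>2 + 2 * (cmod (g x))\<^sup>2)"
      using f g by (auto simp: square_integrable_def)
    have "(cmod (f x + g x))\<^sup>2 \<le> 2 * (cmod (f x))\<^sup>2 + 2 * (cmod (g x))\<^sup>2" for x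
    proof -
      have "(cmod (f x + g x))\<^sup>2 \<le> (cmod (f x) + cmod (g x))\<^sup>2"
        by (intro power_mono norm_triangle_ineq norm_ge_zero)
      also have "\<dots> \<le> 2 * (cmod (f x))\<^sup>2 + 2 * (cmod (g x))\<^sup>2"
        using zero_le_power2[of "cmod (f x) - cmod (g x)"]
        by (simp add: power2_sum power2_diff)
      finally show ?thesis .
    qed
    then show "AE x in lebesgue. norm ((cmod (f x + g x))\<^sup>2)
        \<le> norm (2 * (cmod (f x))\<^sup>2 + 2 * (cmod (g x))\<^sup>2)"
      by simp
  qed measurable
  then show ?thesis by (simp add: square_integrable_def)
qed

lemma square_integrable_inner:
  assumes f: "square_integrable f" and g: "square_integrable g"
  shows "integrable lebesgue (\<lambda>x. f x \<bullet> g x)"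
proof -
  have [measurable]: "f \<in> borel_measurable lebesgue" "g \<in> borel_measurable lebesgue"
    using f g by (auto simp: square_integrable_def)
  show ?thesis
  proof (rule Bochner_Integration.integrable_bound)
    show "integrable lebesgue (\<lambda>x. (cmod (f x))\<^sup>2 + (cmod (g x))\<^sup>2)"
      using f g by (auto simp: square_integrable_def)
    have "\<bar>f x \<bullet> g x\<bar> \<le> (cmod (f x))\<^sup>2 + (cmod (g x))\<^sup>2" for x
    proof -
      have "2 * (cmod (f x) * cmod (g x)) \<le> (cmod (f x))\<^sup>2 + (cmod (g x))\<^sup>2"
        using zero_le_power2[of "cmod (f x) - cmod (g x)"] by (simp add: power2_diff)
      moreover have "\<bar>f x \<bullet> g x\<bar> \<le> cmod (f x) * cmod (g x)"
        by (rule Cauchy_Schwarz_ineq2)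
      moreover have "0 \<le> cmod (f x) * cmod (g x)" by simp
      ultimately show ?thesis by linarith
    qed
    then show "AE x in lebesgue. norm (f x \<bullet> g x) \<le> norm ((cmod (f x))\<^sup>2 + (cmod (g x))\<^sup>2)"
      by simp
  qed measurable
qed

quotient_type L2 = "real \<Rightarrow> complex" / partial:
  "\<lambda>f g. square_integrable f \<and> square_integrable g \<and> (AE x in lebesgue. f x = g x)"
proof (rule part_equivpI)
  show "\<exists>f. square_integrable f \<and> square_integrable f \<and> (AE x in lebesgue. f x = f x)"
    using square_integrable_zero by auto
qed (auto simp: symp_def transp_def eq_commute elim: AE_mp)

instantiation L2 :: real_vector
begin

lift_definition zero_L2 :: L2 is "\<lambda>_. 0"
  by (simp add: square_integrable_zero)

lift_definition plus_L2 :: "L2 \<Rightarrow> L2 \<Rightarrow> L2" is "\<lambda>f g x. f x + g x"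
  by (auto simp: square_integrable_add elim: AE_mp)

lift_definition scaleR_L2 :: "real \<Rightarrow> L2 \<Rightarrow> L2" is "\<lambda>r f x. r *\<^sub>R f x"
  by (auto simp: square_integrable_scaleR elim: AE_mp)

lift_definition uminus_L2 :: "L2 \<Rightarrow> L2" is "\<lambda>f x. - f x"
  using square_integrable_scaleR[of _ "-1"] by (auto elim: AE_mp)

definition minus_L2 :: "L2 \<Rightarrow> L2 \<Rightarrow> L2" where "minus_L2 f g = f + (- g)"

instance
proof
  fix f g k :: L2 and r s :: real
  show "f + g + k = f + (g + k)"
    by transfer (auto simp: square_integrable_add add.assoc)
  show "f + g = g + f"
    by transfer (auto simp: square_integrable_add add.commute)
  show "0 + f = f"
    by transfer auto
  show "- f + f = 0"
    by transfer (use square_integrable_zero in auto)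
  show "f - g = f + - g"
    by (rule minus_L2_def)
  show "r *\<^sub>R (f + g) = r *\<^sub>R f + r *\<^sub>R g"
    by transfer (auto simp: square_integrable_add square_integrable_scaleR scaleR_add_right
        simp del: scaleR_conv_of_real)
  show "(r + s) *\<^sub>R f = r *\<^sub>R f + s *\<^sub>R f"
    by transfer (auto simp: square_integrable_add square_integrable_scaleR
        simp flip: scaleR_add_left)
  show "r *\<^sub>R s *\<^sub>R f = (r * s) *\<^sub>R f"
    by transfer (use square_integrable_scaleR in auto)
  show "1 *\<^sub>R f = f"
    by transfer auto
qed

end

instantiation L2 :: real_inner
begin

text \<open>The real part of the Hermitian inner product; it induces the usual norm
  (see \<open>norm_L2_rep\<close> below).\<close>

lift_definition inner_L2 :: "L2 \<Rightarrow> L2 \<Rightarrow> real" is "\<lambda>f g. LINT x|lebesgue. f x \<bullet> g x"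
proof -
  fix f f' g g' :: "real \<Rightarrow> complex"
  assume f: "square_integrable f \<and> square_integrable f' \<and> (AE x in lebesgue. f x = f' x)"
    and g: "square_integrable g \<and> square_integrable g' \<and> (AE x in lebesgue. g x = g' x)"
  show "(LINT x|lebesgue. f x \<bullet> g x) = (LINT x|lebesgue. f' x \<bullet> g' x)"
  proof (rule integral_cong_AE)
    show "(\<lambda>x. f x \<bullet> g x) \<in> borel_measurable lebesgue" "(\<lambda>x. f' x \<bullet> g' x) \<in> borel_measurable lebesgue"
      using f g square_integrable_inner by (blast intro: borel_measurable_integrable)+
    have "AE x in lebesgue. f x = f' x" "AE x in lebesgue. g x = g' x" using f g by auto
    then show "AE x in lebesgue. f x \<bullet> g x = f' x \<bullet> g' x" by eventually_elim simp
  qed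
qed

definition norm_L2 :: "L2 \<Rightarrow> real" where "norm_L2 f = sqrt (f \<bullet> f)"
definition dist_L2 :: "L2 \<Rightarrow> L2 \<Rightarrow> real" where "dist_L2 f g = norm (f - g)"
definition sgn_L2 :: "L2 \<Rightarrow> L2" where "sgn_L2 f = f /\<^sub>R norm f"
definition uniformity_L2 :: "(L2 \<times> L2) filter" where
  "uniformity_L2 = (INF e\<in>{0 <..}. principal {(f, g). dist f g < e})"
definition open_L2 :: "L2 set \<Rightarrow> bool" where
  "open_L2 U = (\<forall>f\<in>U. eventually (\<lambda>(f', g). f' = f \<longrightarrow> g \<in> U) uniformity)"

instance
proof
  fix f g k :: L2 and r :: real
  show "sgn f = f /\<^sub>R norm f" by (rule sgn_L2_def)
  show "dist f g = norm (f - g)" by (rule dist_L2_def)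
  show "uniformity = (INF e\<in>{0 <..}. principal {(x::L2, y). dist x y < e})"
    by (rule uniformity_L2_def)
  show "open U = (\<forall>x\<in>U. \<forall>\<^sub>F (x', y) in uniformity. x' = x \<longrightarrow> y \<in> U)" for U :: "L2 set"
    by (rule open_L2_def)
  show "f \<bullet> g = g \<bullet> f"
    by transfer (simp add: inner_commute)
  show "(f + g) \<bullet> k = f \<bullet> k + g \<bullet> k"
    by transfer (simp add: inner_add_left square_integrable_inner)
  show "(r *\<^sub>R f) \<bullet> g = r * (f \<bullet> g)"
    by transfer simp
  show "0 \<le> f \<bullet> f"
    by transfer simp
  show "(f \<bullet> f = 0) = (f = 0)"
  proof transfer
    fix f :: "real \<Rightarrow> complex"
    assume f: "square_integrable f \<and> square_integrable f \<and> (AE x in lebesgue. f x = f x)"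
    have "((LINT x|lebesgue. f x \<bullet> f x) = 0) \<longleftrightarrow> (AE x in lebesgue. f x \<bullet> f x = 0)"
      using f square_integrable_inner by (intro integral_nonneg_eq_0_iff_AE) auto
    then show "((LINT x|lebesgue. f x \<bullet> f x) = 0) =
      (square_integrable f \<and> square_integrable (\<lambda>_. 0) \<and> (AE x in lebesgue. f x = 0))"
      using f square_integrable_zero by simp
  qed
  show "norm f = sqrt (f \<bullet> f)" by (rule norm_L2_def)
qed

end

lemma square_integrable_rep_L2: "square_integrable (rep_L2 f)"
  using Quotient3_rep_reflp[OF Quotient3_L2] by blast

lemma norm_L2_rep: "norm f = sqrt (LINT x|lebesgue. (cmod (rep_L2 f x))\<^sup>2)"
  by (simp add: norm_L2_def inner_L2.rep_eq power2_norm_eq_inner)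

text \<open>Multiplication by a bounded measurable function (and, by convention, the zero operator
  for any other \<open>m\<close>).\<close>

lift_definition mult_op :: "(real \<Rightarrow> complex) \<Rightarrow> L2 \<Rightarrow> L2" is
  "\<lambda>m f. if m \<in> borel_measurable lebesgue \<and> bounded (range m) then (\<lambda>x. m x * f x) else (\<lambda>_. 0)"
  by (auto simp: square_integrable_mult_bounded square_integrable_zero elim: AE_mp)


section \<open>Distributions\<close>

text \<open>Distributions are linear functionals on test functions; their values at functions
  that are not test functions are irrelevant.\<close>

type_synonym distribution = "(real \<Rightarrow> complex) \<Rightarrow> complex"

definition vderiv :: "(real \<Rightarrow> complex) \<Rightarrow> real \<Rightarrow> complex" where
  "vderiv \<phi> x = vector_derivative \<phi> (at x)"

definition test_function :: "(real \<Rightarrow> complex) \<Rightarrow> bool" where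
  "test_function \<phi> \<longleftrightarrow>
     (\<forall>n x. (vderiv ^^ n) \<phi> differentiable (at x)) \<and> bounded {x. \<phi> x \<noteq> 0}"

definition distr_eq :: "distribution \<Rightarrow> distribution \<Rightarrow> bool" where
  "distr_eq S T \<longleftrightarrow> (\<forall>\<phi>. test_function \<phi> \<longrightarrow> S \<phi> = T \<phi>)"

definition distr_of :: "(real \<Rightarrow> complex) \<Rightarrow> distribution" where
  "distr_of u \<phi> = (LINT x|lebesgue. u x * \<phi> x)"

definition distr_deriv :: "distribution \<Rightarrow> distribution" where
  "distr_deriv T \<phi> = - T (vderiv \<phi>)"


section \<open>The semiclassical Schroedinger operator and its resolvent\<close>

definition ess_bounded :: "(real \<Rightarrow> complex) \<Rightarrow> bool" where
  "ess_bounded u \<longleftrightarrow> u \<in> borel_measurable lebesgue \<and> (\<exists>C. AE x in lebesgue. cmod (u x) \<le> C)"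

definition schroedinger_distr :: "real \<Rightarrow> (real \<Rightarrow> real) \<Rightarrow> L2 \<Rightarrow> distribution" where
  "schroedinger_distr h V u \<phi> =
     - (complex_of_real h)\<^sup>2 * distr_deriv (distr_deriv (distr_of (rep_L2 u))) \<phi>
     + distr_of (\<lambda>x. complex_of_real (V x) * rep_L2 u x) \<phi>"

definition schroedinger_domain :: "real \<Rightarrow> (real \<Rightarrow> real) \<Rightarrow> L2 set" where
  "schroedinger_domain h V = {u.
     ess_bounded (rep_L2 u) \<and>
     (\<exists>u'. ess_bounded (rep_L2 u') \<and>
        distr_eq (distr_deriv (distr_of (rep_L2 u))) (distr_of (rep_L2 u'))) \<and>
     (\<exists>f. distr_eq (schroedinger_distr h V u) (distr_of (rep_L2 f)))}"

text \<open>Only meaningful on \<^const>\<open>schroedinger_domain\<close>.\<close>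

definition schroedinger :: "real \<Rightarrow> (real \<Rightarrow> real) \<Rightarrow> L2 \<Rightarrow> L2" where
  "schroedinger h V u = (THE f. distr_eq (schroedinger_distr h V u) (distr_of (rep_L2 f)))"

definition resolvent :: "real \<Rightarrow> (real \<Rightarrow> real) \<Rightarrow> complex \<Rightarrow> L2 \<Rightarrow> L2" where
  "resolvent h V z =
     inv_into (schroedinger_domain h V) (\<lambda>u. schroedinger h V u - mult_op (\<lambda>_. z) u)"

definition exterior :: "real \<Rightarrow> real \<Rightarrow> complex" where
  "exterior R = indicator {x. \<bar>x\<bar> > R}"

definition weight :: "real \<Rightarrow> real \<Rightarrow> complex" where
  "weight \<delta> x = complex_of_real ((1 + \<bar>x\<bar>) powr (- ((1 + \<delta>) / 2)))"

definition weighted_resolvent ::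
  "real \<Rightarrow> real \<Rightarrow> real \<Rightarrow> (real \<Rightarrow> real) \<Rightarrow> complex \<Rightarrow> L2 \<Rightarrow> L2" where
  "weighted_resolvent R \<delta> h V z =
     mult_op (exterior R) \<circ> mult_op (weight \<delta>) \<circ> resolvent h V z \<circ>
     mult_op (weight \<delta>) \<circ> mult_op (exterior R)"

end

theory Submission
  imports Defs
begin

text \<open>
  Let \<open>u\<close> solve \<open>- h\<^sup>2 u'' + V u - z u = f\<close> with \<open>f = w g\<close>, where \<open>z = E + \<i> \<epsilon>\<close> and \<open>w\<close> is the weight
  cut off to \<open>\<bar>x\<bar> > R\<close>. Three integrated identities give the estimate. The imaginary part of the
  pairing of the equation with \<open>u\<close> bounds \<open>\<epsilon> \<parallel>u\<parallel>\<^sup>2\<close> by \<open>\<parallel>w u\<parallel> \<parallel>g\<parallel>\<close>. Differentiating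
  \<open>\<psi> (h\<^sup>2 \<bar>u'\<bar>\<^sup>2 + E \<bar>u\<bar>\<^sup>2)\<close>, where \<open>\<psi>\<close> is odd and bounded by 1, vanishes on the support of \<open>V\<close> and has
  derivative \<open>\<delta> (1 + R) powr \<delta> w\<^sup>2\<close>, bounds \<open>w u\<close> and \<open>w u'\<close> up to an error \<open>\<epsilon> \<parallel>u\<parallel> \<parallel>\<psi> u'\<parallel>\<close>.
  Differentiating \<open>\<psi>\<^sup>2 Re (u' cnj u)\<close> controls \<open>\<psi> u'\<close>, and the error is absorbed because
  \<open>2 \<epsilon> \<le> E\<close>.

  The first identity also gives injectivity of \<open>P - z\<close>. Surjectivity follows by variation of
  constants from the two solutions of the homogeneous equation that decay at \<open>\<infinity>\<close> and at \<open>- \<infinity>\<close>;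
  their Wronskian does not vanish because their Weyl functions lie in opposite half-planes.
\<close>

section \<open>Absolutely continuous functions\<close>

text \<open>The potential is only integrable, so \<open>u''\<close> is a locally integrable function
  and not a pointwise derivative. All calculus therefore runs through \<open>primitive F f\<close>:
  the increments of \<open>F\<close> are the integrals of the locally integrable \<open>f\<close>,
  that is, \<open>F\<close> is locally absolutely continuous with derivative \<open>f\<close> almost
  everywhere. The energy identities are product rules for such functions.

  The absorption is uniform in \<epsilon> because the first identity costs \<epsilon> to the power
  -1/2 in the norm of \<open>u\<close> and, through the third, the same power in that of
  \<open>\<psi> u'\<close>, while the error carries a full factor \<epsilon>. The factor \<psi> has
  to stay on \<open>u'\<close>, since only \<open>\<psi> u'\<close> can be estimated without meeting
  \<open>V\<close>.

  The resolvent is an \<open>inv_into\<close>, hence arbitrary off the range of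
  \<open>P - z\<close>. Surjectivity is needed for integrable \<open>V\<close> of any size, so a
  Neumann series with a geometric rate would not do; the decaying solutions come from a Volterra
  equation instead.\<close>

definition primitive :: "(real \<Rightarrow> complex) \<Rightarrow> (real \<Rightarrow> complex) \<Rightarrow> bool" where
  "primitive F f \<longleftrightarrow> (\<forall>a b. a \<le> b \<longrightarrow>
     f absolutely_integrable_on {a..b} \<and> (LINT x:{a..b}|lebesgue. f x) = F b - F a)"

definition locally_integrable :: "(real \<Rightarrow> complex) \<Rightarrow> bool" where
  "locally_integrable f \<longleftrightarrow> (\<forall>a b. f absolutely_integrable_on {a..b})"

lemma borel_measurable_lebesgueI:
  "f \<in> borel_measurable borel \<Longrightarrow> f \<in> borel_measurable lebesgue"
  by (simp add: measurable_completion)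

lemma continuous_on_lebesgue_measurable:
  fixes f :: "real \<Rightarrow> 'a::topological_space"
  assumes "continuous_on UNIV f"
  shows "f \<in> borel_measurable lebesgue"
  using assms by (intro borel_measurable_lebesgueI borel_measurable_continuous_onI)

lemma primitive_locally_integrable: "primitive F f \<Longrightarrow> locally_integrable f"
  unfolding primitive_def locally_integrable_def
  by (metis absolutely_integrable_on_null atLeastatMost_empty_iff2 set_integrable_empty)

lemma locally_integrable_measurable:
  assumes "locally_integrable f"
  shows "f \<in> borel_measurable lebesgue"
proof (rule borel_measurable_LIMSEQ_metric)
  fix n :: nat
  have "f absolutely_integrable_on {- real n..real n}"
    using assms unfolding locally_integrable_def by blast
  then show "(\<lambda>x. indicator {- real n..real n} x *\<^sub>R f x) \<in> borel_measurable lebesgue"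
    unfolding set_integrable_def by (rule borel_measurable_integrable)
next
  fix x :: real
  obtain N where N: "\<bar>x\<bar> \<le> real N"
    using real_arch_simple by blast
  have "eventually (\<lambda>n. indicator {- real n..real n} x *\<^sub>R f x = f x) sequentially"
    using N by (intro eventually_sequentiallyI[of N]) (auto simp: indicator_def)
  then show "(\<lambda>n. indicator {- real n..real n} x *\<^sub>R f x) \<longlonglongrightarrow> f x"
    by (rule tendsto_eventually)
qed

lemma primitive_measurable_deriv: "primitive F f \<Longrightarrow> f \<in> borel_measurable lebesgue"
  by (intro locally_integrable_measurable primitive_locally_integrable)

lemma primitive_integrable: "primitive F f \<Longrightarrow> f absolutely_integrable_on {a..b}"
  using primitive_locally_integrable unfolding locally_integrable_def by blast

lemma primitive_integral: "primitive F f \<Longrightarrow> a \<le> b \<Longrightarrow> (LINT x:{a..b}|lebesgue. f x) = F b - F a"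
  unfolding primitive_def by blast

lemma primitive_continuous:
  assumes "primitive F f"
  shows "continuous_on UNIV F"
proof -
  have "isCont F x" for x
  proof -
    have "continuous_on {x - 1..x + 1} (\<lambda>y. F (x - 1) + integral {x - 1..y} f)"
      using primitive_integrable[OF assms]
      by (intro continuous_intros indefinite_integral_continuous_1 set_lebesgue_integral_eq_integral)
    moreover have "F (x - 1) + integral {x - 1..y} f = F y" if "y \<in> {x - 1..x + 1}" for y
      using that primitive_integral[OF assms, of "x - 1" y]
        set_lebesgue_integral_eq_integral(2)[OF primitive_integrable[OF assms, of "x - 1" y]]
      by simp
    ultimately have "continuous_on {x - 1..x + 1} F"
      by (rule continuous_on_eq)
    then show ?thesis
      by (rule continuous_on_interior) simp
  qed
  then show ?thesis
    by (simp add: continuous_at_imp_continuous_on)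
qed

lemma primitive_measurable: "primitive F f \<Longrightarrow> F \<in> borel_measurable lebesgue"
  by (intro continuous_on_lebesgue_measurable primitive_continuous)

lemma absolutely_integrable_continuous_mult:
  fixes f g :: "real \<Rightarrow> complex"
  assumes f: "f absolutely_integrable_on {a..b}" and g: "continuous_on UNIV g"
  shows "(\<lambda>x. g x * f x) absolutely_integrable_on {a..b}"
proof -
  have "bounded (g ` {a..b})"
    by (meson compact_Icc compact_continuous_image compact_imp_bounded continuous_on_subset g
        subset_UNIV)
  then obtain C where C: "\<And>x. x \<in> {a..b} \<Longrightarrow> cmod (g x) \<le> C"
    by (meson bounded_iff imageI)
  have [measurable]: "g \<in> borel_measurable lebesgue"
    by (rule continuous_on_lebesgue_measurable[OF g])
  have int: "integrable lebesgue (\<lambda>x. indicator {a..b} x *\<^sub>R f x)"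
    using f by (simp add: set_integrable_def)
  note [measurable] = borel_measurable_integrable[OF int]
  have "integrable lebesgue (\<lambda>x. g x * (indicator {a..b} x *\<^sub>R f x))"
  proof (rule Bochner_Integration.integrable_bound)
    show "integrable lebesgue (\<lambda>x. C *\<^sub>R (indicator {a..b} x *\<^sub>R f x))"
      using int by (rule integrable_scaleR_right)
    have "norm (g x * (indicator {a..b} x *\<^sub>R f x)) \<le> norm (C *\<^sub>R (indicator {a..b} x *\<^sub>R f x))" for x
      using C[of x] by (cases "x \<in> {a..b}") (auto simp: norm_mult intro!: mult_right_mono)
    then show "AE x in lebesgue. norm (g x * (indicator {a..b} x *\<^sub>R f x))
        \<le> norm (C *\<^sub>R (indicator {a..b} x *\<^sub>R f x))"
      by simp
  qed measurable
  then show ?thesis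
    by (simp add: set_integrable_def mult.left_commute scaleR_conv_of_real)
qed

lemma locally_integrable_continuous_mult:
  "locally_integrable f \<Longrightarrow> continuous_on UNIV g \<Longrightarrow> locally_integrable (\<lambda>x. g x * f x)"
  unfolding locally_integrable_def by (blast intro: absolutely_integrable_continuous_mult)

lemma locally_integrable_add:
  "locally_integrable f \<Longrightarrow> locally_integrable g \<Longrightarrow> locally_integrable (\<lambda>x. f x + g x)"
  unfolding locally_integrable_def by (blast intro: set_integral_add(1))

lemma locally_integrable_cmult: "locally_integrable f \<Longrightarrow> locally_integrable (\<lambda>x. c * f x)"
  unfolding locally_integrable_def by (blast intro: set_integrable_mult_right)

lemma locally_integrable_continuous: "continuous_on UNIV f \<Longrightarrow> locally_integrable f"
  unfolding locally_integrable_def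
  by (meson absolutely_integrable_continuous_real continuous_on_subset subset_UNIV)

lemma integrable_imp_locally_integrable: "integrable lebesgue f \<Longrightarrow> locally_integrable f"
  unfolding locally_integrable_def set_integrable_def
  by (auto intro!: integrable_mult_indicator)

lemma locally_integrable_AE_cong:
  assumes "locally_integrable f" "g \<in> borel_measurable lebesgue" "AE x in lebesgue. f x = g x"
  shows "locally_integrable g"
  unfolding locally_integrable_def
proof (intro allI)
  fix a b
  have [measurable]: "f \<in> borel_measurable lebesgue" "g \<in> borel_measurable lebesgue"
    using assms(2) locally_integrable_measurable[OF assms(1)] by auto
  have "integrable lebesgue (\<lambda>x. indicator {a..b} x *\<^sub>R f x)"
    using assms by (auto simp: locally_integrable_def set_integrable_def)
  moreover have "AE x in lebesgue. indicator {a..b} x *\<^sub>R f x = indicator {a..b} x *\<^sub>R g x"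
    using assms(3) by eventually_elim simp
  moreover have "(\<lambda>x. indicator {a..b} x *\<^sub>R g x) \<in> borel_measurable lebesgue"
    using assms(2) by (intro borel_measurable_scaleR borel_measurable_indicator) simp_all
  ultimately show "g absolutely_integrable_on {a..b}"
    unfolding set_integrable_def using integrable_cong_AE_imp by blast
qed

text \<open>Representatives chosen by \<open>rep_L2\<close> are known only almost everywhere; this
  lets them replace one another in the density while the continuous function \<open>F\<close> stays
  fixed.\<close>

lemma primitive_AE_cong:
  assumes "primitive F f" "g \<in> borel_measurable lebesgue" "AE x in lebesgue. f x = g x"
  shows "primitive F g"
  unfolding primitive_def
proof (intro allI impI conjI)
  fix a b :: real assume ab: "a \<le> b"
  show "g absolutely_integrable_on {a..b}"
    using locally_integrable_AE_cong[OF primitive_locally_integrable[OF assms(1)] assms(2,3)]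
    by (auto simp: locally_integrable_def)
  have [measurable]: "f \<in> borel_measurable lebesgue" "g \<in> borel_measurable lebesgue"
    using assms(2) primitive_measurable_deriv[OF assms(1)] by auto
  have "(LINT x:{a..b}|lebesgue. g x) = (LINT x:{a..b}|lebesgue. f x)"
    unfolding set_lebesgue_integral_def
  proof (rule integral_cong_AE)
    show "AE x in lebesgue. indicator {a..b} x *\<^sub>R g x = indicator {a..b} x *\<^sub>R f x"
      using assms(3) by eventually_elim simp
  qed (intro borel_measurable_scaleR borel_measurable_indicator; simp)+
  then show "(LINT x:{a..b}|lebesgue. g x) = F b - F a"
    using primitive_integral[OF assms(1) ab] by simp
qed

section \<open>Closure properties of primitives\<close>

lemma primitive_add:
  "primitive F f \<Longrightarrow> primitive G g \<Longrightarrow> primitive (\<lambda>x. F x + G x) (\<lambda>x. f x + g x)"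
  unfolding primitive_def by auto

lemma primitive_cmult: "primitive F f \<Longrightarrow> primitive (\<lambda>x. c * F x) (\<lambda>x. c * f x)"
  unfolding primitive_def by (auto simp: right_diff_distrib)

lemma primitive_const: "primitive (\<lambda>_. c) (\<lambda>_. 0)"
  unfolding primitive_def by auto

lemma primitive_uminus: "primitive F f \<Longrightarrow> primitive (\<lambda>x. - F x) (\<lambda>x. - f x)"
  using primitive_cmult[of F f "-1"] by simp

lemma primitive_diff:
  "primitive F f \<Longrightarrow> primitive G g \<Longrightarrow> primitive (\<lambda>x. F x - G x) (\<lambda>x. f x - g x)"
  using primitive_add[OF _ primitive_uminus, of F f G g] by simp

lemma primitive_cnj:
  assumes "primitive F f"
  shows "primitive (\<lambda>x. cnj (F x)) (\<lambda>x. cnj (f x))"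
  unfolding primitive_def
proof (intro allI impI conjI)
  fix a b :: real assume ab: "a \<le> b"
  have *: "(\<lambda>x. indicator {a..b} x *\<^sub>R cnj (f x)) = (\<lambda>x. cnj (indicator {a..b} x *\<^sub>R f x))"
    by (simp add: scaleR_conv_of_real)
  show "(\<lambda>x. cnj (f x)) absolutely_integrable_on {a..b}"
    using primitive_integrable[OF assms, of a b] unfolding set_integrable_def * complex_integrable_cnj .
  have "(LINT x|lebesgue. cnj (indicator {a..b} x *\<^sub>R f x)) = cnj (F b - F a)"
    unfolding primitive_integral[OF assms ab, symmetric] set_lebesgue_integral_def
    by (rule Bochner_Integration.integral_cnj)
  then show "(LINT x:{a..b}|lebesgue. cnj (f x)) = cnj (F b) - cnj (F a)"
    unfolding set_lebesgue_integral_def * by (simp only: complex_cnj_diff)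
qed

lemma primitive_deriv:
  assumes "\<And>x. (F has_vector_derivative f x) (at x)" and "continuous_on UNIV f"
  shows "primitive F f"
  unfolding primitive_def
proof (intro allI impI conjI)
  fix a b :: real assume ab: "a \<le> b"
  show *: "f absolutely_integrable_on {a..b}"
    using locally_integrable_continuous[OF assms(2)] by (auto simp: locally_integrable_def)
  have "(f has_integral F b - F a) {a..b}"
    using assms(1) by (intro fundamental_theorem_of_calculus ab) (blast intro: has_vector_derivative_at_within)
  then show "(LINT x:{a..b}|lebesgue. f x) = F b - F a"
    using set_lebesgue_integral_eq_integral(2)[OF *] by (simp add: integral_unique)
qed

text \<open>Reflection turns statements about \<open>- \<infinity>\<close> into statements about
  \<infinity>, so that limits, tails and decaying solutions are treated on right half-lines
  only.\<close>

lemma primitive_reflect: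
  assumes "primitive F f"
  shows "primitive (\<lambda>x. F (- x)) (\<lambda>x. - f (- x))"
  unfolding primitive_def
proof (intro allI impI conjI)
  fix a b :: real assume ab: "a \<le> b"
  have *: "f absolutely_integrable_on {-b..-a}"
    using primitive_integrable[OF assms] .
  have ind: "indicat_real {a..b} x = indicator {-b..-a} (- x)" for x
    by (auto simp: indicator_def)
  have eq: "(\<lambda>x. indicat_real {a..b} x *\<^sub>R f (- x)) = (\<lambda>x. (\<lambda>x. indicator {-b..-a} x *\<^sub>R f x) (- x))"
    by (simp add: ind)
  have 1: "integrable lebesgue (\<lambda>x. indicat_real {a..b} x *\<^sub>R f (- x))"
    using * unfolding eq set_integrable_def
    using lebesgue_integrable_real_affine[of "\<lambda>x. indicator {-b..-a} x *\<^sub>R f x" "-1" 0] by simp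
  then show "(\<lambda>x. - f (- x)) absolutely_integrable_on {a..b}"
    by (simp add: set_integrable_def)
  have "(LINT x|lebesgue. indicat_real {a..b} x *\<^sub>R f (- x)) = F (-a) - F (-b)"
    using primitive_integral[OF assms, of "-b" "-a"] ab unfolding eq
    using lebesgue_integral_real_affine[of "-1" "\<lambda>x. indicator {-b..-a} x *\<^sub>R f x" 0]
    by (simp add: set_lebesgue_integral_def)
  then show "(LINT x:{a..b}|lebesgue. - f (- x)) = F (- b) - F (- a)"
    by (simp add: set_lebesgue_integral_def)
qed

text \<open>Completion does not change the measure of Borel sets, so a countable cover of
  \<open>lborel\<close> by sets of finite measure also serves \<open>lebesgue\<close>. Fubini's
  theorem is applied below to the completed measure.\<close>

lemma sigma_finite_lebesgue: "sigma_finite_measure (lebesgue :: real measure)"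
proof
  obtain A :: "real set set" where A: "countable A" "A \<subseteq> sets lborel" "\<Union>A = space lborel"
    "\<forall>a\<in>A. emeasure lborel a \<noteq> \<infinity>"
    using lborel.sigma_finite_countable by blast
  have "\<forall>a\<in>A. emeasure lebesgue a \<noteq> \<infinity>"
    using A(2,4) by (auto simp: emeasure_completion main_part_sets subset_eq)
  moreover have "A \<subseteq> sets lebesgue" using A(2) by auto
  ultimately show "\<exists>A::real set set. countable A \<and> A \<subseteq> sets lebesgue \<and> \<Union>A = space lebesgue \<and>
      (\<forall>a\<in>A. emeasure lebesgue a \<noteq> \<infinity>)"
    using A(1,3) by auto
qed

text \<open>Fubini's theorem for \<open>f s * g t\<close> on the triangle \<open>a \<le> s \<le> t \<le> b\<close>.\<close>

lemma primitive_mult: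
  assumes F: "primitive F f" and G: "primitive G g"
  shows "primitive (\<lambda>x. F x * G x) (\<lambda>x. f x * G x + F x * g x)"
  unfolding primitive_def
proof (intro allI impI conjI)
  fix a b :: real assume ab: "a \<le> b"
  note fi = primitive_integrable[OF F] and gi = primitive_integrable[OF G]
  note cF = primitive_continuous[OF F] and cG = primitive_continuous[OF G]
  have fG: "(\<lambda>x. f x * G x) absolutely_integrable_on {a..b}"
    using absolutely_integrable_continuous_mult[OF fi cG] by (simp add: mult.commute)
  have Fg: "(\<lambda>x. F x * g x) absolutely_integrable_on {a..b}"
    using absolutely_integrable_continuous_mult[OF gi cF] .
  from fG Fg show "(\<lambda>x. f x * G x + F x * g x) absolutely_integrable_on {a..b}"
    by (rule set_integral_add)
  define M where "M = (lebesgue :: real measure)"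
  interpret sigma_finite_measure M
    unfolding M_def by (rule sigma_finite_lebesgue)
  interpret P: pair_sigma_finite M M ..
  define f0 where "f0 x = indicator {a..b} x *\<^sub>R f x" for x
  define g0 where "g0 x = indicator {a..b} x *\<^sub>R g x" for x
  have f0i: "integrable M f0" and g0i: "integrable M g0"
    using fi[of a b] gi[of a b] unfolding f0_def g0_def set_integrable_def M_def by auto
  have [measurable]: "f0 \<in> borel_measurable M" "g0 \<in> borel_measurable M"
    using f0i g0i by auto
  have idM[measurable]: "(\<lambda>x. x) \<in> measurable M borel"
    unfolding M_def by (rule borel_measurable_lebesgueI) simp
  have [measurable]: "Measurable.pred (M \<Otimes>\<^sub>M M) (\<lambda>(s, t). s \<le> t)"
    unfolding case_prod_beta by measurable
  define H where "H = (\<lambda>(s, t). (f0 s * g0 t) * of_bool (s \<le> t))"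
  have fg: "integrable (M \<Otimes>\<^sub>M M) (\<lambda>(s, t). f0 s * g0 t)"
  proof (rule P.Fubini_integrable)
    show "(\<lambda>(s, t). f0 s * g0 t) \<in> borel_measurable (M \<Otimes>\<^sub>M M)" by measurable
    show "integrable M (\<lambda>x. LINT y|M. norm (case (x, y) of (s, t) \<Rightarrow> f0 s * g0 t))"
      using f0i by (simp add: norm_mult)
    show "AE x in M. integrable M (\<lambda>y. case (x, y) of (s, t) \<Rightarrow> f0 s * g0 t)"
      using g0i by simp
  qed
  have Hi: "integrable (M \<Otimes>\<^sub>M M) H"
  proof (rule Bochner_Integration.integrable_bound[OF fg])
    show "H \<in> borel_measurable (M \<Otimes>\<^sub>M M)" unfolding H_def by measurable
  qed (auto simp: H_def)
  have "(LINT t|M. (LINT s|M. H (s, t))) = (LINT s|M. (LINT t|M. H (s, t)))"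
    using P.Fubini_integral[of "\<lambda>s t. H (s, t)"] Hi by simp
  moreover have "(LINT s|M. H (s, t)) = indicator {a..b} t *\<^sub>R (F t * g t - F a * g t)" for t
  proof -
    have "(LINT s|M. H (s, t)) = (LINT s|M. g0 t * (f0 s * of_bool (s \<le> t)))"
      by (simp add: H_def mult_ac)
    also have "\<dots> = g0 t * (LINT s|M. f0 s * of_bool (s \<le> t))" by simp
    also have "\<dots> = indicator {a..b} t *\<^sub>R (F t * g t - F a * g t)"
    proof (cases "t \<in> {a..b}")
      case True
      then have "f0 s * of_bool (s \<le> t) = indicator {a..t} s *\<^sub>R f s" for s
        by (auto simp: f0_def indicator_def)
      then have *: "(LINT s|M. f0 s * of_bool (s \<le> t)) = F t - F a"
        using primitive_integral[OF F, of a t] True by (simp add: M_def set_lebesgue_integral_def)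
      show ?thesis
        unfolding * using True by (simp add: g0_def algebra_simps)
    qed (simp add: g0_def)
    finally show ?thesis .
  qed
  moreover have "(LINT t|M. H (s, t)) = indicator {a..b} s *\<^sub>R (f s * G b - f s * G s)" for s
  proof -
    have "(LINT t|M. H (s, t)) = (LINT t|M. f0 s * (g0 t * of_bool (s \<le> t)))"
      by (simp add: H_def mult_ac)
    also have "\<dots> = f0 s * (LINT t|M. g0 t * of_bool (s \<le> t))" by simp
    also have "\<dots> = indicator {a..b} s *\<^sub>R (f s * G b - f s * G s)"
    proof (cases "s \<in> {a..b}")
      case True
      then have "g0 t * of_bool (s \<le> t) = indicator {s..b} t *\<^sub>R g t" for t
        by (auto simp: g0_def indicator_def)
      then have *: "(LINT t|M. g0 t * of_bool (s \<le> t)) = G b - G s"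
        using primitive_integral[OF G, of s b] True by (simp add: M_def set_lebesgue_integral_def)
      show ?thesis
        unfolding * using True by (simp add: f0_def algebra_simps)
    qed (simp add: f0_def)
    finally show ?thesis .
  qed
  \<comment> \<open>On the triangle the inner integrals are the increments \<open>F t - F a\<close>
    and \<open>G b - G s\<close>; equating the two orders of integration is integration by
    parts.\<close>
  ultimately have "(LINT t:{a..b}|lebesgue. F t * g t - F a * g t) =
      (LINT s:{a..b}|lebesgue. f s * G b - f s * G s)"
    by (simp add: set_lebesgue_integral_def M_def)
  then have "(LINT t:{a..b}|lebesgue. F t * g t) - F a * (G b - G a) =
      (F b - F a) * G b - (LINT s:{a..b}|lebesgue. f s * G s)"
    using Fg fG fi gi primitive_integral[OF F ab] primitive_integral[OF G ab]
    by (simp add: set_integral_diff)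
  then show "(LINT x:{a..b}|lebesgue. f x * G x + F x * g x) = F b * G b - F a * G a"
    using Fg fG by (simp add: algebra_simps)
qed

lemma primitive_of_locally_integrable:
  assumes f: "locally_integrable f"
  shows "\<exists>F. primitive F f \<and> F 0 = 0"
proof -
  define F where "F x = (if 0 \<le> x then (LINT t:{0..x}|lebesgue. f t) else - (LINT t:{x..0}|lebesgue. f t))" for x
  have i: "f absolutely_integrable_on {a..b}" for a b
    using f by (auto simp: locally_integrable_def)
  have split: "(LINT t:{a..c}|lebesgue. f t) = (LINT t:{a..b}|lebesgue. f t) + (LINT t:{b..c}|lebesgue. f t)"
    if "a \<le> b" "b \<le> c" for a b c
    using that i[of a b] i[of b c] i[of a c]
    by (simp add: set_lebesgue_integral_eq_integral Henstock_Kurzweil_Integration.integral_combine)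
  have "(LINT t:{a..b}|lebesgue. f t) = F b - F a" if "a \<le> b" for a b
    using that split[of a b 0] split[of a 0 b] split[of 0 a b] by (auto simp: F_def)
  moreover have "F 0 = 0"
    using split[of 0 0 0] by (simp add: F_def)
  ultimately show ?thesis
    using i unfolding primitive_def by blast
qed

text \<open>The constant of integration is pinned at 0, so that an identity between two primitives
  (reality, oddness, a constant Wronskian) need only be checked at one point.\<close>

lemma primitive_unique:
  assumes "primitive F f" "primitive G g" "AE x in lebesgue. f x = g x"
  shows "F x - G x = F 0 - G 0"
proof -
  have "primitive (\<lambda>x. F x - G x) (\<lambda>x. f x - g x)"
    using assms by (intro primitive_diff)
  then have "primitive (\<lambda>x. F x - G x) (\<lambda>x. 0)"
    by (rule primitive_AE_cong) (use assms(3) in auto)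
  then have "F b - G b - (F a - G a) = 0" if "a \<le> b" for a b
    using primitive_integral[of "\<lambda>x. F x - G x" "\<lambda>x. 0" a b] that by simp
  from this[of 0 x] this[of x 0] show ?thesis by (cases "0 \<le> x") (auto simp: algebra_simps)
qed

section \<open>Limits at infinity and vanishing boundary terms\<close>

lemma set_integrable_at_top_limit:
  fixes f :: "real \<Rightarrow> complex"
  assumes "f absolutely_integrable_on {a..}"
  shows "((\<lambda>b. LINT x:{a..b}|lebesgue. f x) \<longlongrightarrow> (LINT x:{a..}|lebesgue. f x)) at_top"
  using tendsto_set_lebesgue_integral_at_top[of a lebesgue f] assms by simp

text \<open>If \<open>F\<close> is a primitive with limit \<open>L\<close> at \<infinity>, the tail
  integral from \<open>x\<close> equals \<open>L - F x\<close>; both claims are read off from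
  that.\<close>

lemma primitive_tail:
  assumes f: "\<And>a. f absolutely_integrable_on {a..}"
  shows "primitive (\<lambda>x. - (LINT t:{x..}|lebesgue. f t)) f"
    and "((\<lambda>x. LINT t:{x..}|lebesgue. f t) \<longlongrightarrow> 0) at_top"
proof -
  have "locally_integrable f"
    unfolding locally_integrable_def using set_integrable_subset[OF f] by (metis Icc_subset_Ici_iff atLeastAtMost_borel dual_order.refl sets_completionI_sets sets_lborel)
  then obtain F where F: "primitive F f"
    using primitive_of_locally_integrable by blast
  have lim: "((\<lambda>b. F b - F a) \<longlongrightarrow> (LINT x:{a..}|lebesgue. f x)) at_top" for a
  proof (rule Lim_transform_eventually[OF set_integrable_at_top_limit[OF f]])
    show "\<forall>\<^sub>F b in at_top. (LINT x:{a..b}|lebesgue. f x) = F b - F a"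
      using eventually_ge_at_top[of a] by eventually_elim (rule primitive_integral[OF F])
  qed
  define L where "L = (LINT x:{0..}|lebesgue. f x) + F 0"
  have L: "(F \<longlongrightarrow> L) at_top"
    unfolding L_def using tendsto_add[OF lim[of 0] tendsto_const[of "F 0"]] by simp
  have tail: "(LINT x:{a..}|lebesgue. f x) = L - F a" for a
    using tendsto_unique[OF _ lim tendsto_diff[OF L tendsto_const[of "F a"]]] by simp
  have "primitive (\<lambda>x. F x + (- L)) (\<lambda>x. f x + 0)"
    by (intro primitive_add F primitive_const)
  then show "primitive (\<lambda>x. - (LINT t:{x..}|lebesgue. f t)) f"
    by (simp add: tail)
  show "((\<lambda>x. LINT t:{x..}|lebesgue. f t) \<longlongrightarrow> 0) at_top"
    unfolding tail using tendsto_diff[OF tendsto_const[of L] L] by simp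
qed

lemma limit_at_top_integrable_zero:
  fixes F :: "real \<Rightarrow> complex"
  assumes i: "integrable lebesgue F" and l: "(F \<longlongrightarrow> l) at_top"
  shows "l = 0"
proof (rule ccontr)
  assume "l \<noteq> 0"
  have "((\<lambda>x. cmod (F x)) \<longlongrightarrow> cmod l) at_top"
    using l by (rule tendsto_norm)
  then have "eventually (\<lambda>x. cmod l / 2 < cmod (F x)) at_top"
    using \<open>l \<noteq> 0\<close> by (intro order_tendstoD(1)) auto
  then obtain N where N: "\<And>x. N \<le> x \<Longrightarrow> cmod l / 2 < cmod (F x)"
    unfolding eventually_at_top_linorder by blast
  have "cmod l / 2 * real n \<le> (LINT x|lebesgue. cmod (F x))" for n
  proof -
    have "(LINT x|lebesgue. indicator {N..N + real n} x * (cmod l / 2)) \<le> (LINT x|lebesgue. cmod (F x))"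
    proof (rule integral_mono)
      show "integrable lebesgue (\<lambda>x. indicator {N..N + real n} x * (cmod l / 2))"
        by (intro integrable_mult_left integrable_real_indicator) auto
      show "integrable lebesgue (\<lambda>x. cmod (F x))" using i by simp
      show "indicator {N..N + real n} x * (cmod l / 2) \<le> cmod (F x)" for x
        using N[of x] by (auto simp: indicator_def)
    qed
    then show ?thesis by (simp add: mult.commute)
  qed
  moreover obtain n where "(LINT x|lebesgue. cmod (F x)) < real n * (cmod l / 2)"
    using reals_Archimedean3[of "cmod l / 2"] \<open>l \<noteq> 0\<close> by auto
  ultimately show False
    by (metis linorder_not_less mult.commute)
qed

text \<open>Integrability of the density on a half-line makes \<open>F\<close> converge;
  integrability of \<open>F\<close> itself leaves 0 as the only possible limit.\<close>

lemma primitive_at_top_zero: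
  assumes F: "primitive F f" and Fi: "integrable lebesgue F" and fi: "f absolutely_integrable_on {a..}"
  shows "(F \<longlongrightarrow> 0) at_top" and "(LINT x:{a..}|lebesgue. f x) = - F a"
proof -
  have lim: "((\<lambda>b. F b - F a) \<longlongrightarrow> (LINT x:{a..}|lebesgue. f x)) at_top"
  proof (rule Lim_transform_eventually[OF set_integrable_at_top_limit[OF fi]])
    show "\<forall>\<^sub>F b in at_top. (LINT x:{a..b}|lebesgue. f x) = F b - F a"
      using eventually_ge_at_top[of a] by eventually_elim (rule primitive_integral[OF F])
  qed
  have L: "(F \<longlongrightarrow> (LINT x:{a..}|lebesgue. f x) + F a) at_top"
    using tendsto_add[OF lim tendsto_const[of "F a"]] by simp
  have "(LINT x:{a..}|lebesgue. f x) + F a = 0"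
    by (rule limit_at_top_integrable_zero[OF Fi L])
  then show "(F \<longlongrightarrow> 0) at_top" and "(LINT x:{a..}|lebesgue. f x) = - F a"
    using L by (auto simp: eq_neg_iff_add_eq_0)
qed

lemma lebesgue_integral_split:
  fixes f :: "real \<Rightarrow> complex"
  assumes "integrable lebesgue f"
  shows "(LINT x|lebesgue. f x) = (LINT x:{a..}|lebesgue. f x) + (LINT x:{- a..}|lebesgue. f (- x))"
proof -
  have i: "f absolutely_integrable_on {a..}" "f absolutely_integrable_on {..a}"
    using assms unfolding set_integrable_def by (auto intro: integrable_mult_indicator)
  have "(LINT x:{a..} \<union> {..a}|lebesgue. f x) = (LINT x:{a..}|lebesgue. f x) + (LINT x:{..a}|lebesgue. f x)"
  proof (rule set_integral_Un_AE)
    have "AE x in lebesgue. x \<noteq> a"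
      by (intro AE_I[of _ _ "{a}"]) auto
    then show "AE x in lebesgue. \<not> (x \<in> {a..} \<and> x \<in> {..a})"
      by eventually_elim auto
  qed (use i in auto)
  moreover have "{a..} \<union> {..a} = UNIV" by auto
  moreover have "(LINT x:{..a}|lebesgue. f x) = (LINT x:{- a..}|lebesgue. f (- x))"
  proof -
    have "indicat_real {- a..} x = indicator {..a} (- x)" for x by (auto simp: indicator_def)
    then show ?thesis
      unfolding set_lebesgue_integral_def
      using lebesgue_integral_real_affine[of "-1" "\<lambda>x. indicator {..a} x *\<^sub>R f x" 0] by simp
  qed
  ultimately show ?thesis
    by (simp add: set_lebesgue_integral_def)
qed

lemma integrable_reflect: "integrable lebesgue f \<Longrightarrow> integrable lebesgue (\<lambda>x. f (- x :: real) :: complex)"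
  using lebesgue_integrable_real_affine[of f "-1" 0] by simp

text \<open>The energy identities are integrated over the line through this lemma, which disposes of
  boundary terms without cutoffs. The negative half-line is the positive one for the reflected
  function.\<close>

lemma primitive_integral_zero:
  assumes F: "primitive F f" and Fi: "integrable lebesgue F" and fi: "integrable lebesgue f"
  shows "(LINT x|lebesgue. f x) = 0"
proof -
  have 1: "(LINT x:{0..}|lebesgue. f x) = - F 0"
    using fi by (intro primitive_at_top_zero(2)[OF F Fi])
       (auto simp: set_integrable_def intro!: integrable_mult_indicator)
  have 2: "(LINT x:{0..}|lebesgue. - f (- x)) = - F (- 0)"
    using integrable_reflect[OF fi]
    by (intro primitive_at_top_zero(2)[OF primitive_reflect[OF F] integrable_reflect[OF Fi]])
       (auto simp: set_integrable_def intro!: integrable_mult_indicator)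
  show ?thesis
    using lebesgue_integral_split[OF fi, of 0] 1 2 by (simp add: set_lebesgue_integral_def)
qed

section \<open>Test functions and weak derivatives\<close>

definition smooth :: "(real \<Rightarrow> complex) \<Rightarrow> bool" where
  "smooth \<phi> \<longleftrightarrow> (\<forall>n x. (vderiv ^^ n) \<phi> differentiable (at x))"

lemma test_function_iff: "test_function \<phi> \<longleftrightarrow> smooth \<phi> \<and> bounded {x. \<phi> x \<noteq> 0}"
  by (simp add: test_function_def smooth_def)

text \<open>Smoothness asks that all iterates of \<open>vderiv\<close> be differentiable. A class in
  which each member has a derivative again in the class contains all these iterates, so none of them
  has to be computed.\<close>

lemma smooth_coinduct:
  assumes "P \<phi>" and step: "\<And>\<phi>. P \<phi> \<Longrightarrow> \<exists>\<psi>. P \<psi> \<and> (\<forall>x. (\<phi> has_vector_derivative \<psi> x) (at x))"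
  shows "smooth \<phi>"
proof -
  have eq: "vderiv \<phi> = \<psi>" if "\<forall>x. (\<phi> has_vector_derivative \<psi> x) (at x)" for \<phi> \<psi>
    using that by (auto simp: vderiv_def fun_eq_iff intro: vector_derivative_at)
  have "P ((vderiv ^^ n) \<phi>)" for n
  proof (induction n)
    case (Suc n)
    then obtain \<psi> where "P \<psi>" "\<forall>x. ((vderiv ^^ n) \<phi> has_vector_derivative \<psi> x) (at x)"
      using step by blast
    then show ?case using eq by auto
  qed (use assms in simp)
  then show ?thesis
    unfolding smooth_def using step differentiableI_vector by blast
qed

lemma smooth_vderiv: "smooth \<phi> \<Longrightarrow> smooth (vderiv \<phi>)"
  unfolding smooth_def by (metis comp_apply funpow_Suc_right)

lemma smooth_has_vderiv: "smooth \<phi> \<Longrightarrow> (\<phi> has_vector_derivative vderiv \<phi> x) (at x)"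
  unfolding smooth_def vderiv_def
  by (metis funpow_0 vector_derivative_works)

lemma smooth_antideriv:
  assumes "smooth \<psi>" "\<And>x. (\<phi> has_vector_derivative \<psi> x) (at x)"
  shows "smooth \<phi>"
  by (rule smooth_coinduct[where P = "\<lambda>f. f = \<phi> \<or> smooth f"])
     (use assms smooth_vderiv smooth_has_vderiv in blast)+

lemma smooth_const: "smooth (\<lambda>_. c)"
  by (rule smooth_coinduct[where P = "\<lambda>f. \<exists>c. f = (\<lambda>_. c)"])
     (auto intro!: exI[of _ "\<lambda>_. 0"])

lemma smooth_continuous: "smooth \<phi> \<Longrightarrow> continuous_on UNIV \<phi>"
  using smooth_has_vderiv
  by (blast intro: continuous_at_imp_continuous_on has_vector_derivative_continuous)

text \<open>A product differentiates into two products: single products are not closed under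
  differentiation, but finite sums of products are. The list holds the pairs of factors, and
  Leibniz' rule replaces each pair by two.\<close>

lemma smooth_sum_list_mult:
  assumes "\<forall>(f, g) \<in> set fs. smooth f \<and> smooth g"
  shows "smooth (\<lambda>x. \<Sum>(f, g) \<leftarrow> fs. f x * g x)"
proof (rule smooth_coinduct[where P = "\<lambda>\<phi>. \<exists>fs. (\<forall>(f, g) \<in> set fs. smooth f \<and> smooth g) \<and>
    \<phi> = (\<lambda>x. \<Sum>(f, g) \<leftarrow> fs. f x * g x)"])
  fix \<phi> :: "real \<Rightarrow> complex"
  assume "\<exists>fs. (\<forall>(f, g) \<in> set fs. smooth f \<and> smooth g) \<and> \<phi> = (\<lambda>x. \<Sum>(f, g) \<leftarrow> fs. f x * g x)"
  then obtain fs where fs: "\<forall>(f, g) \<in> set fs. smooth f \<and> smooth g"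
    and \<phi>: "\<phi> = (\<lambda>x. \<Sum>(f, g) \<leftarrow> fs. f x * g x)"
    by blast
  have "\<exists>gs. (\<forall>(f, g) \<in> set gs. smooth f \<and> smooth g) \<and>
      (\<forall>x. ((\<lambda>x. \<Sum>(f, g) \<leftarrow> fs. f x * g x) has_vector_derivative (\<Sum>(f, g) \<leftarrow> gs. f x * g x)) (at x))"
    using fs
  proof (induction fs)
    case Nil
    show ?case by (intro exI[of _ "[]"]) auto
  next
    case (Cons p fs)
    obtain f g where p: "p = (f, g)" by fastforce
    with Cons have f: "smooth f" and g: "smooth g" by auto
    from Cons obtain gs where gs: "\<forall>(f, g) \<in> set gs. smooth f \<and> smooth g"
      "\<And>x. ((\<lambda>x. \<Sum>(f, g) \<leftarrow> fs. f x * g x) has_vector_derivative (\<Sum>(f, g) \<leftarrow> gs. f x * g x)) (at x)"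
      by auto
    have "((\<lambda>x. f x * g x + (\<Sum>(f, g) \<leftarrow> fs. f x * g x)) has_vector_derivative
        (f x * vderiv g x + vderiv f x * g x + (\<Sum>(f, g) \<leftarrow> gs. f x * g x))) (at x)" for x
      by (intro has_vector_derivative_add has_vector_derivative_mult smooth_has_vderiv f g gs)
    with gs(1) f g smooth_vderiv show ?case
      by (intro exI[of _ "(f, vderiv g) # (vderiv f, g) # gs"]) (auto simp: p add_ac)
  qed
  then show "\<exists>\<psi>. (\<exists>fs. (\<forall>(f, g) \<in> set fs. smooth f \<and> smooth g) \<and> \<psi> = (\<lambda>x. \<Sum>(f, g) \<leftarrow> fs. f x * g x)) \<and>
      (\<forall>x. (\<phi> has_vector_derivative \<psi> x) (at x))"
    unfolding \<phi> by blast
qed (use assms in blast)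

lemma smooth_mult: "smooth f \<Longrightarrow> smooth g \<Longrightarrow> smooth (\<lambda>x. f x * g x)"
  using smooth_sum_list_mult[of "[(f, g)]"] by simp

lemma smooth_diff_cmult: "smooth f \<Longrightarrow> smooth g \<Longrightarrow> smooth (\<lambda>x. f x - c * g x)"
  using smooth_sum_list_mult[of "[(f, \<lambda>_. 1), (\<lambda>_. - c, g)]"] smooth_const by simp

text \<open>Each differentiation produces a factor \<open>a\<close>; the scalar \<open>c\<close> in
  the invariant absorbs it.\<close>

lemma smooth_affine:
  assumes "smooth \<phi>"
  shows "smooth (\<lambda>x. \<phi> (a * x + b))"
proof (rule smooth_coinduct[where P = "\<lambda>f. \<exists>c \<phi>. smooth \<phi> \<and> f = (\<lambda>x. c *\<^sub>R \<phi> (a * x + b))"])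
  show "\<exists>c \<psi>. smooth \<psi> \<and> (\<lambda>x. \<phi> (a * x + b)) = (\<lambda>x. c *\<^sub>R \<psi> (a * x + b))"
    using assms by (intro exI[of _ 1] exI[of _ \<phi>]) simp
next
  fix f :: "real \<Rightarrow> complex"
  assume "\<exists>c \<phi>. smooth \<phi> \<and> f = (\<lambda>x. c *\<^sub>R \<phi> (a * x + b))"
  then obtain c \<phi> where \<phi>: "smooth \<phi>" and f: "f = (\<lambda>x. c *\<^sub>R \<phi> (a * x + b))" by blast
  have "(f has_vector_derivative (c * a) *\<^sub>R vderiv \<phi> (a * x + b)) (at x)" for x
  proof -
    have "((\<lambda>x. a * x + b) has_real_derivative a) (at x)"
      by (auto intro!: derivative_eq_intros)
    then have "((\<phi> \<circ> (\<lambda>x. a * x + b)) has_vector_derivative a *\<^sub>R vderiv \<phi> (a * x + b)) (at x)"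
      by (intro vector_diff_chain_at smooth_has_vderiv \<phi>)
         (simp add: has_real_derivative_iff_has_vector_derivative)
    then have "((\<lambda>x. c *\<^sub>R \<phi> (a * x + b)) has_vector_derivative c *\<^sub>R (a *\<^sub>R vderiv \<phi> (a * x + b))) (at x)"
      by (intro bounded_linear.has_vector_derivative[OF bounded_linear_scaleR_right]) (simp add: o_def)
    then show ?thesis by (simp add: f)
  qed
  then show "\<exists>\<psi>. (\<exists>c \<phi>. smooth \<phi> \<and> \<psi> = (\<lambda>x. c *\<^sub>R \<phi> (a * x + b))) \<and>
      (\<forall>x. (f has_vector_derivative \<psi> x) (at x))"
    using smooth_vderiv[OF \<phi>] by blast
qed

section \<open>Bump functions\<close>

definition flat_fun :: "real poly \<Rightarrow> real \<Rightarrow> real" where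
  "flat_fun p x = (if 0 < x then poly p (1 / x) * exp (- (1 / x)) else 0)"

lemma poly_times_exp_neg_tendsto:
  "((\<lambda>y::real. poly p y * exp (- y)) \<longlongrightarrow> 0) at_top"
proof -
  have "((\<lambda>y. \<Sum>i\<le>degree p. coeff p i * (y ^ i / exp y)) \<longlongrightarrow> (\<Sum>i\<le>degree p. coeff p i * 0)) at_top"
    by (intro tendsto_sum tendsto_mult tendsto_const tendsto_power_div_exp_0)
  moreover have "(\<Sum>i\<le>degree p. coeff p i * (y ^ i / exp y)) = poly p y * exp (- y)" for y
    by (simp add: poly_altdef sum_distrib_right exp_minus divide_inverse mult.assoc)
  ultimately show ?thesis by simp
qed

text \<open>For \<open>x > 0\<close> the derivative of \<open>p(1/x) exp(-1/x)\<close> is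
  \<open>(p - p')(1/x) exp(-1/x) / x^2\<close>, again of this form; \<open>[:0, 0, 1:]\<close> is
  the square of the variable. Carrying a polynomial as parameter is what closes the class under
  differentiation.\<close>

lemma flat_fun_deriv:
  "(flat_fun p has_real_derivative flat_fun ([:0, 0, 1:] * (p - pderiv p)) x) (at x)"
proof -
  consider "x > 0" | "x < 0" | "x = 0" by linarith
  then show ?thesis
  proof cases
    case 1
    have "((\<lambda>x. poly p (1 / x) * exp (- (1 / x))) has_real_derivative
        poly (pderiv p) (1 / x) * (- (1 / x\<^sup>2)) * exp (- (1 / x)) +
        exp (- (1 / x)) * (1 / x\<^sup>2) * poly p (1 / x)) (at x)"
      using 1 by (auto intro!: derivative_eq_intros DERIV_chain2[OF poly_DERIV] simp: power2_eq_square)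
    also have "poly (pderiv p) (1 / x) * (- (1 / x\<^sup>2)) * exp (- (1 / x)) +
        exp (- (1 / x)) * (1 / x\<^sup>2) * poly p (1 / x) = flat_fun ([:0, 0, 1:] * (p - pderiv p)) x"
      using 1 by (simp add: flat_fun_def field_simps power2_eq_square)
    finally have "((\<lambda>x. poly p (1 / x) * exp (- (1 / x))) has_real_derivative
        flat_fun ([:0, 0, 1:] * (p - pderiv p)) x) (at x)" .
    then show ?thesis
      by (rule has_field_derivative_transform_within_open[where S = "{0<..}"])
         (use 1 in \<open>auto simp: flat_fun_def\<close>)
  next
    case 2
    have "((\<lambda>x. 0) has_real_derivative 0) (at x)" by simp
    then have "(flat_fun p has_real_derivative 0) (at x)"
      by (rule has_field_derivative_transform_within_open[where S = "{..<0}"])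
         (use 2 in \<open>auto simp: flat_fun_def\<close>)
    with 2 show ?thesis by (simp add: flat_fun_def)
  next
    case 3
    \<comment> \<open>The difference quotient at 0 gains a factor \<open>1 / h\<close>, hence the
      multiplication of \<open>p\<close> by the variable in \<open>pCons 0 p\<close>. With
      \<open>y = 1 / h\<close> it is a polynomial times \<open>exp (- y)\<close> at
      \<infinity>.\<close>
    have "((\<lambda>h. poly (pCons 0 p) (1 / h) * exp (- (1 / h))) \<longlongrightarrow> 0) (at_right (0::real))"
      using filterlim_compose[OF poly_times_exp_neg_tendsto filterlim_inverse_at_top_right, of "pCons 0 p"]
      by (simp add: inverse_eq_divide)
    then have "((\<lambda>h. flat_fun p h / h) \<longlongrightarrow> 0) (at_right 0)"
      by (rule Lim_transform_eventually)
         (auto simp: eventually_at_filter flat_fun_def divide_simps)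
    moreover have "((\<lambda>h. flat_fun p h / h) \<longlongrightarrow> 0) (at_left 0)"
      by (rule Lim_transform_eventually[OF tendsto_const[of 0]])
         (auto simp: eventually_at_filter flat_fun_def)
    ultimately have "((\<lambda>h. flat_fun p h / h) \<longlongrightarrow> 0) (at 0)"
      by (simp add: filterlim_at_split)
    then show ?thesis
      using 3 by (simp add: has_field_derivative_iff flat_fun_def)
  qed
qed

lemma smooth_flat_fun: "smooth (\<lambda>x. complex_of_real (flat_fun p x))"
proof (rule smooth_coinduct[where P = "\<lambda>f. \<exists>p. f = (\<lambda>x. complex_of_real (flat_fun p x))"])
  fix f assume "\<exists>p. f = (\<lambda>x. complex_of_real (flat_fun p x))"
  then obtain p where f: "f = (\<lambda>x. complex_of_real (flat_fun p x))" by blast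
  have "(f has_vector_derivative complex_of_real (flat_fun ([:0, 0, 1:] * (p - pderiv p)) x)) (at x)" for x
    unfolding f
    by (intro bounded_linear.has_vector_derivative[OF bounded_linear_of_real])
       (use flat_fun_deriv in \<open>simp only: has_real_derivative_iff_has_vector_derivative\<close>)
  then show "\<exists>\<psi>. (\<exists>p. \<psi> = (\<lambda>x. complex_of_real (flat_fun p x))) \<and>
      (\<forall>x. (f has_vector_derivative \<psi> x) (at x))"
    by blast
qed blast

text \<open>The parameter \<open>n\<close> steepens the flanks: each factor is
  \<open>exp (- 1 / (n d))\<close> with \<open>d\<close> the distance to an endpoint, so the values
  inside the interval increase to 1 while the support stays in \<open>{a..b}\<close>.\<close>

definition plateau :: "real \<Rightarrow> real \<Rightarrow> nat \<Rightarrow> real \<Rightarrow> complex" where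
  "plateau a b n x = complex_of_real (flat_fun 1 (real n * (x - a))) * complex_of_real (flat_fun 1 (real n * (b - x)))"

lemma flat_fun_one_bounds: "0 \<le> flat_fun 1 x" "flat_fun 1 x \<le> 1"
  by (auto simp: flat_fun_def)

lemma plateau_zero: "x \<notin> {a<..<b} \<Longrightarrow> plateau a b n x = 0"
  by (auto simp: plateau_def flat_fun_def zero_less_mult_iff)

lemma test_function_plateau: "test_function (plateau a b n)"
  unfolding test_function_iff
proof
  have "smooth (\<lambda>x. complex_of_real (flat_fun 1 (real n * x + (- real n * a))) *
      complex_of_real (flat_fun 1 (- real n * x + real n * b)))"
    by (intro smooth_mult smooth_affine[OF smooth_flat_fun])
  then show "smooth (plateau a b n)"
    by (simp add: plateau_def[abs_def] algebra_simps)
  have "{x. plateau a b n x \<noteq> 0} \<subseteq> {a<..<b}"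
    using plateau_zero by blast
  then show "bounded {x. plateau a b n x \<noteq> 0}"
    using bounded_subset[OF bounded_box[of a b]] by simp
qed

lemma norm_plateau_le: "cmod (plateau a b n x) \<le> 1"
  unfolding plateau_def norm_mult using flat_fun_one_bounds by (simp add: mult_le_one)

lemma plateau_tendsto: "(\<lambda>n. plateau a b n x) \<longlonglongrightarrow> indicator {a<..<b} x"
proof (cases "x \<in> {a<..<b}")
  case True
  have *: "(\<lambda>n. flat_fun 1 (real n * c)) \<longlonglongrightarrow> 1" if "0 < c" for c
  proof -
    have "(\<lambda>n. exp (- (inverse (real n) * inverse c))) \<longlonglongrightarrow> exp (- (0 * inverse c))"
      by (intro tendsto_intros lim_inverse_n)
    moreover have "eventually (\<lambda>n. exp (- (inverse (real n) * inverse c)) = flat_fun 1 (real n * c)) sequentially"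
      using that by (intro eventually_sequentiallyI[of 1]) (auto simp: flat_fun_def field_simps)
    ultimately show ?thesis by (simp add: Lim_transform_eventually)
  qed
  have "(\<lambda>n. plateau a b n x) \<longlonglongrightarrow> complex_of_real 1 * complex_of_real 1"
    unfolding plateau_def using True by (intro tendsto_mult tendsto_of_real *) auto
  with True show ?thesis by simp
qed (simp add: plateau_zero)

text \<open>Off the closure of the set where \<phi> is nonzero, \<phi> vanishes on a neighbourhood
  and its derivative vanishes too; the closure of a bounded set is bounded.\<close>

lemma test_function_vderiv:
  assumes "test_function \<phi>"
  shows "test_function (vderiv \<phi>)"
  unfolding test_function_iff
proof
  show "smooth (vderiv \<phi>)"
    using assms smooth_vderiv test_function_iff by blast
  have "{x. vderiv \<phi> x \<noteq> 0} \<subseteq> closure {x. \<phi> x \<noteq> 0}"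
  proof (rule subsetI, rule ccontr)
    fix x assume x: "x \<in> {x. vderiv \<phi> x \<noteq> 0}" "x \<notin> closure {x. \<phi> x \<noteq> 0}"
    have "((\<lambda>_. 0) has_vector_derivative 0) (at x)" by simp
    then have "(\<phi> has_vector_derivative 0) (at x)"
    proof (rule has_vector_derivative_transform_within_open[where S = "- closure {x. \<phi> x \<noteq> 0}"])
      fix y assume "y \<in> - closure {x. \<phi> x \<noteq> 0}"
      then show "0 = \<phi> y" using closure_subset[of "{x. \<phi> x \<noteq> 0}"] by auto
    qed (use x in auto)
    then have "vderiv \<phi> x = 0" by (simp add: vderiv_def vector_derivative_at)
    with x show False by simp
  qed
  then show "bounded {x. vderiv \<phi> x \<noteq> 0}"
    using assms bounded_closure bounded_subset test_function_iff by blast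
qed

lemma test_function_support:
  assumes "test_function \<phi>"
  obtains K where "0 \<le> K" "\<And>x. K < \<bar>x\<bar> \<Longrightarrow> \<phi> x = 0"
proof -
  obtain K where "\<forall>x\<in>{x. \<phi> x \<noteq> 0}. \<bar>x\<bar> \<le> K"
    using assms unfolding test_function_iff bounded_iff real_norm_def by blast
  then have "\<And>x. max K 0 < \<bar>x\<bar> \<Longrightarrow> \<phi> x = 0" by force
  then show thesis using that[of "max K 0"] by simp
qed

lemma test_function_continuous: "test_function \<phi> \<Longrightarrow> continuous_on UNIV \<phi>"
  using smooth_continuous test_function_iff by blast

lemma test_function_primitive: "test_function \<phi> \<Longrightarrow> primitive \<phi> (vderiv \<phi>)"
  using smooth_has_vderiv test_function_continuous[OF test_function_vderiv] test_function_iff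
  by (intro primitive_deriv) auto

section \<open>The fundamental lemma of the calculus of variations and weak derivatives\<close>

lemma integrable_times_test_function:
  assumes f: "locally_integrable f" and \<phi>: "test_function \<phi>"
  shows "integrable lebesgue (\<lambda>x. f x * \<phi> x)"
proof -
  obtain K where K: "\<And>x. K < \<bar>x\<bar> \<Longrightarrow> \<phi> x = 0"
    using test_function_support[OF \<phi>] by blast
  have "(\<lambda>x. \<phi> x * f x) absolutely_integrable_on {-K..K}"
    using locally_integrable_continuous_mult[OF f test_function_continuous[OF \<phi>]]
    by (auto simp: locally_integrable_def)
  moreover have "indicator {-K..K} x *\<^sub>R (\<phi> x * f x) = f x * \<phi> x" for x
  proof (cases "K < \<bar>x\<bar>")
    case False
    then have "x \<in> {-K..K}" by auto
    then show ?thesis by simp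
  qed (simp add: K)
  ultimately show ?thesis by (simp add: set_integrable_def)
qed

lemma primitive_test_function_by_parts:
  assumes F: "primitive F f" and \<phi>: "test_function \<phi>"
  shows "(LINT x|lebesgue. F x * vderiv \<phi> x) = - (LINT x|lebesgue. f x * \<phi> x)"
proof -
  have 1: "integrable lebesgue (\<lambda>x. f x * \<phi> x)"
    by (rule integrable_times_test_function[OF primitive_locally_integrable[OF F] \<phi>])
  have F': "locally_integrable F"
    by (rule locally_integrable_continuous[OF primitive_continuous[OF F]])
  have 2: "integrable lebesgue (\<lambda>x. F x * vderiv \<phi> x)"
    by (rule integrable_times_test_function[OF F' test_function_vderiv[OF \<phi>]])
  have "(LINT x|lebesgue. f x * \<phi> x + F x * vderiv \<phi> x) = 0"
    by (rule primitive_integral_zero[OF primitive_mult[OF F test_function_primitive[OF \<phi>]]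
          integrable_times_test_function[OF F' \<phi>]]) (intro Bochner_Integration.integrable_add 1 2)
  then show ?thesis
    using 1 2 by (simp add: eq_neg_iff_add_eq_0 add.commute)
qed

text \<open>On a bounded window \<open>f\<close> is integrable, and the Borel sets over which its
  integral vanishes form a Dynkin system that contains the half-lines \<open>{..a}\<close>, an
  intersection-stable generator. A function whose integral vanishes over every measurable set is
  zero almost everywhere.\<close>

lemma AE_zero_if_interval_integrals_zero:
  assumes f: "locally_integrable f" and zero: "\<And>a b. a \<le> b \<Longrightarrow> (LINT x:{a..b}|lebesgue. f x) = 0"
  shows "AE x in lebesgue. f x = 0"
proof -
  have "AE x in lebesgue. indicator {- real N..real N} x *\<^sub>R f x = 0" for N
  proof (rule sigma_finite_measure.density_zero[OF sigma_finite_lebesgue])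
    let ?g = "\<lambda>x. indicator {- real N..real N} x *\<^sub>R f x"
    have "f absolutely_integrable_on {- real N..real N}"
      using f unfolding locally_integrable_def by blast
    then show g: "integrable lebesgue ?g"
      by (simp add: set_integrable_def)
    have gi: "?g absolutely_integrable_on A" if "A \<in> sets lebesgue" for A
      unfolding set_integrable_def by (rule integrable_mult_indicator[OF that g])
    have total: "(LINT x|lebesgue. ?g x) = 0"
      using zero[of "- real N" "real N"] by (simp add: set_lebesgue_integral_def)
    have gen: "sigma_sets UNIV (range (\<lambda>a::real. {..a})) = sets borel"
      unfolding borel_eq_atMost by (rule sets_measure_of[symmetric]) simp
    have borel: "(LINT x:A|lebesgue. ?g x) = 0" if "A \<in> sets borel" for A
    proof -
      have "Int_stable (range (\<lambda>a::real. {..a}))" "range (\<lambda>a::real. {..a}) \<subseteq> Pow UNIV"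
        "A \<in> sigma_sets UNIV (range (\<lambda>a::real. {..a}))"
        using that gen by (auto simp: Int_stable_def)
      then show ?thesis
      proof (induction rule: sigma_sets_induct_disjoint)
        case (basic A)
        then obtain a where A: "A = {..a}" by auto
        have "indicat_real A x *\<^sub>R indicat_real {- real N..real N} x *\<^sub>R f x =
            indicator {- real N..min a (real N)} x *\<^sub>R f x" for x
          by (auto simp: A indicator_def)
        then have "(LINT x:A|lebesgue. ?g x) = (LINT x:{- real N..min a (real N)}|lebesgue. f x)"
          by (simp only: set_lebesgue_integral_def)
        then show ?case
          using zero[of "- real N" "min a (real N)"]
          by (cases "- real N \<le> min a (real N)") (auto simp: set_lebesgue_integral_def)
      next
        case (compl A)
        have A: "A \<in> sets lebesgue"
          using compl(1) by (simp add: gen)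
        have "(LINT x:A \<union> (UNIV - A)|lebesgue. ?g x) =
            (LINT x:A|lebesgue. ?g x) + (LINT x:UNIV - A|lebesgue. ?g x)"
          using A sets.compl_sets[OF A] by (intro set_integral_Un gi) auto
        with compl total show ?case by (simp add: set_lebesgue_integral_def)
      next
        case (union A)
        have A: "A i \<in> sets lebesgue" for i
          using union(2) by (auto simp: gen)
        have "(LINT x:(\<Union>i. A i)|lebesgue. ?g x) = (\<Sum>i. (LINT x:A i|lebesgue. ?g x))"
          by (rule lebesgue_integral_countable_add)
             (use A gi union(1) in \<open>auto simp: disjoint_family_on_def\<close>)
        with union(3) show ?case by simp
      qed (simp add: set_lebesgue_integral_def)
    qed
    \<comment> \<open>A Lebesgue set is a Borel set up to a subset of a Borel null set, which does
      not affect the integral.\<close>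
    fix A :: "real set" assume "A \<in> sets lebesgue"
    then obtain S T T' where A: "A = S \<union> T" "T \<subseteq> T'" "T' \<in> null_sets lborel" "S \<in> sets lborel"
      by (rule sets_completionE)
    have "AE x in lebesgue. x \<notin> T'"
      using A(3) null_sets_completionI AE_not_in by blast
    have "(LINT x:A|lebesgue. ?g x) = (LINT x:S|lebesgue. ?g x)"
      unfolding set_lebesgue_integral_def
    proof (rule integral_cong_AE)
      show "AE x in lebesgue. indicat_real A x *\<^sub>R ?g x = indicat_real S x *\<^sub>R ?g x"
        using \<open>AE x in lebesgue. x \<notin> T'\<close>
        by eventually_elim (use A(1,2) in \<open>auto simp: indicator_def\<close>)
      show "(\<lambda>x. indicat_real A x *\<^sub>R ?g x) \<in> borel_measurable lebesgue"
        "(\<lambda>x. indicat_real S x *\<^sub>R ?g x) \<in> borel_measurable lebesgue"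
        using gi[OF \<open>A \<in> sets lebesgue\<close>] gi[of S] A(4)
        by (auto simp only: set_integrable_def sets_completionI_sets intro: borel_measurable_integrable)
    qed
    with borel A show "(LINT x:A|lebesgue. ?g x) = 0" by simp
  qed
  then have "AE x in lebesgue. \<forall>N. indicator {- real N..real N} x *\<^sub>R f x = 0"
    by (intro AE_all_countable[THEN iffD2] allI)
  then show ?thesis
  proof eventually_elim
    case (elim x)
    obtain N where "\<bar>x\<bar> \<le> real N" using real_arch_simple by blast
    with elim[rule_format, of N] show ?case by (auto simp: indicator_def abs_le_iff split: if_splits)
  qed
qed

text \<open>The functions \<open>plateau\<close> tend boundedly to the indicator of the open
  interval, so dominated convergence passes from test functions to interval integrals; the endpoints
  form a null set.\<close>

lemma fundamental_lemma_variations: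
  assumes f: "locally_integrable f"
    and zero: "\<And>\<phi>. test_function \<phi> \<Longrightarrow> (LINT x|lebesgue. f x * \<phi> x) = 0"
  shows "AE x in lebesgue. f x = 0"
proof (rule AE_zero_if_interval_integrals_zero[OF f])
  fix a b :: real
  have fi: "integrable lebesgue (\<lambda>x. indicator {a..b} x *\<^sub>R f x)"
    using f by (auto simp: locally_integrable_def set_integrable_def)
  have "(\<lambda>n. LINT x|lebesgue. f x * plateau a b n x) \<longlonglongrightarrow> (LINT x|lebesgue. indicator {a..b} x *\<^sub>R f x)"
  proof (rule integral_dominated_convergence[where w = "\<lambda>x. norm (indicator {a..b} x *\<^sub>R f x)"])
    show "(\<lambda>x. indicator {a..b} x *\<^sub>R f x) \<in> borel_measurable lebesgue"
      using fi by auto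
    show "(\<lambda>x. f x * plateau a b n x) \<in> borel_measurable lebesgue" for n
      by (intro borel_measurable_integrable integrable_times_test_function[OF f test_function_plateau])
    show "integrable lebesgue (\<lambda>x. norm (indicator {a..b} x *\<^sub>R f x))"
      using fi by (rule integrable_norm)
    have "AE x in lebesgue. x \<notin> {a, b}"
      by (intro AE_not_in) (auto simp: negligible_iff_null_sets[symmetric])
    then show "AE x in lebesgue. (\<lambda>n. f x * plateau a b n x) \<longlonglongrightarrow> indicator {a..b} x *\<^sub>R f x"
    proof eventually_elim
      case (elim x)
      have "(\<lambda>n. f x * plateau a b n x) \<longlonglongrightarrow> f x * indicator {a<..<b} x"
        by (intro tendsto_mult tendsto_const plateau_tendsto)
      with elim show ?case by (auto simp: indicator_def split: if_splits)
    qed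
    show "AE x in lebesgue. norm (f x * plateau a b n x) \<le> norm (indicator {a..b} x *\<^sub>R f x)" for n
    proof (rule AE_I2)
      fix x
      show "norm (f x * plateau a b n x) \<le> norm (indicator {a..b} x *\<^sub>R f x)"
        using norm_plateau_le[of a b n x] plateau_zero[of x a b n] mult_left_le[of "cmod (plateau a b n x)" "cmod (f x)"]
        by (cases "x \<in> {a<..<b}") (auto simp: norm_mult)
    qed
  qed
  then show "(LINT x:{a..b}|lebesgue. f x) = 0"
    using zero[OF test_function_plateau] by (simp add: set_lebesgue_integral_def LIMSEQ_const_iff)
qed

text \<open>Otherwise the fundamental lemma, applied to the constant 1, would make 1 vanish almost
  everywhere. No integral of a concrete bump has to be evaluated.\<close>

lemma exists_test_function_nonzero_integral:
  "\<exists>\<theta>. test_function \<theta> \<and> (LINT x|lebesgue. \<theta> x) \<noteq> 0"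
proof (rule ccontr)
  assume "\<not> ?thesis"
  then have "AE x in (lebesgue :: real measure). (1::complex) = 0"
    by (intro fundamental_lemma_variations[of "\<lambda>_. 1"] locally_integrable_continuous) auto
  then show False
    using non_negligible_UNIV[where 'a = real] by (simp add: AE_iff_null negligible_iff_null_sets)
qed

text \<open>Vanishing of the total integral makes the antiderivative that starts at 0 on the left
  return to 0 on the right, so that its support is bounded.\<close>

lemma test_function_antideriv:
  assumes \<eta>: "test_function \<eta>" and zero: "(LINT x|lebesgue. \<eta> x) = 0"
  shows "\<exists>\<omega>. test_function \<omega> \<and> vderiv \<omega> = \<eta>"
proof -
  have c: "continuous_on UNIV \<eta>" by (rule test_function_continuous[OF \<eta>])
  obtain K where K: "0 \<le> K" "\<And>x. K < \<bar>x\<bar> \<Longrightarrow> \<eta> x = 0"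
    using test_function_support[OF \<eta>] by blast
  obtain F where F: "primitive F \<eta>"
    using primitive_of_locally_integrable[OF locally_integrable_continuous[OF c]] by blast
  have dF: "(F has_vector_derivative \<eta> x) (at x)" for x
  proof -
    have "((\<lambda>y. integral {x - 1..y} \<eta>) has_vector_derivative \<eta> x) (at x within {x - 1..x + 1})"
      by (rule integral_has_vector_derivative) (use c continuous_on_subset in auto)
    then have "((\<lambda>y. integral {x - 1..y} \<eta> + F (x - 1)) has_vector_derivative \<eta> x) (at x within {x - 1..x + 1})"
      by (auto intro!: derivative_eq_intros)
    then have "((\<lambda>y. integral {x - 1..y} \<eta> + F (x - 1)) has_vector_derivative \<eta> x) (at x)"
      by (simp add: at_within_Icc_at)
    then show ?thesis
    proof (rule has_vector_derivative_transform_within_open[where S = "{x - 1<..<x + 1}"])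
      fix y assume "y \<in> {x - 1<..<x + 1}"
      then show "integral {x - 1..y} \<eta> + F (x - 1) = F y"
        using primitive_integral[OF F, of "x - 1" y]
          set_lebesgue_integral_eq_integral(2)[OF primitive_integrable[OF F, of "x - 1" y]] by simp
    qed auto
  qed
  define \<omega> where "\<omega> x = F x - F (- K)" for x
  have d\<omega>: "(\<omega> has_vector_derivative \<eta> x) (at x)" for x
    unfolding \<omega>_def using dF by (auto intro!: derivative_eq_intros)
  have z: "(LINT x:{a..b}|lebesgue. \<eta> x) = 0" if "b \<le> - K \<or> K \<le> a" for a b
  proof -
    have "AE x in lebesgue. x \<notin> {K, - K}"
      by (intro AE_not_in) (auto simp: negligible_iff_null_sets[symmetric])
    then have "AE x in lebesgue. indicator {a..b} x *\<^sub>R \<eta> x = 0"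
    proof eventually_elim
      case (elim x)
      with that K(2)[of x] show ?case by (auto simp: indicator_def)
    qed
    then show ?thesis
      unfolding set_lebesgue_integral_def by (rule integral_eq_zero_AE)
  qed
  have "\<omega> x = 0" if x: "x \<notin> {-K..K}" for x
  proof (cases "x < - K")
    case True
    then show ?thesis
      using primitive_integral[OF F, of x "- K"] z[of "- K" x] by (simp add: \<omega>_def)
  next
    case False
    then have "K < x" using x by auto
    have "indicator {- K..K} x *\<^sub>R \<eta> x = \<eta> x" for x
      using K(2)[of x] by (auto simp: indicator_def abs_if split: if_splits)
    then have "(LINT x:{-K..K}|lebesgue. \<eta> x) = 0"
      using zero by (simp add: set_lebesgue_integral_def)
    then show ?thesis
      using primitive_integral[OF F, of K x] primitive_integral[OF F, of "- K" K] z[of x K] K(1) \<open>K < x\<close>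
      by (simp add: \<omega>_def)
  qed
  then have "{x. \<omega> x \<noteq> 0} \<subseteq> {-K..K}" by blast
  then have "bounded {x. \<omega> x \<noteq> 0}"
    using bounded_closed_interval bounded_subset by blast
  moreover have "smooth \<omega>"
    using smooth_antideriv d\<omega> \<eta> test_function_iff by blast
  moreover have "vderiv \<omega> = \<eta>"
    using d\<omega> by (auto simp: vderiv_def fun_eq_iff intro: vector_derivative_at)
  ultimately show ?thesis unfolding test_function_iff by blast
qed

lemma test_function_diff_cmult:
  assumes "test_function f" "test_function g"
  shows "test_function (\<lambda>x. f x - c * g x)"
  unfolding test_function_iff
proof
  show "smooth (\<lambda>x. f x - c * g x)"
    using assms by (auto simp: test_function_iff intro: smooth_diff_cmult)
  have "bounded ({x. f x \<noteq> 0} \<union> {x. g x \<noteq> 0})"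
    using assms by (auto simp: test_function_iff)
  then show "bounded {x. f x - c * g x \<noteq> 0}"
    by (rule bounded_subset) auto
qed

lemma test_function_integrable: "test_function \<phi> \<Longrightarrow> integrable lebesgue \<phi>"
  using integrable_times_test_function[of "\<lambda>_. 1" \<phi>] locally_integrable_continuous[of "\<lambda>_. 1"] by simp

text \<open>Subtracting a primitive \<open>w\<close> of \<open>v\<close> leaves a function
  \<open>k\<close> with vanishing weak derivative. Fix \<theta> with nonzero integral: every test
  function is a multiple of \<theta> plus a test function of integral 0, and the latter is a
  derivative, so \<open>k\<close> annihilates it. Hence \<open>k\<close> pairs like a
  constant.\<close>

lemma du_Bois_Reymond:
  assumes u: "locally_integrable u" and v: "locally_integrable v"
    and weak: "\<And>\<phi>. test_function \<phi> \<Longrightarrow>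
      (LINT x|lebesgue. u x * vderiv \<phi> x) = - (LINT x|lebesgue. v x * \<phi> x)"
  shows "\<exists>U. primitive U v \<and> (AE x in lebesgue. u x = U x)"
proof -
  obtain w where w: "primitive w v"
    using primitive_of_locally_integrable[OF v] by blast
  have w': "locally_integrable w"
    by (rule locally_integrable_continuous[OF primitive_continuous[OF w]])
  define k where "k x = u x + (- 1) * w x" for x
  have k: "locally_integrable k"
    unfolding k_def by (intro locally_integrable_add locally_integrable_cmult u w')
  have k0: "(LINT x|lebesgue. k x * vderiv \<phi> x) = 0" if \<phi>: "test_function \<phi>" for \<phi>
  proof -
    have "(LINT x|lebesgue. k x * vderiv \<phi> x) =
        (LINT x|lebesgue. u x * vderiv \<phi> x - w x * vderiv \<phi> x)"
      by (simp add: k_def algebra_simps)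
    also have "\<dots> = (LINT x|lebesgue. u x * vderiv \<phi> x) - (LINT x|lebesgue. w x * vderiv \<phi> x)"
      using test_function_vderiv[OF \<phi>] u w'
      by (intro Bochner_Integration.integral_diff integrable_times_test_function)
    finally show ?thesis
      using weak[OF \<phi>] primitive_test_function_by_parts[OF w \<phi>] by simp
  qed
  obtain \<theta> where \<theta>: "test_function \<theta>" "(LINT x|lebesgue. \<theta> x) \<noteq> 0"
    using exists_test_function_nonzero_integral by blast
  \<comment> \<open>The mean of \<open>k\<close> against \<theta>, the only constant compatible with
    testing against \<theta> itself.\<close>
  define c where "c = (LINT x|lebesgue. k x * \<theta> x) / (LINT x|lebesgue. \<theta> x)"
  have "AE x in lebesgue. k x + (- c) = 0"
  proof (rule fundamental_lemma_variations)
    show "locally_integrable (\<lambda>x. k x + (- c))"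
      by (intro locally_integrable_add k locally_integrable_continuous) auto
    fix \<phi> assume \<phi>: "test_function \<phi>"
    define d where "d = (LINT x|lebesgue. \<phi> x) / (LINT x|lebesgue. \<theta> x)"
    define \<eta> where "\<eta> x = \<phi> x - d * \<theta> x" for x
    have i\<phi>: "integrable lebesgue \<phi>" "integrable lebesgue (\<lambda>x. k x * \<phi> x)"
      and i\<theta>: "integrable lebesgue \<theta>" "integrable lebesgue (\<lambda>x. k x * \<theta> x)"
      using \<phi> \<theta>(1) k by (auto intro: test_function_integrable integrable_times_test_function)
    have "test_function \<eta>"
      unfolding \<eta>_def by (rule test_function_diff_cmult[OF \<phi> \<theta>(1)])
    moreover have "(LINT x|lebesgue. \<eta> x) = 0"
      using i\<phi> i\<theta> \<theta>(2) by (simp add: \<eta>_def d_def)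
    ultimately obtain \<omega> where "test_function \<omega>" "vderiv \<omega> = \<eta>"
      using test_function_antideriv by blast
    then have "(LINT x|lebesgue. k x * \<eta> x) = 0" using k0 by blast
    moreover have "k x * \<eta> x = k x * \<phi> x - d * (k x * \<theta> x)" for x
      by (simp add: \<eta>_def algebra_simps)
    ultimately have "(LINT x|lebesgue. k x * \<phi> x) = d * (LINT x|lebesgue. k x * \<theta> x)"
      using i\<phi> i\<theta> by simp
    then have "(LINT x|lebesgue. k x * \<phi> x) - c * (LINT x|lebesgue. \<phi> x) = 0"
      using \<theta>(2) by (simp add: c_def d_def)
    moreover have "(k x + (- c)) * \<phi> x = k x * \<phi> x - c * \<phi> x" for x
      by (simp add: algebra_simps)
    ultimately show "(LINT x|lebesgue. (k x + (- c)) * \<phi> x) = 0"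
      using i\<phi> by simp
  qed
  then have "AE x in lebesgue. u x = w x + c"
    by eventually_elim (simp add: k_def algebra_simps)
  moreover have "primitive (\<lambda>x. w x + c) v"
    using primitive_add[OF w primitive_const[of c]] by simp
  ultimately show ?thesis by blast
qed

section \<open>Representatives of square-integrable functions\<close>

lemma L2_eqI: "AE x in lebesgue. rep_L2 f x = rep_L2 g x \<Longrightarrow> f = g"
  using Quotient3_rel_rep[OF Quotient3_L2, of f g] square_integrable_rep_L2 by simp

lemma rep_abs_L2:
  assumes "square_integrable f"
  shows "AE x in lebesgue. rep_L2 (abs_L2 f) x = f x"
proof -
  have "abs_L2 (rep_L2 (abs_L2 f)) = abs_L2 f"
    by (rule Quotient3_abs_rep[OF Quotient3_L2])
  then show ?thesis
    using Quotient3_rel[OF Quotient3_L2, of "rep_L2 (abs_L2 f)" f] assms square_integrable_rep_L2 by simp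
qed

lemma rep_plus_L2: "AE x in lebesgue. rep_L2 (f + g) x = rep_L2 f x + rep_L2 g x"
  using rep_abs_L2[OF square_integrable_add[OF square_integrable_rep_L2 square_integrable_rep_L2]]
  by (simp add: plus_L2_def)

lemma rep_scaleR_L2: "AE x in lebesgue. rep_L2 (r *\<^sub>R f) x = r *\<^sub>R rep_L2 f x"
  using rep_abs_L2[OF square_integrable_scaleR[OF square_integrable_rep_L2]]
  by (simp add: scaleR_L2_def)

lemma rep_diff_L2: "AE x in lebesgue. rep_L2 (f - g) x = rep_L2 f x - rep_L2 g x"
proof -
  have "f - g = f + (- 1) *\<^sub>R g" by simp
  moreover have "AE x in lebesgue. rep_L2 (f + (- 1) *\<^sub>R g) x = rep_L2 f x - rep_L2 g x"
    using rep_plus_L2[of f "(- 1) *\<^sub>R g"] rep_scaleR_L2[of "- 1" g] by eventually_elim simp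
  ultimately show ?thesis by simp
qed

lemma rep_mult_op:
  assumes "m \<in> borel_measurable lebesgue" "bounded (range m)"
  shows "AE x in lebesgue. rep_L2 (mult_op m f) x = m x * rep_L2 f x"
  using rep_abs_L2[OF square_integrable_mult_bounded[OF square_integrable_rep_L2 assms]] assms
  by (simp add: mult_op_def)

lemma square_integrable_measurable: "square_integrable f \<Longrightarrow> f \<in> borel_measurable lebesgue"
  by (simp add: square_integrable_def)

lemma square_integrable_cong_AE:
  assumes "square_integrable f" "g \<in> borel_measurable lebesgue" "AE x in lebesgue. f x = g x"
  shows "square_integrable g"
proof -
  have [measurable]: "g \<in> borel_measurable lebesgue" by fact
  have "integrable lebesgue (\<lambda>x. (cmod (f x))\<^sup>2)"
    using assms by (simp add: square_integrable_def)
  moreover have "(\<lambda>x. (cmod (g x))\<^sup>2) \<in> borel_measurable lebesgue" by measurable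
  moreover have "AE x in lebesgue. (cmod (f x))\<^sup>2 = (cmod (g x))\<^sup>2"
    using assms(3) by eventually_elim simp
  ultimately have "integrable lebesgue (\<lambda>x. (cmod (g x))\<^sup>2)"
    by (rule integrable_cong_AE_imp)
  then show ?thesis using assms(2) by (simp add: square_integrable_def)
qed

lemma of_real_measurable:
  "f \<in> borel_measurable M \<Longrightarrow> (\<lambda>x. complex_of_real (f x)) \<in> borel_measurable M"
  by (rule measurable_compose[OF _ borel_measurable_of_real])

lemma cnj_measurable: "f \<in> borel_measurable M \<Longrightarrow> (\<lambda>x. cnj (f x)) \<in> borel_measurable M"
  by (rule measurable_compose[where g = cnj and N = borel])
     (auto intro: borel_measurable_continuous_onI continuous_intros)

lemma square_integrable_cnj: "square_integrable f \<Longrightarrow> square_integrable (\<lambda>x. cnj (f x))"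
  unfolding square_integrable_def by (simp add: cnj_measurable)

lemma square_integrable_cmult: "square_integrable f \<Longrightarrow> square_integrable (\<lambda>x. c * f x)"
  by (rule square_integrable_mult_bounded) auto

lemma square_integrable_diff:
  "square_integrable f \<Longrightarrow> square_integrable g \<Longrightarrow> square_integrable (\<lambda>x. f x - g x)"
  using square_integrable_add[of f "\<lambda>x. (- 1) * g x"] square_integrable_cmult[of g "- 1"] by simp

lemma square_integrable_mult:
  assumes f: "square_integrable f" and g: "square_integrable g"
  shows "integrable lebesgue (\<lambda>x. f x * g x)"
proof -
  have [measurable]: "f \<in> borel_measurable lebesgue" "g \<in> borel_measurable lebesgue"
    using f g by (auto simp: square_integrable_def)
  show ?thesis
  proof (rule Bochner_Integration.integrable_bound)
    show "integrable lebesgue (\<lambda>x. (cmod (f x))\<^sup>2 + (cmod (g x))\<^sup>2)"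
      using f g by (auto simp: square_integrable_def)
    have "cmod (f x * g x) \<le> (cmod (f x))\<^sup>2 + (cmod (g x))\<^sup>2" for x
    proof -
      have "2 * (cmod (f x) * cmod (g x)) \<le> (cmod (f x))\<^sup>2 + (cmod (g x))\<^sup>2"
        using zero_le_power2[of "cmod (f x) - cmod (g x)"] by (simp add: power2_diff)
      moreover have "0 \<le> cmod (f x) * cmod (g x)" by simp
      ultimately show ?thesis unfolding norm_mult by linarith
    qed
    then show "AE x in lebesgue. norm (f x * g x) \<le> norm ((cmod (f x))\<^sup>2 + (cmod (g x))\<^sup>2)"
      by simp
  qed measurable
qed

lemma square_integrable_indicator: "square_integrable (\<lambda>x. complex_of_real (indicat_real {a..b} x))"
  unfolding square_integrable_def
proof
  show "(\<lambda>x. complex_of_real (indicat_real {a..b} x)) \<in> borel_measurable lebesgue"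
    by (intro of_real_measurable borel_measurable_indicator) simp
  have "(cmod (complex_of_real (indicat_real {a..b} x)))\<^sup>2 = indicat_real {a..b} x" for x
    by (simp add: indicator_def)
  moreover have "integrable lebesgue (indicat_real {a..b})"
    by (rule integrable_real_indicator) (auto simp: emeasure_lborel_Icc_eq)
  ultimately show "integrable lebesgue (\<lambda>x. (cmod (complex_of_real (indicat_real {a..b} x)))\<^sup>2)"
    by (simp only:)
qed

lemma square_integrable_locally_integrable: "square_integrable f \<Longrightarrow> locally_integrable f"
  unfolding locally_integrable_def set_integrable_def
  using square_integrable_mult[OF square_integrable_indicator]
  by (simp add: scaleR_conv_of_real)

text \<open>The quadratic \<open>A - 2 t P + t^2 B\<close> in \<open>t\<close> is the integral of a
  square, so its discriminant is not positive. Moduli stand in place of the inner product because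
  the energy estimates take absolute values before pairing.\<close>

lemma Cauchy_Schwarz_integral:
  assumes f: "square_integrable f" and g: "square_integrable g"
  shows "(LINT x|lebesgue. cmod (f x) * cmod (g x)) \<le>
    sqrt (LINT x|lebesgue. (cmod (f x))\<^sup>2) * sqrt (LINT x|lebesgue. (cmod (g x))\<^sup>2)"
proof -
  define A where "A = (LINT x|lebesgue. (cmod (f x))\<^sup>2)"
  define B where "B = (LINT x|lebesgue. (cmod (g x))\<^sup>2)"
  define P where "P = (LINT x|lebesgue. cmod (f x) * cmod (g x))"
  have i: "integrable lebesgue (\<lambda>x. (cmod (f x))\<^sup>2)" "integrable lebesgue (\<lambda>x. (cmod (g x))\<^sup>2)"
    "integrable lebesgue (\<lambda>x. cmod (f x) * cmod (g x))"
    using f g square_integrable_mult[OF f g] integrable_norm[of lebesgue "\<lambda>x. f x * g x"]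
    by (auto simp: square_integrable_def norm_mult)
  have nn: "0 \<le> A" "0 \<le> B" "0 \<le> P" by (auto simp: A_def B_def P_def)
  have q: "0 \<le> A - 2 * t * P + t\<^sup>2 * B" for t
  proof -
    have "0 \<le> (LINT x|lebesgue. (cmod (f x) - t * cmod (g x))\<^sup>2)" by simp
    also have "(\<lambda>x. (cmod (f x) - t * cmod (g x))\<^sup>2) =
        (\<lambda>x. (cmod (f x))\<^sup>2 - (2 * t) * (cmod (f x) * cmod (g x)) + t\<^sup>2 * (cmod (g x))\<^sup>2)"
      by (auto simp: power2_diff power_mult_distrib algebra_simps)
    also have "(LINT x|lebesgue. \<dots> x) = A - 2 * t * P + t\<^sup>2 * B"
      using i by (simp add: A_def B_def P_def)
    finally show ?thesis .
  qed
  have "P\<^sup>2 \<le> A * B"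
  proof (cases "B = 0")
    case True
    have "P = 0"
    proof (rule ccontr)
      assume "P \<noteq> 0"
      \<comment> \<open>With \<open>B = 0\<close> the quadratic is affine in \<open>t\<close>, and
        this \<open>t\<close> drives it to \<open>- A - 2\<close>, below 0.\<close>
      then have "0 \<le> A - 2 * (A + 1)"
        using q[of "(A + 1) / P"] True by simp
      with nn show False by simp
    qed
    with nn show ?thesis by simp
  next
    case False
    then have "0 < B" using nn by simp
    have "0 \<le> B * (A - 2 * (P / B) * P + (P / B)\<^sup>2 * B)"
      using q[of "P / B"] \<open>0 < B\<close> by simp
    also have "\<dots> = A * B - P\<^sup>2"
      using \<open>0 < B\<close> by (simp add: field_simps power2_eq_square)
    finally show ?thesis by simp
  qed
  then have "P \<le> sqrt (A * B)"
    by (rule real_le_rsqrt)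
  then show ?thesis by (simp add: A_def B_def P_def real_sqrt_mult)
qed

section \<open>The domain of the operator in terms of absolutely continuous functions\<close>

lemma distr_of_cong_AE:
  assumes "u \<in> borel_measurable lebesgue" "v \<in> borel_measurable lebesgue"
    "AE x in lebesgue. u x = v x" "test_function \<phi>"
  shows "distr_of u \<phi> = distr_of v \<phi>"
proof -
  have [measurable]: "\<phi> \<in> borel_measurable lebesgue"
    by (rule continuous_on_lebesgue_measurable[OF test_function_continuous[OF assms(4)]])
  have [measurable]: "u \<in> borel_measurable lebesgue" "v \<in> borel_measurable lebesgue" by fact+
  show ?thesis
    unfolding distr_of_def
  proof (rule integral_cong_AE)
    show "AE x in lebesgue. u x * \<phi> x = v x * \<phi> x"
      using assms(3) by eventually_elim simp
  qed measurable
qed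

text \<open>This is the uniqueness behind the \<open>THE\<close> in
  \<open>schroedinger\<close>.\<close>

lemma distr_of_inject:
  assumes "distr_eq (distr_of (rep_L2 f)) (distr_of (rep_L2 g))"
  shows "f = g"
proof (rule L2_eqI)
  have li: "locally_integrable (rep_L2 f)" "locally_integrable (rep_L2 g)"
    by (intro square_integrable_locally_integrable square_integrable_rep_L2)+
  have "AE x in lebesgue. rep_L2 f x + (- 1) * rep_L2 g x = 0"
  proof (rule fundamental_lemma_variations)
    show "locally_integrable (\<lambda>x. rep_L2 f x + (- 1) * rep_L2 g x)"
      by (intro locally_integrable_add locally_integrable_cmult li)
    fix \<phi> assume \<phi>: "test_function \<phi>"
    have "(rep_L2 f x + (- 1) * rep_L2 g x) * \<phi> x = rep_L2 f x * \<phi> x - rep_L2 g x * \<phi> x" for x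
      by (simp add: algebra_simps)
    then show "(LINT x|lebesgue. (rep_L2 f x + (- 1) * rep_L2 g x) * \<phi> x) = 0"
      using assms \<phi> li by (simp add: distr_eq_def distr_of_def integrable_times_test_function)
  qed
  then show "AE x in lebesgue. rep_L2 f x = rep_L2 g x"
    by eventually_elim simp
qed

lemma schroedinger_eqI:
  assumes "distr_eq (schroedinger_distr h V u) (distr_of (rep_L2 f))"
  shows "schroedinger h V u = f"
  unfolding schroedinger_def
proof (rule the_equality)
  fix g assume "distr_eq (schroedinger_distr h V u) (distr_of (rep_L2 g))"
  with assms have "distr_eq (distr_of (rep_L2 g)) (distr_of (rep_L2 f))"
    by (simp add: distr_eq_def)
  then show "g = f" by (rule distr_of_inject)
qed (rule assms)

lemma schroedinger_distr_eq:
  assumes "u \<in> schroedinger_domain h V"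
  shows "distr_eq (schroedinger_distr h V u) (distr_of (rep_L2 (schroedinger h V u)))"
proof -
  obtain f where "distr_eq (schroedinger_distr h V u) (distr_of (rep_L2 f))"
    using assms by (auto simp: schroedinger_domain_def)
  with schroedinger_eqI show ?thesis by blast
qed

lemma potential_measurable:
  assumes "integrable lebesgue V"
  shows "(\<lambda>x. complex_of_real (V x)) \<in> borel_measurable lebesgue"
    "locally_integrable (\<lambda>x. complex_of_real (V x))"
proof -
  show "(\<lambda>x. complex_of_real (V x)) \<in> borel_measurable lebesgue"
    using assms by (intro of_real_measurable borel_measurable_integrable)
  show "locally_integrable (\<lambda>x. complex_of_real (V x))"
    using assms by (intro integrable_imp_locally_integrable) simp
qed

text \<open>The lemma of du Bois-Reymond applies twice: to the weak derivative of \<open>u\<close>,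
  and then to that of \<open>u'\<close>, whose density is read off from the equation. The continuous
  \<open>U\<close> replaces the representative of \<open>u\<close>, so that \<open>V U\<close> is
  locally integrable.\<close>

lemma domain_primitive:
  assumes V: "integrable lebesgue V" and h: "h > 0" and u: "u \<in> schroedinger_domain h V"
  obtains U U' where "primitive U U'"
    "primitive U' (\<lambda>x. (V x * U x - rep_L2 (schroedinger h V u) x) / complex_of_real (h\<^sup>2))"
    "AE x in lebesgue. rep_L2 u x = U x" "square_integrable U" "square_integrable U'"
proof -
  let ?f = "rep_L2 (schroedinger h V u)"
  have li: "locally_integrable (rep_L2 g)" for g
    by (intro square_integrable_locally_integrable square_integrable_rep_L2)
  have me [measurable]: "rep_L2 g \<in> borel_measurable lebesgue" for g
    by (intro square_integrable_measurable square_integrable_rep_L2)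
  note [measurable] = potential_measurable(1)[OF V]
  obtain u' where u': "distr_eq (distr_deriv (distr_of (rep_L2 u))) (distr_of (rep_L2 u'))"
    using u by (auto simp: schroedinger_domain_def)
  then have weak: "(LINT x|lebesgue. rep_L2 u x * vderiv \<phi> x) = - (LINT x|lebesgue. rep_L2 u' x * \<phi> x)"
    if "test_function \<phi>" for \<phi>
    using that by (auto simp: distr_eq_def distr_deriv_def distr_of_def minus_equation_iff)
  then obtain U where U: "primitive U (rep_L2 u')" "AE x in lebesgue. rep_L2 u x = U x"
    using du_Bois_Reymond[OF li li] by blast
  have cU: "continuous_on UNIV U" by (rule primitive_continuous[OF U(1)])
  have [measurable]: "U \<in> borel_measurable lebesgue" by (rule primitive_measurable[OF U(1)])
  \<comment> \<open>This is \<open>u''\<close> as forced by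
    \<open>- h^2 u'' + V u = f\<close>.\<close>
  define g where "g x = (V x * U x - ?f x) / complex_of_real (h\<^sup>2)" for x
  have VU: "locally_integrable (\<lambda>x. complex_of_real (V x) * U x)"
    using locally_integrable_continuous_mult[OF potential_measurable(2)[OF V] cU] by (simp add: mult.commute)
  have g: "locally_integrable g"
  proof -
    have "locally_integrable (\<lambda>x. (1 / h\<^sup>2) * (V x * U x + (- 1) * ?f x))"
      by (intro locally_integrable_cmult locally_integrable_add VU li)
    then show ?thesis by (simp add: g_def[abs_def] field_simps)
  qed
  have "\<exists>U'. primitive U' g \<and> (AE x in lebesgue. rep_L2 u' x = U' x)"
  proof (rule du_Bois_Reymond[OF li g])
    fix \<phi> assume \<phi>: "test_function \<phi>"
    define I where "I = (LINT x|lebesgue. rep_L2 u' x * vderiv \<phi> x)"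
    have "distr_of (\<lambda>x. V x * rep_L2 u x) \<phi> = distr_of (\<lambda>x. V x * U x) \<phi>"
      using U(2) by (intro distr_of_cong_AE[OF _ _ _ \<phi>]) (measurable, auto elim: eventually_mono)
    moreover have "schroedinger_distr h V u \<phi> = distr_of ?f \<phi>"
      using schroedinger_distr_eq[OF u] \<phi> by (simp add: distr_eq_def)
    moreover have "distr_deriv (distr_deriv (distr_of (rep_L2 u))) \<phi> = - I"
      using u' test_function_vderiv[OF \<phi>]
      by (simp add: distr_eq_def distr_deriv_def[of "distr_deriv _"] I_def distr_of_def)
    ultimately have eq: "(complex_of_real h)\<^sup>2 * I + (LINT x|lebesgue. V x * U x * \<phi> x) = (LINT x|lebesgue. ?f x * \<phi> x)"
      by (simp add: schroedinger_distr_def distr_of_def)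
    have "(complex_of_real h)\<^sup>2 * (LINT x|lebesgue. g x * \<phi> x) = (LINT x|lebesgue. (complex_of_real h)\<^sup>2 * (g x * \<phi> x))"
      by simp
    also have "\<dots> = (LINT x|lebesgue. V x * U x * \<phi> x - ?f x * \<phi> x)"
      using h by (intro Bochner_Integration.integral_cong) (auto simp: g_def field_simps)
    also have "\<dots> = - ((complex_of_real h)\<^sup>2 * I)"
      unfolding Bochner_Integration.integral_diff[OF integrable_times_test_function[OF VU \<phi>]
            integrable_times_test_function[OF li \<phi>]] eq[symmetric] by simp
    finally have "(complex_of_real h)\<^sup>2 * (LINT x|lebesgue. g x * \<phi> x) = (complex_of_real h)\<^sup>2 * (- I)"
      by (simp only: mult_minus_right)
    then have "(LINT x|lebesgue. g x * \<phi> x) = - I"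
      using h by (simp only: mult_cancel_left) simp
    then show "I = - (LINT x|lebesgue. g x * \<phi> x)"
      by (simp only: minus_minus)
  qed
  then obtain U' where U': "primitive U' g" "AE x in lebesgue. rep_L2 u' x = U' x" by blast
  have mU': "U' \<in> borel_measurable lebesgue" by (rule primitive_measurable[OF U'(1)])
  show ?thesis
  proof (rule that[of U U'])
    show "primitive U U'" by (rule primitive_AE_cong[OF U(1) mU' U'(2)])
    show "primitive U' (\<lambda>x. (V x * U x - ?f x) / complex_of_real (h\<^sup>2))"
      using U'(1) by (simp add: g_def[abs_def])
    show "square_integrable U"
      by (rule square_integrable_cong_AE[OF square_integrable_rep_L2 _ U(2)]) measurable
    show "square_integrable U'"
      by (rule square_integrable_cong_AE[OF square_integrable_rep_L2 mU' U'(2)])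
  qed (rule U(2))
qed

text \<open>The converse passage. The uniform bound \<open>C\<close> supplies the essential
  boundedness that the domain asks of \<open>u\<close> and \<open>u'\<close>; integration by parts
  against test functions, used for \<open>U\<close> and for \<open>U'\<close>, identifies the
  distributions.\<close>

lemma primitive_in_domain:
  assumes V: "integrable lebesgue V" and h: "h > 0"
    and U: "primitive U U'" "square_integrable U" "\<And>x. cmod (U x) \<le> C"
    and U': "primitive U' (\<lambda>x. (V x * U x - rep_L2 f x) / complex_of_real (h\<^sup>2))" "square_integrable U'" "\<And>x. cmod (U' x) \<le> C"
  shows "abs_L2 U \<in> schroedinger_domain h V" and "schroedinger h V (abs_L2 U) = f"
proof -
  let ?u = "abs_L2 U" and ?u' = "abs_L2 U'"
  note AU = rep_abs_L2[OF U(2)] and AU' = rep_abs_L2[OF U'(2)]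
  have li: "locally_integrable (rep_L2 g)" for g
    by (intro square_integrable_locally_integrable square_integrable_rep_L2)
  have me [measurable]: "rep_L2 g \<in> borel_measurable lebesgue" for g
    by (intro square_integrable_measurable square_integrable_rep_L2)
  note [measurable] = potential_measurable(1)[OF V]
  have [measurable]: "U \<in> borel_measurable lebesgue" "U' \<in> borel_measurable lebesgue"
    by (rule primitive_measurable[OF U(1)], rule primitive_measurable[OF U'(1)])
  have "AE x in lebesgue. cmod (rep_L2 ?u x) \<le> C" "AE x in lebesgue. cmod (rep_L2 ?u' x) \<le> C"
    using AU by (eventually_elim, simp add: U(3), use AU' in \<open>eventually_elim, simp add: U'(3)\<close>)
  then have b: "ess_bounded (rep_L2 ?u)" "ess_bounded (rep_L2 ?u')"
    unfolding ess_bounded_def using me by blast+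
  have d: "distr_deriv (distr_of (rep_L2 ?u)) \<phi> = distr_of (rep_L2 ?u') \<phi>" if \<phi>: "test_function \<phi>" for \<phi>
  proof -
    have "distr_of (rep_L2 ?u) (vderiv \<phi>) = distr_of U (vderiv \<phi>)"
      by (rule distr_of_cong_AE[OF _ _ AU test_function_vderiv[OF \<phi>]]) measurable
    moreover have "distr_of (rep_L2 ?u') \<phi> = distr_of U' \<phi>"
      by (rule distr_of_cong_AE[OF _ _ AU' \<phi>]) measurable
    ultimately show ?thesis
      using primitive_test_function_by_parts[OF U(1) \<phi>] by (simp add: distr_deriv_def distr_of_def)
  qed
  have VU: "locally_integrable (\<lambda>x. complex_of_real (V x) * U x)"
    using locally_integrable_continuous_mult[OF potential_measurable(2)[OF V] primitive_continuous[OF U(1)]]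
    by (simp add: mult.commute)
  have s: "distr_eq (schroedinger_distr h V ?u) (distr_of (rep_L2 f))"
    unfolding distr_eq_def
  proof (intro allI impI)
    fix \<phi> assume \<phi>: "test_function \<phi>"
    have 1: "distr_of (\<lambda>x. V x * rep_L2 ?u x) \<phi> = distr_of (\<lambda>x. V x * U x) \<phi>"
      using AU by (intro distr_of_cong_AE[OF _ _ _ \<phi>]) (measurable, auto elim: eventually_mono)
    have "distr_deriv (distr_deriv (distr_of (rep_L2 ?u))) \<phi> = - distr_of (rep_L2 ?u') (vderiv \<phi>)"
      using d[OF test_function_vderiv[OF \<phi>]] by (simp add: distr_deriv_def[of "distr_deriv _"])
    also have "distr_of (rep_L2 ?u') (vderiv \<phi>) = distr_of U' (vderiv \<phi>)"
      by (rule distr_of_cong_AE[OF _ _ AU' test_function_vderiv[OF \<phi>]]) measurable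
    finally have 2: "distr_deriv (distr_deriv (distr_of (rep_L2 ?u))) \<phi> =
        (LINT x|lebesgue. (V x * U x - rep_L2 f x) / complex_of_real (h\<^sup>2) * \<phi> x)"
      using primitive_test_function_by_parts[OF U'(1) \<phi>] by (simp add: distr_of_def[of U'])
    have "(complex_of_real h)\<^sup>2 * (LINT x|lebesgue. (V x * U x - rep_L2 f x) / complex_of_real (h\<^sup>2) * \<phi> x) =
        (LINT x|lebesgue. (complex_of_real h)\<^sup>2 * ((V x * U x - rep_L2 f x) / complex_of_real (h\<^sup>2) * \<phi> x))"
      by simp
    also have "\<dots> = (LINT x|lebesgue. V x * U x * \<phi> x - rep_L2 f x * \<phi> x)"
      using h by (intro Bochner_Integration.integral_cong) (auto simp: field_simps)
    also have "\<dots> = distr_of (\<lambda>x. V x * U x) \<phi> - distr_of (rep_L2 f) \<phi>"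
      unfolding distr_of_def by (intro Bochner_Integration.integral_diff integrable_times_test_function VU li \<phi>)
    finally show "schroedinger_distr h V ?u \<phi> = distr_of (rep_L2 f) \<phi>"
      unfolding schroedinger_distr_def 1 2 by simp
  qed
  show "?u \<in> schroedinger_domain h V"
    using b d s by (auto simp: schroedinger_domain_def distr_eq_def)
  show "schroedinger h V ?u = f" by (rule schroedinger_eqI[OF s])
qed

section \<open>The weighted estimate\<close>

text \<open>The norm of a function rather than of a class in \<open>L2\<close>: the estimates work
  with the absolutely continuous representatives.\<close>

definition l2norm :: "(real \<Rightarrow> complex) \<Rightarrow> real" where
  "l2norm f = sqrt (LINT x|lebesgue. (cmod (f x))\<^sup>2)"

lemma l2norm_nonneg: "0 \<le> l2norm f"
  by (simp add: l2norm_def)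

lemma l2norm_power2: "(l2norm f)\<^sup>2 = (LINT x|lebesgue. (cmod (f x))\<^sup>2)"
  by (simp add: l2norm_def)

lemma square_integrable_norm_power2: "square_integrable f \<Longrightarrow> integrable lebesgue (\<lambda>x. (cmod (f x))\<^sup>2)"
  by (simp add: square_integrable_def)

lemma square_integrable_norm_mult:
  "square_integrable f \<Longrightarrow> square_integrable g \<Longrightarrow> integrable lebesgue (\<lambda>x. cmod (f x) * cmod (g x))"
  using integrable_norm[OF square_integrable_mult, of f g] by (simp add: norm_mult)

lemma l2norm_Cauchy_Schwarz:
  assumes "square_integrable f" "square_integrable g"
  shows "(LINT x|lebesgue. cmod (f x) * cmod (g x)) \<le> l2norm f * l2norm g"
  using Cauchy_Schwarz_integral[OF assms] by (simp add: l2norm_def)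

text \<open>The product rule yields complex densities, whereas the identities of the energy argument
  are real. Agreement almost everywhere suffices, which accommodates a potential that vanishes
  outside \<open>[-R, R]\<close> only almost everywhere.\<close>

lemma primitive_real_integral_zero:
  assumes N: "primitive N n" "integrable lebesgue N"
    and r: "integrable lebesgue r" "AE x in lebesgue. n x = complex_of_real (r x)"
  shows "(LINT x|lebesgue. r x) = 0"
proof -
  have "integrable lebesgue (\<lambda>x. complex_of_real (r x))"
    using r(1) by simp
  moreover from this have "primitive N (\<lambda>x. complex_of_real (r x))"
    using r(2) by (intro primitive_AE_cong[OF N(1)] borel_measurable_integrable)
  ultimately have "(LINT x|lebesgue. complex_of_real (r x)) = 0"
    using N(2) by (intro primitive_integral_zero)
  then show ?thesis by simp
qed

text \<open>The function is twice \<i> times the imaginary part of \<open>cnj U * U'\<close>. In its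
  derivative the terms \<open>|U'|^2\<close> cancel, and a real \<open>V\<close> contributes nothing
  to the imaginary part, so only \<open>Im z\<close> and the source survive. With a source this is
  the absorption identity; without one it gives the sign of the Weyl function.\<close>

lemma primitive_cnj_wronskian:
  fixes V :: "real \<Rightarrow> real" and U U' F :: "real \<Rightarrow> complex" and z :: complex
  assumes "primitive U U'" "primitive U' (\<lambda>x. (V x * U x - z * U x - F x) / complex_of_real (h\<^sup>2))"
  shows "primitive (\<lambda>x. cnj (U x) * U' x - U x * cnj (U' x))
    (\<lambda>x. - 2 * \<i> * complex_of_real ((Im z * (cmod (U x))\<^sup>2 + Im (cnj (U x) * F x)) / h\<^sup>2))"
proof -
  let ?n = "\<lambda>x. (V x * U x - z * U x - F x) / complex_of_real (h\<^sup>2)"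
  have "primitive (\<lambda>x. cnj (U x) * U' x - U x * cnj (U' x))
      (\<lambda>x. (cnj (U' x) * U' x + cnj (U x) * ?n x) - (U' x * cnj (U' x) + U x * cnj (?n x)))"
    by (intro primitive_diff primitive_mult primitive_cnj assms)
  moreover have "(cnj (U' x) * U' x + cnj (U x) * ?n x) - (U' x * cnj (U' x) + U x * cnj (?n x)) =
      - 2 * \<i> * complex_of_real ((Im z * (cmod (U x))\<^sup>2 + Im (cnj (U x) * F x)) / h\<^sup>2)" for x
  proof -
    define Q where "Q = Im z * (cmod (U x))\<^sup>2 + Im (cnj (U x) * F x)"
    have "(cnj (U' x) * U' x + cnj (U x) * ?n x) - (U' x * cnj (U' x) + U x * cnj (?n x)) =
        cnj (U x) * ?n x - cnj (cnj (U x) * ?n x)"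
      by (simp add: mult_ac)
    also have "\<dots> = 2 * \<i> * complex_of_real (Im (cnj (U x) * ?n x))"
      unfolding complex_diff_cnj by (simp only: mult_ac of_real_mult of_real_numeral)
    also have "cnj (U x) * ?n x = (cnj (U x) * (V x * U x - z * U x - F x)) / complex_of_real (h\<^sup>2)"
      by simp
    also have "Im \<dots> = Im (cnj (U x) * (V x * U x - z * U x - F x)) / h\<^sup>2"
      by (rule Im_divide_of_real)
    also have "Im (cnj (U x) * (V x * U x - z * U x - F x)) = - Q"
      unfolding Q_def cmod_power2 by (simp add: algebra_simps power2_eq_square)
    finally show ?thesis unfolding Q_def[symmetric] by simp
  qed
  ultimately show ?thesis by simp
qed

lemma absorption_estimate:
  fixes V :: "real \<Rightarrow> real" and U U' F :: "real \<Rightarrow> complex" and z :: complex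
  assumes P: "primitive U U'" "primitive U' (\<lambda>x. (V x * U x - z * U x - F x) / complex_of_real (h\<^sup>2))"
    and sq: "square_integrable U" "square_integrable U'" "square_integrable F" and h: "h > 0"
  shows "Im z * (l2norm U)\<^sup>2 \<le> (LINT x|lebesgue. cmod (U x) * cmod (F x))"
proof -
  define q where "q x = Im (cnj (U x) * F x)" for x
  define r where "r x = Im z * (cmod (U x))\<^sup>2 + q x" for x
  have FU: "integrable lebesgue q"
    unfolding q_def by (intro integrable_Im square_integrable_mult square_integrable_cnj sq)
  then have ri: "integrable lebesgue r"
    unfolding r_def by (intro Bochner_Integration.integrable_add integrable_mult_right
        square_integrable_norm_power2 sq)
  have "(LINT x|lebesgue. r x) = 0"
  proof (rule primitive_real_integral_zero)
    \<comment> \<open>The factor \<open>h^2 \<i> / 2\<close> turns the density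
      \<open>- 2 \<i> r / h^2\<close> into \<open>r\<close>.\<close>
    show "primitive (\<lambda>x. complex_of_real (h\<^sup>2) * (\<i> / 2) * (cnj (U x) * U' x - U x * cnj (U' x)))
      (\<lambda>x. complex_of_real (h\<^sup>2) * (\<i> / 2) * (- 2 * \<i> * complex_of_real (r x / h\<^sup>2)))"
      unfolding r_def q_def by (intro primitive_cmult primitive_cnj_wronskian[OF P])
    show "integrable lebesgue (\<lambda>x. complex_of_real (h\<^sup>2) * (\<i> / 2) * (cnj (U x) * U' x - U x * cnj (U' x)))"
      by (intro integrable_mult_right Bochner_Integration.integrable_diff square_integrable_mult square_integrable_cnj sq)
    show "AE x in lebesgue. complex_of_real (h\<^sup>2) * (\<i> / 2) * (- 2 * \<i> * complex_of_real (r x / h\<^sup>2)) = complex_of_real (r x)"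
      using h by simp
  qed (rule ri)
  then have "Im z * (l2norm U)\<^sup>2 = (LINT x|lebesgue. - q x)"
    using FU sq by (simp add: r_def l2norm_power2 square_integrable_norm_power2 eq_neg_iff_add_eq_0)
  also have "\<dots> \<le> (LINT x|lebesgue. cmod (U x) * cmod (F x))"
  proof (rule integral_mono)
    show "integrable lebesgue (\<lambda>x. - q x)" using FU by simp
    show "integrable lebesgue (\<lambda>x. cmod (U x) * cmod (F x))"
      by (intro square_integrable_norm_mult sq)
    show "- q x \<le> cmod (U x) * cmod (F x)" for x
      unfolding q_def using abs_Im_le_cmod[of "cnj (U x) * F x"] by (simp add: norm_mult)
  qed
  finally show ?thesis .
qed

section \<open>The multiplier and the estimate outside the support of the potential\<close>

definition exterior_weight :: "real \<Rightarrow> real \<Rightarrow> real \<Rightarrow> real" where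
  "exterior_weight R \<delta> x = indicat_real {x. R < \<bar>x\<bar>} x * (1 + \<bar>x\<bar>) powr (- ((1 + \<delta>) / 2))"

lemma exterior_weight_bounds:
  assumes "\<delta> > 0"
  shows "0 \<le> exterior_weight R \<delta> x" "exterior_weight R \<delta> x \<le> 1"
proof -
  have "(1 + \<bar>x\<bar>) powr (- ((1 + \<delta>) / 2)) \<le> 1"
    using assms powr_mono[of "- ((1 + \<delta>) / 2)" 0 "1 + \<bar>x\<bar>"] by (simp add: add_nonneg_eq_0_iff split: if_splits)
  then show "0 \<le> exterior_weight R \<delta> x" "exterior_weight R \<delta> x \<le> 1"
    by (auto simp: exterior_weight_def indicator_def)
qed

lemma exterior_weight_measurable: "(\<lambda>x. exterior_weight R \<delta> x) \<in> borel_measurable lebesgue"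
  unfolding exterior_weight_def by (intro borel_measurable_lebesgueI) measurable

lemma exterior_weight_power2:
  "(exterior_weight R \<delta> x)\<^sup>2 = (if R < \<bar>x\<bar> then (1 + \<bar>x\<bar>) powr (- 1 - \<delta>) else 0)"
  by (simp add: exterior_weight_def power2_eq_square powr_add[symmetric] indicator_def add_divide_distrib)

lemma locally_integrable_bounded:
  assumes "m \<in> borel_measurable lebesgue" "\<And>x. cmod (m x) \<le> C"
  shows "locally_integrable m"
proof -
  have "bounded (range m)" using assms(2) by (auto simp: bounded_iff)
  have "locally_integrable (\<lambda>x. m x * 1)"
    unfolding locally_integrable_def set_integrable_def
  proof (intro allI)
    fix a b
    have 1: "square_integrable (\<lambda>x. m x * complex_of_real (indicat_real {a..b} x))"
      by (rule square_integrable_mult_bounded[OF square_integrable_indicator assms(1) \<open>bounded (range m)\<close>])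
    have "integrable lebesgue (\<lambda>x. complex_of_real (indicat_real {a..b} x) *
        (m x * complex_of_real (indicat_real {a..b} x)))"
      by (rule square_integrable_mult[OF square_integrable_indicator 1])
    moreover have "complex_of_real (indicat_real {a..b} x) * (m x * complex_of_real (indicat_real {a..b} x)) =
        indicat_real {a..b} x *\<^sub>R (m x * 1)" for x
      by (simp add: indicator_def)
    ultimately show "integrable lebesgue (\<lambda>x. indicat_real {a..b} x *\<^sub>R (m x * 1))" by simp
  qed
  then show ?thesis by simp
qed

text \<open>The multiplier of the energy argument: odd, and for \<open>x > R\<close> equal to
  \<open>1 - ((1 + R) / (1 + x)) powr \<delta>\<close>, so that its derivative is a multiple of the squared weight.\<close>

lemma exterior_multiplier:
  assumes R: "R \<ge> 0" and \<delta>: "\<delta> > 0"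
  obtains \<psi> :: "real \<Rightarrow> real" where
    "primitive (\<lambda>x. complex_of_real (\<psi> x))
      (\<lambda>x. complex_of_real (\<delta> * (1 + R) powr \<delta> * (exterior_weight R \<delta> x)\<^sup>2))"
    "\<And>x. \<bar>\<psi> x\<bar> \<le> 1" "\<And>x. \<bar>x\<bar> \<le> R \<Longrightarrow> \<psi> x = 0"
proof -
  define D where "D x = complex_of_real (\<delta> * (1 + R) powr \<delta> * (exterior_weight R \<delta> x)\<^sup>2)" for x
  have D_even: "D (- x) = D x" for x
    by (simp add: D_def exterior_weight_power2)
  have "locally_integrable D"
  proof (rule locally_integrable_bounded)
    note [measurable] = exterior_weight_measurable[of R \<delta>]
    have "(\<lambda>x. \<delta> * (1 + R) powr \<delta> * (exterior_weight R \<delta> x)\<^sup>2) \<in> borel_measurable lebesgue"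
      by measurable
    then show "D \<in> borel_measurable lebesgue"
      unfolding D_def by (rule of_real_measurable)
    show "cmod (D x) \<le> \<delta> * (1 + R) powr \<delta>" for x
    proof -
      have "(exterior_weight R \<delta> x)\<^sup>2 \<le> 1"
        using exterior_weight_bounds[OF \<delta>, of R x] by (simp add: power_le_one)
      then have "\<delta> * (1 + R) powr \<delta> * (exterior_weight R \<delta> x)\<^sup>2 \<le> \<delta> * (1 + R) powr \<delta> * 1"
        using \<delta> by (intro mult_left_mono) auto
      then show ?thesis unfolding D_def norm_of_real using \<delta> by simp
    qed
  qed
  then obtain \<Psi> where \<Psi>: "primitive \<Psi> D" "\<Psi> 0 = 0"
    using primitive_of_locally_integrable by blast
  \<comment> \<open>The primitive is obtained abstractly, with value 0 at 0; that it is real and odd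
    follows from uniqueness, since its density is real and even.\<close>
  have "primitive (\<lambda>x. cnj (\<Psi> x)) (\<lambda>x. cnj (D x))"
    by (rule primitive_cnj[OF \<Psi>(1)])
  then have "cnj (\<Psi> x) - \<Psi> x = cnj (\<Psi> 0) - \<Psi> 0" for x
    by (rule primitive_unique[OF _ \<Psi>(1)]) (simp add: D_def)
  then have real: "\<Psi> x = complex_of_real (Re (\<Psi> x))" for x
    using \<Psi>(2) by (simp add: complex_eq_iff)
  have odd: "\<Psi> (- x) = - \<Psi> x" for x
  proof -
    have "primitive (\<lambda>x. \<Psi> (- x)) (\<lambda>x. - D (- x))" "primitive (\<lambda>x. - \<Psi> x) (\<lambda>x. - D x)"
      by (intro primitive_reflect primitive_uminus \<Psi>)+
    then show ?thesis
      using primitive_unique[of "\<lambda>x. \<Psi> (- x)" "\<lambda>x. - D (- x)" "\<lambda>x. - \<Psi> x" "\<lambda>x. - D x" x] \<Psi>(2)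
      by (simp add: D_even add_eq_0_iff2)
  qed
  have zero: "\<Psi> x = 0" if "0 \<le> x" "x \<le> R" for x
  proof -
    have "(LINT t:{0..x}|lebesgue. D t) = (LINT t:{0..x}|lebesgue. 0)"
      using that by (intro set_lebesgue_integral_cong) (auto simp: D_def exterior_weight_power2)
    then show ?thesis
      using primitive_integral[OF \<Psi>(1) that(1)] \<Psi>(2) by simp
  qed
  have outer: "Re (\<Psi> x) = 1 - (1 + R) powr \<delta> * (1 + x) powr (- \<delta>)" if "R \<le> x" for x
  proof -
    define G where "G t = complex_of_real (- ((1 + R) powr \<delta> * (1 + t) powr (- \<delta>)))" for t
    \<comment> \<open>The derivative is matched on the open interval only: at \<open>R\<close>
      itself the cutoff makes \<open>D\<close> vanish, whereas the derivative of \<open>G\<close>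
      there is not 0.\<close>
    have "(D has_integral (G x - G R)) {R..x}"
    proof (rule fundamental_theorem_of_calculus_interior[OF that])
      show "continuous_on {R..x} G"
        unfolding G_def using R by (intro continuous_intros) auto
      fix t assume t: "t \<in> {R<..<x}"
      have "- 1 - \<delta> = - \<delta> - 1" by simp
      moreover have "(1 + t) powr (- \<delta> - 1) = (1 + t) powr (- \<delta>) / (1 + t)"
        using t R by (simp only: powr_diff) simp
      ultimately have eq: "(1 + t) powr (- \<delta> - 1) = (1 + t) powr (- \<delta>) / (1 + t)"
        "(1 + t) powr (- 1 - \<delta>) = (1 + t) powr (- \<delta>) / (1 + t)"
        by (simp_all only:)
      have "((\<lambda>t. - ((1 + R) powr \<delta> * (1 + t) powr (- \<delta>))) has_real_derivative
          \<delta> * (1 + R) powr \<delta> * (exterior_weight R \<delta> t)\<^sup>2) (at t)"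
        unfolding exterior_weight_power2 using t R eq by (auto intro!: derivative_eq_intros)
      then show "(G has_vector_derivative D t) (at t)"
        unfolding G_def D_def
        by (intro bounded_linear.has_vector_derivative[OF bounded_linear_of_real])
           (simp only: has_real_derivative_iff_has_vector_derivative)
    qed
    moreover have "(LINT t:{R..x}|lebesgue. D t) = integral {R..x} D"
      by (rule set_lebesgue_integral_eq_integral(2)[OF primitive_integrable[OF \<Psi>(1)]])
    ultimately have "\<Psi> x - \<Psi> R = G x - G R"
      using primitive_integral[OF \<Psi>(1) that] by (simp add: integral_unique)
    moreover have "G R = - 1"
      using R by (simp add: G_def powr_add[symmetric])
    ultimately have "\<Psi> x = G x + 1"
      using zero[of R] R by simp
    then show ?thesis by (simp add: G_def)
  qed
  have bound: "\<bar>Re (\<Psi> x)\<bar> \<le> 1" if "R \<le> x" for x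
  proof -
    have "(1 + R) powr \<delta> \<le> (1 + x) powr \<delta>"
      using that R \<delta> by (intro powr_mono2) auto
    then have "(1 + R) powr \<delta> * (1 + x) powr (- \<delta>) \<le> (1 + x) powr \<delta> * (1 + x) powr (- \<delta>)"
      by (intro mult_right_mono) auto
    also have "\<dots> = 1" using that R by (simp add: powr_add[symmetric])
    finally show ?thesis
      unfolding outer[OF that] by simp
  qed
  show thesis
  proof (rule that[of "\<lambda>x. Re (\<Psi> x)"])
    show "primitive (\<lambda>x. complex_of_real (Re (\<Psi> x)))
        (\<lambda>x. complex_of_real (\<delta> * (1 + R) powr \<delta> * (exterior_weight R \<delta> x)\<^sup>2))"
      using \<Psi>(1) by (simp add: real[symmetric] D_def[abs_def])
    show "Re (\<Psi> x) = 0" if "\<bar>x\<bar> \<le> R" for x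
      using that zero[of x] zero[of "- x"] odd[of x] by (cases "0 \<le> x") auto
    then show "\<bar>Re (\<Psi> x)\<bar> \<le> 1" for x
      using bound[of x] bound[of "- x"] odd[of x] by (cases "R \<le> x"; cases "R \<le> - x") auto
  qed
qed

text \<open>In the application \<mu>, \<alpha>, \<beta>, \<gamma>, \<kappa> are the norms of
  \<open>u\<close>, \<open>w u'\<close>, \<open>w u\<close>, \<open>g\<close>,
  \<open>\<psi> u'\<close>, and \<open>c = \<delta> (1 + R) powr \<delta>\<close>. Inequalities 1
  and 3 bound \<open>\<epsilon> \<mu> \<kappa>\<close> without negative powers of \<epsilon>. Then 2
  closes by Young's inequality, as \<alpha> and \<beta> enter the resulting right-hand side with
  total degree below two.\<close>

lemma resolvent_estimate_algebra:
  fixes E \<epsilon> c h \<mu> \<alpha> \<beta> \<gamma> \<kappa> :: real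
  assumes E: "E \<ge> 2 * \<epsilon>" "\<epsilon> > 0" and c: "c > 0" and h: "h > 0"
    and nn: "0 \<le> \<mu>" "0 \<le> \<alpha>" "0 \<le> \<beta>" "0 \<le> \<gamma>" "0 \<le> \<kappa>"
    and 1: "\<epsilon> * \<mu>\<^sup>2 \<le> \<beta> * \<gamma>"
    and 2: "c * (h\<^sup>2 * \<alpha>\<^sup>2 + E * \<beta>\<^sup>2) \<le> 2 * \<epsilon> * (\<mu> * \<kappa>) + 2 * (\<alpha> * \<gamma>)"
    and 3: "h\<^sup>2 * \<kappa>\<^sup>2 \<le> E * \<mu>\<^sup>2 + \<beta> * \<gamma> + 2 * h\<^sup>2 * c * (\<beta> * \<alpha>)"
  shows "\<beta> \<le> 8 * \<gamma> / (c * sqrt E * h)"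
proof -
  \<comment> \<open>The scaling absorbs \<open>h\<close> and \<open>E\<close>: the inequalities
    \<open>k\<close> and \<open>m\<close> below involve only \<open>s\<close>, \<open>A\<close>,
    \<open>B\<close>, \<open>X\<close> and \<gamma>.\<close>
  define s A B X where "s = h * c" and "A = h * \<alpha>" and "B = sqrt E * \<beta>" and "X = h * (\<epsilon> * (\<mu> * \<kappa>))"
  have E0: "0 < E" using E by linarith
  have B2: "B\<^sup>2 = E * \<beta>\<^sup>2" using E0 by (simp add: B_def power_mult_distrib)
  have s: "s > 0" using c h by (simp add: s_def)
  have AB: "0 \<le> A" "0 \<le> B" "0 \<le> X" using nn h E E0 by (auto simp: A_def B_def X_def)
  have k: "X\<^sup>2 \<le> B\<^sup>2 * \<gamma> * (3 / 2 * \<gamma> + s * A)"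
  proof -
    have e0: "0 \<le> \<epsilon> * \<mu>\<^sup>2" using E by simp
    have "X\<^sup>2 = (\<epsilon> * \<mu>\<^sup>2) * (\<epsilon> * (h\<^sup>2 * \<kappa>\<^sup>2))"
      by (simp add: X_def power2_eq_square mult_ac)
    also have "\<dots> \<le> (\<epsilon> * \<mu>\<^sup>2) * (\<epsilon> * (E * \<mu>\<^sup>2 + \<beta> * \<gamma> + 2 * h\<^sup>2 * c * (\<beta> * \<alpha>)))"
      using 3 E e0 by (intro mult_left_mono) auto
    also have "\<dots> = (\<epsilon> * \<mu>\<^sup>2) * (E * (\<epsilon> * \<mu>\<^sup>2) + \<epsilon> * (\<beta> * \<gamma> + 2 * s * (\<beta> * A)))"
      by (simp add: s_def A_def power2_eq_square algebra_simps)
    \<comment> \<open>Inequality 1 removes each \<open>\<epsilon> \<mu>^2\<close>, and the remaining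
      \<epsilon> is at most \<open>E / 2\<close>. This is where the size of \<epsilon> relative to
      \<open>E\<close> enters, and it produces the factor \<open>3 / 2 = 1 + 1 / 2\<close>.\<close>
    also have "\<dots> \<le> (\<beta> * \<gamma>) * (E * (\<beta> * \<gamma>) + (E / 2) * (\<beta> * \<gamma> + 2 * s * (\<beta> * A)))"
    proof (rule mult_mono[OF 1 add_mono])
      show "E * (\<epsilon> * \<mu>\<^sup>2) \<le> E * (\<beta> * \<gamma>)"
        using 1 E0 by (intro mult_left_mono) auto
      have "0 \<le> \<beta> * \<gamma> + 2 * s * (\<beta> * A)"
        using nn s AB by (intro add_nonneg_nonneg mult_nonneg_nonneg) auto
      then show "\<epsilon> * (\<beta> * \<gamma> + 2 * s * (\<beta> * A)) \<le> (E / 2) * (\<beta> * \<gamma> + 2 * s * (\<beta> * A))"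
        using E by (intro mult_right_mono) auto
      show "0 \<le> E * (\<epsilon> * \<mu>\<^sup>2) + \<epsilon> * (\<beta> * \<gamma> + 2 * s * (\<beta> * A))"
        using E E0 e0 nn s AB by (intro add_nonneg_nonneg mult_nonneg_nonneg) auto
    qed (use nn in simp)
    also have "\<dots> = (E * \<beta>\<^sup>2) * \<gamma> * (3 / 2 * \<gamma> + s * A)"
      by (simp add: power2_eq_square algebra_simps)
    finally show ?thesis by (simp add: B2)
  qed
  have "s * (A\<^sup>2 + B\<^sup>2) = h * (c * (h\<^sup>2 * \<alpha>\<^sup>2 + E * \<beta>\<^sup>2))"
    by (simp add: B2 s_def A_def power_mult_distrib)
  also have "\<dots> \<le> h * (2 * \<epsilon> * (\<mu> * \<kappa>) + 2 * (\<alpha> * \<gamma>))"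
    using 2 h by (intro mult_left_mono) auto
  also have "\<dots> = 2 * X + 2 * (A * \<gamma>)"
    by (simp add: X_def A_def algebra_simps)
  finally have m: "s * (A\<^sup>2 + B\<^sup>2) \<le> 2 * X + 2 * (A * \<gamma>)" .
  define Y where "Y = \<gamma> * (3 / 2 * \<gamma> + s * A)"
  have Y: "0 \<le> Y" using nn s AB by (simp add: Y_def)
  have "X \<le> B * sqrt Y"
  proof (rule power2_le_imp_le)
    show "X\<^sup>2 \<le> (B * sqrt Y)\<^sup>2"
      using k Y by (simp add: power_mult_distrib Y_def mult.assoc)
  qed (use AB Y in simp)
  then have "s * X \<le> s * (B * sqrt Y)"
    using s by (intro mult_left_mono) auto
  \<comment> \<open>Young's inequality, weighted so that half of \<open>(s B)^2\<close> is left over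
    on the other side.\<close>
  moreover have "2 * (s * (B * sqrt Y)) \<le> (s * B)\<^sup>2 / 2 + 2 * Y"
    using zero_le_power2[of "s * B - 2 * sqrt Y"] Y by (simp add: power2_diff power_mult_distrib algebra_simps)
  ultimately have "2 * (s * X) \<le> (s * B)\<^sup>2 / 2 + 2 * Y"
    by linarith
  moreover have "s * (s * (A\<^sup>2 + B\<^sup>2)) \<le> s * (2 * X + 2 * (A * \<gamma>))"
    using m s by (intro mult_left_mono) auto
  ultimately have "(s * A)\<^sup>2 + (s * B)\<^sup>2 / 2 \<le> 3 * \<gamma>\<^sup>2 + 4 * \<gamma> * (s * A)"
    by (simp add: Y_def power2_eq_square algebra_simps)
  moreover have "4 * \<gamma> * (s * A) \<le> (s * A)\<^sup>2 + 4 * \<gamma>\<^sup>2"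
    using zero_le_power2[of "s * A - 2 * \<gamma>"] by (simp add: power2_diff power_mult_distrib algebra_simps)
  moreover have "(8 * \<gamma>)\<^sup>2 = 64 * \<gamma>\<^sup>2"
    by (simp add: power2_eq_square)
  moreover have "0 \<le> \<gamma>\<^sup>2" by simp
  \<comment> \<open>After the second completed square the terms \<open>(s A)^2\<close> cancel and
    \<open>(s B)^2 \<le> 14 \<gamma>^2\<close> remains; the square of the constant 8 leaves ample
    room.\<close>
  ultimately have "(s * B)\<^sup>2 \<le> (8 * \<gamma>)\<^sup>2" by linarith
  then have "s * B \<le> 8 * \<gamma>"
    by (rule power2_le_imp_le) (use nn in simp)
  moreover have "s * B = \<beta> * (c * sqrt E * h)"
    by (simp add: s_def B_def mult_ac)
  moreover have "0 < c * sqrt E * h"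
    using c h E0 by simp
  ultimately show ?thesis
    by (simp only: pos_le_divide_eq)
qed

text \<open>The potential enters only through being real and through \<open>\<psi> V = 0\<close>
  almost everywhere, so neither its size nor its sign affects the constant. Steps 1, 2 and 3 are the
  inequalities fed to \<open>resolvent_estimate_algebra\<close>.\<close>

lemma exterior_estimate:
  fixes V :: "real \<Rightarrow> real" and U U' G :: "real \<Rightarrow> complex" and z :: complex
  assumes R: "R \<ge> 0" and V: "AE x in lebesgue. \<bar>x\<bar> > R \<longrightarrow> V x = 0"
    and E: "E \<ge> 2 * \<epsilon>" "\<epsilon> > 0" and \<delta>: "\<delta> > 0" and h: "h > 0"
    and z: "z = complex_of_real E + \<i> * complex_of_real \<epsilon>"
    and P: "primitive U U'" "primitive U' (\<lambda>x. (V x * U x - z * U x - exterior_weight R \<delta> x * G x) / complex_of_real (h\<^sup>2))"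
    and sq: "square_integrable U" "square_integrable U'" "square_integrable G"
  shows "l2norm (\<lambda>x. exterior_weight R \<delta> x * U x) \<le> 8 * l2norm G / (\<delta> * (1 + R) powr \<delta> * sqrt E * h)"
proof -
  define w where "w = exterior_weight R \<delta>"
  define c where "c = \<delta> * (1 + R) powr \<delta>"
  define F where "F x = w x * G x" for x
  obtain \<psi> :: "real \<Rightarrow> real" where \<psi>: "primitive (\<lambda>x. complex_of_real (\<psi> x)) (\<lambda>x. complex_of_real (c * (w x)\<^sup>2))"
    "\<And>x. \<bar>\<psi> x\<bar> \<le> 1" "\<And>x. \<bar>x\<bar> \<le> R \<Longrightarrow> \<psi> x = 0"
    using exterior_multiplier[OF R \<delta>] unfolding c_def w_def by blast
  have c: "c > 0" using \<delta> R by (simp add: c_def)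
  have w: "0 \<le> w x" "w x \<le> 1" for x
    using exterior_weight_bounds[OF \<delta>, of R x] by (auto simp: w_def)
  have bdw: "bounded (range (\<lambda>x. complex_of_real (w x)))" "bounded (range (\<lambda>x. complex_of_real (\<psi> x)))"
    using w \<psi>(2) by (auto simp: bounded_iff intro!: exI[of _ 1])
  have mw: "(\<lambda>x. complex_of_real (w x)) \<in> borel_measurable lebesgue"
    unfolding w_def by (rule of_real_measurable[OF exterior_weight_measurable])
  have m\<psi>: "(\<lambda>x. complex_of_real (\<psi> x)) \<in> borel_measurable lebesgue"
    by (rule primitive_measurable[OF \<psi>(1)])
  have sqw: "square_integrable (\<lambda>x. w x * f x)" and sq\<psi>: "square_integrable (\<lambda>x. \<psi> x * f x)"
    if "square_integrable f" for f :: "real \<Rightarrow> complex"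
    using square_integrable_mult_bounded[OF that mw bdw(1)] square_integrable_mult_bounded[OF that m\<psi> bdw(2)] .
  have sqF: "square_integrable F" unfolding F_def by (rule sqw[OF sq(3)])
  have cF: "cmod (F x) = w x * cmod (G x)" for x
    using w[of x] by (simp add: F_def norm_mult)
  define n where "n x = (V x * U x - z * U x - F x) / complex_of_real (h\<^sup>2)" for x
  have P': "primitive U' n"
    using P(2) by (simp add: n_def[abs_def] F_def w_def)
  have hn: "complex_of_real (h\<^sup>2) * n x = V x * U x - z * U x - F x" for x
    using h by (simp add: n_def)
  have \<psi>V: "AE x in lebesgue. \<psi> x * V x = 0"
    using V by eventually_elim (use \<psi>(3) in \<open>auto simp: not_less[symmetric]\<close>)
  let ?\<mu> = "l2norm U" and ?\<alpha> = "l2norm (\<lambda>x. w x * U' x)" and ?\<beta> = "l2norm (\<lambda>x. w x * U x)"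
    and ?\<gamma> = "l2norm G" and ?\<kappa> = "l2norm (\<lambda>x. \<psi> x * U' x)"
  have 1: "\<epsilon> * ?\<mu>\<^sup>2 \<le> ?\<beta> * ?\<gamma>"
  proof -
    have "\<epsilon> * ?\<mu>\<^sup>2 \<le> (LINT x|lebesgue. cmod (U x) * cmod (F x))"
      using absorption_estimate[OF P(1) P'[unfolded n_def] sq(1,2) sqF h] by (simp add: z)
    also have "\<dots> = (LINT x|lebesgue. cmod (w x * U x) * cmod (G x))"
      using w by (simp add: cF norm_mult mult_ac)
    also have "\<dots> \<le> ?\<beta> * ?\<gamma>"
      by (rule l2norm_Cauchy_Schwarz[OF sqw[OF sq(1)] sq(3)])
    finally show ?thesis .
  qed
  have 2: "c * (h\<^sup>2 * ?\<alpha>\<^sup>2 + E * ?\<beta>\<^sup>2) \<le> 2 * \<epsilon> * (?\<mu> * ?\<kappa>) + 2 * (?\<alpha> * ?\<gamma>)"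
  proof -
    \<comment> \<open>This is the derivative of \<open>\<psi> (h^2 |U'|^2 + E |U|^2)\<close>. Since
      \<open>h^2 U'' = V U - E U - (\<i> \<epsilon> U + F)\<close>, the terms with
      \<open>\<psi> E\<close> cancel and the one with \<open>V\<close> is killed by \<psi>; the
      weighted squares come from the derivative of \<psi>.\<close>
    define r where "r x = c * (h\<^sup>2 * (cmod (w x * U' x))\<^sup>2 + E * (cmod (w x * U x))\<^sup>2) -
      2 * Re ((\<i> * \<epsilon> * U x + F x) * cnj (\<psi> x * U' x))" for x
    define X where "X x = c * (h\<^sup>2 * (cmod (w x * U' x))\<^sup>2 + E * (cmod (w x * U x))\<^sup>2)" for x
    define Y where "Y x = 2 * \<epsilon> * (cmod (U x) * cmod (\<psi> x * U' x)) + 2 * (cmod (w x * U' x) * cmod (G x))" for x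
    have Xi: "integrable lebesgue X"
      unfolding X_def by (intro integrable_mult_right Bochner_Integration.integrable_add
          square_integrable_norm_power2 sqw sq)
    have Yi: "integrable lebesgue Y"
      unfolding Y_def by (intro integrable_mult_right Bochner_Integration.integrable_add
          square_integrable_norm_mult sqw sq\<psi> sq)
    have ri: "integrable lebesgue r"
      unfolding r_def X_def[symmetric]
      by (intro Bochner_Integration.integrable_diff Xi integrable_mult_right integrable_Re square_integrable_mult
          square_integrable_add square_integrable_cmult square_integrable_cnj sq sqF sq\<psi>)
    let ?c = complex_of_real
    let ?N = "\<lambda>x. ?c (\<psi> x) * (?c (h\<^sup>2) * (U' x * cnj (U' x)) + ?c E * (U x * cnj (U x)))"
    let ?n = "\<lambda>x. ?c (c * (w x)\<^sup>2) * (?c (h\<^sup>2) * (U' x * cnj (U' x)) + ?c E * (U x * cnj (U x))) +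
      ?c (\<psi> x) * (?c (h\<^sup>2) * (n x * cnj (U' x) + U' x * cnj (n x)) +
        ?c E * (U' x * cnj (U x) + U x * cnj (U' x)))"
    have "(LINT x|lebesgue. r x) = 0"
    proof (rule primitive_real_integral_zero)
      show "primitive ?N ?n"
        by (intro primitive_mult primitive_add primitive_cmult primitive_cnj \<psi>(1) P(1) P')
      have "integrable lebesgue (\<lambda>x. ?c (h\<^sup>2) * ((\<psi> x * U' x) * cnj (U' x)) + ?c E * ((\<psi> x * U x) * cnj (U x)))"
        by (intro Bochner_Integration.integrable_add integrable_mult_right square_integrable_mult square_integrable_cnj sq sq\<psi>)
      then show "integrable lebesgue ?N"
        by (simp add: algebra_simps)
      show "AE x in lebesgue. ?n x = ?c (r x)"
        using \<psi>V
      proof eventually_elim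
        case (elim x)
        define v q where "v = \<i> * \<epsilon> * U x + F x" and "q = Re (v * cnj (\<psi> x * U' x))"
        have "?c (h\<^sup>2) * (n x * cnj (U' x) + U' x * cnj (n x)) =
            (?c (h\<^sup>2) * n x) * cnj (U' x) + U' x * cnj (?c (h\<^sup>2) * n x)"
          by (simp add: algebra_simps)
        also have "\<dots> = (V x * U x - E * U x - v) * cnj (U' x) + U' x * cnj (V x * U x - E * U x - v)"
          unfolding hn by (simp add: v_def z algebra_simps)
        finally have b: "?c (h\<^sup>2) * (n x * cnj (U' x) + U' x * cnj (n x)) =
            (V x * U x - E * U x - v) * cnj (U' x) + U' x * cnj (V x * U x - E * U x - v)" .
        have "\<psi> x * (?c (h\<^sup>2) * (n x * cnj (U' x) + U' x * cnj (n x)) +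
            ?c E * (U' x * cnj (U x) + U x * cnj (U' x))) =
            ?c (\<psi> x * V x) * (U x * cnj (U' x) + U' x * cnj (U x)) -
            (v * cnj (\<psi> x * U' x) + cnj (v * cnj (\<psi> x * U' x)))"
          unfolding b by (simp add: algebra_simps)
        also have "\<dots> = - ?c (2 * q)"
          unfolding elim complex_add_cnj q_def by (simp only: of_real_0 mult_zero_left diff_0)
        finally have d: "\<psi> x * (?c (h\<^sup>2) * (n x * cnj (U' x) + U' x * cnj (n x)) +
            ?c E * (U' x * cnj (U x) + U x * cnj (U' x))) = - ?c (2 * q)" .
        show ?case
          unfolding d r_def v_def[symmetric] q_def[symmetric] complex_norm_square[symmetric]
          by (simp add: norm_mult power_mult_distrib algebra_simps)
      qed
    qed (rule ri)
    moreover have "X x - Y x \<le> r x" for x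
    proof -
      have "Re ((\<i> * \<epsilon> * U x + F x) * cnj (\<psi> x * U' x)) \<le> cmod ((\<i> * \<epsilon> * U x + F x) * cnj (\<psi> x * U' x))"
        by (rule complex_Re_le_cmod)
      also have "\<dots> = cmod (\<i> * \<epsilon> * U x + F x) * (\<bar>\<psi> x\<bar> * cmod (U' x))"
        by (simp add: norm_mult)
      also have "\<dots> \<le> (\<epsilon> * cmod (U x) + cmod (F x)) * (\<bar>\<psi> x\<bar> * cmod (U' x))"
        using E norm_triangle_ineq[of "\<i> * \<epsilon> * U x" "F x"] by (intro mult_right_mono) (auto simp: norm_mult)
      also have "\<dots> = \<epsilon> * cmod (U x) * (\<bar>\<psi> x\<bar> * cmod (U' x)) + (cmod (F x) * cmod (U' x)) * \<bar>\<psi> x\<bar>"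
        by (simp add: algebra_simps)
      \<comment> \<open>The factor \<psi> is given up only in the source term, where the weight of
        \<open>F\<close> passes to \<open>U'\<close>. In the absorption term it is kept, because
        step 3 controls \<open>\<psi> U'\<close> and not \<open>U'\<close>.\<close>
      also have "\<dots> \<le> \<epsilon> * cmod (U x) * (\<bar>\<psi> x\<bar> * cmod (U' x)) + (cmod (F x) * cmod (U' x)) * 1"
        using \<psi>(2)[of x] by (intro add_left_mono mult_left_mono) auto
      finally show ?thesis
        using w[of x] by (simp add: X_def Y_def r_def cF norm_mult algebra_simps)
    qed
    then have "(LINT x|lebesgue. X x - Y x) \<le> (LINT x|lebesgue. r x)"
      by (intro integral_mono Bochner_Integration.integrable_diff Xi Yi ri)
    ultimately have "(LINT x|lebesgue. X x) \<le> (LINT x|lebesgue. Y x)"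
      using Xi Yi by simp
    moreover have "(LINT x|lebesgue. X x) = c * (h\<^sup>2 * ?\<alpha>\<^sup>2 + E * ?\<beta>\<^sup>2)"
      unfolding X_def l2norm_power2
      using square_integrable_norm_power2[OF sqw[OF sq(1)]] square_integrable_norm_power2[OF sqw[OF sq(2)]] by simp
    moreover have "(LINT x|lebesgue. Y x) \<le> 2 * \<epsilon> * (?\<mu> * ?\<kappa>) + 2 * (?\<alpha> * ?\<gamma>)"
    proof -
      have "(LINT x|lebesgue. Y x) = 2 * \<epsilon> * (LINT x|lebesgue. cmod (U x) * cmod (\<psi> x * U' x)) +
          2 * (LINT x|lebesgue. cmod (w x * U' x) * cmod (G x))"
        unfolding Y_def using square_integrable_norm_mult[OF sq(1) sq\<psi>[OF sq(2)]]
          square_integrable_norm_mult[OF sqw[OF sq(2)] sq(3)] by simp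
      also have "\<dots> \<le> 2 * \<epsilon> * (?\<mu> * ?\<kappa>) + 2 * (?\<alpha> * ?\<gamma>)"
        using E by (intro add_mono mult_left_mono l2norm_Cauchy_Schwarz sq sqw sq\<psi>) auto
      finally show ?thesis .
    qed
    ultimately show ?thesis by linarith
  qed
  have 3: "h\<^sup>2 * ?\<kappa>\<^sup>2 \<le> E * ?\<mu>\<^sup>2 + ?\<beta> * ?\<gamma> + 2 * h\<^sup>2 * c * (?\<beta> * ?\<alpha>)"
  proof -
    \<comment> \<open>This is the derivative of \<open>h^2 \<psi>^2 Re (U' * cnj U)\<close>. The
      multiplier is squared so that \<open>|\<psi> U'|^2\<close> appears, and \<epsilon> drops out
      because \<open>\<i> \<epsilon> |U|^2\<close> is purely imaginary.\<close>
    define r where "r x = h\<^sup>2 * (cmod (\<psi> x * U' x))\<^sup>2 - E * (cmod (\<psi> x * U x))\<^sup>2 - Re ((\<psi> x * F x) * cnj (\<psi> x * U x)) +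
      2 * h\<^sup>2 * c * Re ((\<psi> x * (w x * U' x)) * cnj (w x * U x))" for x
    define X where "X x = h\<^sup>2 * (cmod (\<psi> x * U' x))\<^sup>2" for x
    define Y where "Y x = E * (cmod (U x))\<^sup>2 + cmod (w x * U x) * cmod (G x) +
      2 * h\<^sup>2 * c * (cmod (w x * U x) * cmod (w x * U' x))" for x
    have Xi: "integrable lebesgue X"
      unfolding X_def by (intro integrable_mult_right square_integrable_norm_power2 sq\<psi> sq)
    have Yi: "integrable lebesgue Y"
      unfolding Y_def by (intro integrable_mult_right Bochner_Integration.integrable_add
          square_integrable_norm_mult square_integrable_norm_power2 sqw sq)
    have ri: "integrable lebesgue r"
      unfolding r_def
      by (intro Bochner_Integration.integrable_diff Bochner_Integration.integrable_add integrable_mult_right integrable_Re square_integrable_mult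
          square_integrable_norm_power2 square_integrable_cnj sq sqF sq\<psi> sqw)
    let ?c = complex_of_real
    let ?N = "\<lambda>x. ?c (h\<^sup>2 / 2) * ((?c (\<psi> x) * ?c (\<psi> x)) * (U' x * cnj (U x) + U x * cnj (U' x)))"
    let ?n = "\<lambda>x. ?c (h\<^sup>2 / 2) *
      ((?c (c * (w x)\<^sup>2) * ?c (\<psi> x) + ?c (\<psi> x) * ?c (c * (w x)\<^sup>2)) * (U' x * cnj (U x) + U x * cnj (U' x)) +
      (?c (\<psi> x) * ?c (\<psi> x)) * ((n x * cnj (U x) + U' x * cnj (U' x)) + (U' x * cnj (U' x) + U x * cnj (n x))))"
    have "(LINT x|lebesgue. r x) = 0"
    proof (rule primitive_real_integral_zero)
      show "primitive ?N ?n"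
        by (intro primitive_mult primitive_add primitive_cmult primitive_cnj \<psi>(1) P(1) P')
      have "integrable lebesgue (\<lambda>x. ?c (h\<^sup>2 / 2) * ((\<psi> x * U' x) * cnj (\<psi> x * U x) + (\<psi> x * U x) * cnj (\<psi> x * U' x)))"
        by (intro Bochner_Integration.integrable_add integrable_mult_right square_integrable_mult square_integrable_cnj sq sq\<psi>)
      then show "integrable lebesgue ?N"
        by (simp add: algebra_simps)
      show "AE x in lebesgue. ?n x = ?c (r x)"
        using \<psi>V
      proof eventually_elim
        case (elim x)
        let ?p = "?c (\<psi> x)" and ?h = "?c (h\<^sup>2)"
        have a: "U' x * cnj (U x) + U x * cnj (U' x) = 2 * ?c (Re (U' x * cnj (U x)))"
          using complex_add_cnj[of "U' x * cnj (U x)"] by (simp add: mult.commute)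
        have "?h * (n x * cnj (U x) + U x * cnj (n x)) = (?h * n x) * cnj (U x) + U x * cnj (?h * n x)"
          by (simp add: algebra_simps)
        also have "\<dots> = 2 * ?c (V x) * (U x * cnj (U x)) - 2 * E * (U x * cnj (U x)) -
            (F x * cnj (U x) + cnj (F x * cnj (U x)))"
          unfolding hn by (simp add: z algebra_simps)
        also have "F x * cnj (U x) + cnj (F x * cnj (U x)) = 2 * ?c (Re (F x * cnj (U x)))"
          using complex_add_cnj[of "F x * cnj (U x)"] by simp
        finally have b: "?h * (n x * cnj (U x) + U x * cnj (n x)) =
            2 * ?c (V x) * (U x * cnj (U x)) - 2 * E * (U x * cnj (U x)) - 2 * ?c (Re (F x * cnj (U x)))" .
        have "?p * (?p * (?h * (n x * cnj (U x) + U x * cnj (n x)))) =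
            ?c (\<psi> x * V x) * (2 * ?p * (U x * cnj (U x))) +
            ?p * ?p * (- 2 * E * (U x * cnj (U x)) - 2 * ?c (Re (F x * cnj (U x))))"
          unfolding b by (simp add: algebra_simps)
        also have "\<dots> = ?p * ?p * (- 2 * E * (U x * cnj (U x)) - 2 * ?c (Re (F x * cnj (U x))))"
          unfolding elim by simp
        finally have d: "?p * (?p * (?h * (n x * cnj (U x) + U x * cnj (n x)))) =
          ?p * ?p * (- 2 * E * (U x * cnj (U x)) - 2 * ?c (Re (F x * cnj (U x))))" .
        have "?n x =
          ?h * ?c (c * (w x)\<^sup>2) * ?p * (U' x * cnj (U x) + U x * cnj (U' x)) +
          ?h * (?p * ?p) * (U' x * cnj (U' x)) + (?p * (?p * (?h * (n x * cnj (U x) + U x * cnj (n x))))) / 2"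
          by (simp add: field_simps)
        also have "\<dots> = ?c (r x)"
        proof -
          have e: "(cmod (?p * U' x))\<^sup>2 = (\<psi> x)\<^sup>2 * (cmod (U' x))\<^sup>2"
            "(cmod (?p * U x))\<^sup>2 = (\<psi> x)\<^sup>2 * (cmod (U x))\<^sup>2"
            by (simp_all add: norm_mult power_mult_distrib)
          show ?thesis
            unfolding a d r_def e complex_norm_square[symmetric]
            by (simp add: field_simps power2_eq_square)
        qed
        finally show ?case .
      qed
    qed (rule ri)
    moreover have "X x - Y x \<le> r x" for x
    proof -
      have p: "\<bar>\<psi> x\<bar> \<le> 1" by (rule \<psi>(2))
      have p2: "(\<psi> x)\<^sup>2 \<le> 1" using p by (simp add: abs_square_le_1)
      have "E * (cmod (\<psi> x * U x))\<^sup>2 \<le> E * (cmod (U x))\<^sup>2"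
        using p2 E by (intro mult_left_mono) (auto simp: norm_mult power_mult_distrib mult_left_le_one_le)
      moreover have "Re ((\<psi> x * F x) * cnj (\<psi> x * U x)) \<le> cmod (w x * U x) * cmod (G x)"
      proof -
        have "Re ((\<psi> x * F x) * cnj (\<psi> x * U x)) \<le> cmod ((\<psi> x * F x) * cnj (\<psi> x * U x))"
          by (rule complex_Re_le_cmod)
        also have "\<dots> = (\<psi> x)\<^sup>2 * (cmod (w x * U x) * cmod (G x))"
          using w[of x] by (simp add: norm_mult cF power2_eq_square flip: abs_mult)
        also have "\<dots> \<le> cmod (w x * U x) * cmod (G x)"
          using p2 by (intro mult_left_le_one_le) auto
        finally show ?thesis .
      qed
      moreover have "- (2 * h\<^sup>2 * c * Re ((\<psi> x * (w x * U' x)) * cnj (w x * U x))) \<le>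
          2 * h\<^sup>2 * c * (cmod (w x * U x) * cmod (w x * U' x))"
      proof -
        have "- Re ((\<psi> x * (w x * U' x)) * cnj (w x * U x)) \<le> cmod ((\<psi> x * (w x * U' x)) * cnj (w x * U x))"
          using abs_Re_le_cmod[of "(\<psi> x * (w x * U' x)) * cnj (w x * U x)"] by linarith
        also have "\<dots> = \<bar>\<psi> x\<bar> * (cmod (w x * U x) * cmod (w x * U' x))"
          by (simp add: norm_mult)
        also have "\<dots> \<le> cmod (w x * U x) * cmod (w x * U' x)"
          using p by (intro mult_left_le_one_le) auto
        finally have "2 * h\<^sup>2 * c * (- Re ((\<psi> x * (w x * U' x)) * cnj (w x * U x))) \<le>
            2 * h\<^sup>2 * c * (cmod (w x * U x) * cmod (w x * U' x))"
          using c by (intro mult_left_mono) auto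
        then show ?thesis by (simp only: mult_minus_right)
      qed
      ultimately show ?thesis
        unfolding X_def Y_def r_def by linarith
    qed
    then have "(LINT x|lebesgue. X x - Y x) \<le> (LINT x|lebesgue. r x)"
      by (intro integral_mono Bochner_Integration.integrable_diff Xi Yi ri)
    ultimately have "(LINT x|lebesgue. X x) \<le> (LINT x|lebesgue. Y x)"
      using Xi Yi by simp
    moreover have "(LINT x|lebesgue. X x) = h\<^sup>2 * ?\<kappa>\<^sup>2"
      unfolding X_def l2norm_power2 by simp
    moreover have "(LINT x|lebesgue. Y x) \<le> E * ?\<mu>\<^sup>2 + ?\<beta> * ?\<gamma> + 2 * h\<^sup>2 * c * (?\<beta> * ?\<alpha>)"
    proof -
      have "(LINT x|lebesgue. Y x) = E * ?\<mu>\<^sup>2 + (LINT x|lebesgue. cmod (w x * U x) * cmod (G x)) +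
          2 * h\<^sup>2 * c * (LINT x|lebesgue. cmod (w x * U x) * cmod (w x * U' x))"
        unfolding Y_def l2norm_power2
        using square_integrable_norm_power2[OF sq(1)] square_integrable_norm_mult[OF sqw[OF sq(1)] sq(3)]
          square_integrable_norm_mult[OF sqw[OF sq(1)] sqw[OF sq(2)]] by simp
      also have "\<dots> \<le> E * ?\<mu>\<^sup>2 + ?\<beta> * ?\<gamma> + 2 * h\<^sup>2 * c * (?\<beta> * ?\<alpha>)"
        using c by (intro add_mono mult_left_mono l2norm_Cauchy_Schwarz sq sqw order_refl) auto
      finally show ?thesis .
    qed
    ultimately show ?thesis by linarith
  qed
  show ?thesis
    using resolvent_estimate_algebra[OF E c h l2norm_nonneg l2norm_nonneg l2norm_nonneg l2norm_nonneg l2norm_nonneg 1 2 3]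
    by (simp add: w_def c_def)
qed

section \<open>Decaying solutions of the homogeneous equation\<close>

lemma primitive_exp: "primitive (\<lambda>x. exp (c * complex_of_real x)) (\<lambda>x. c * exp (c * complex_of_real x))"
proof (rule primitive_deriv)
  fix x :: real
  have "((\<lambda>w. exp (c * w)) has_field_derivative c * exp (c * complex_of_real x)) (at (complex_of_real x))"
    by (auto intro!: derivative_eq_intros)
  then show "((\<lambda>x. exp (c * complex_of_real x)) has_vector_derivative c * exp (c * complex_of_real x)) (at x)"
    by (rule has_vector_derivative_real_field)
qed (intro continuous_intros)

lemma integrable_set_integrable:
  fixes f :: "real \<Rightarrow> complex"
  shows "integrable lebesgue f \<Longrightarrow> A \<in> sets lebesgue \<Longrightarrow> f absolutely_integrable_on A"
  unfolding set_integrable_def by (rule integrable_mult_indicator)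

lemma integrable_mult_bounded:
  fixes f m :: "real \<Rightarrow> complex"
  assumes f: "integrable lebesgue f" and m: "m \<in> borel_measurable lebesgue" "\<And>x. cmod (m x) \<le> C"
  shows "integrable lebesgue (\<lambda>x. m x * f x)"
proof (rule Bochner_Integration.integrable_bound)
  have [measurable]: "f \<in> borel_measurable lebesgue" "m \<in> borel_measurable lebesgue"
    using f m by auto
  show "(\<lambda>x. m x * f x) \<in> borel_measurable lebesgue" by measurable
  show "integrable lebesgue (\<lambda>x. C *\<^sub>R f x)" using f by (rule integrable_scaleR_right)
  have "norm (m x * f x) \<le> norm (C *\<^sub>R f x)" for x
    using mult_right_mono[OF m(2), of "cmod (f x)" x] mult_right_mono[OF abs_ge_self, of "cmod (f x)" C]
    by (simp add: norm_mult)
  then show "AE x in lebesgue. norm (m x * f x) \<le> norm (C *\<^sub>R f x)" by simp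
qed

lemma set_integrable_tail_mult:
  fixes f m :: "real \<Rightarrow> complex"
  assumes f: "integrable lebesgue f" and m: "m \<in> borel_measurable lebesgue" "\<And>x. a \<le> x \<Longrightarrow> cmod (m x) \<le> C"
  shows "(\<lambda>x. m x * f x) absolutely_integrable_on {a..}"
proof -
  have "integrable lebesgue (\<lambda>x. (indicat_real {a..} x *\<^sub>R m x) * f x)"
  proof (rule integrable_mult_bounded[OF f])
    show "(\<lambda>x. indicat_real {a..} x *\<^sub>R m x) \<in> borel_measurable lebesgue"
      by (intro borel_measurable_scaleR borel_measurable_indicator m(1)) simp
    show "cmod (indicat_real {a..} x *\<^sub>R m x) \<le> max C 0" for x
      using m(2)[of x] by (auto simp: indicator_def)
  qed
  then show ?thesis by (simp add: set_integrable_def)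
qed

lemma set_integral_norm_le:
  fixes f :: "real \<Rightarrow> complex" and g :: "real \<Rightarrow> real"
  assumes f: "f absolutely_integrable_on A" and g: "set_integrable lebesgue A g"
    and le: "\<And>x. x \<in> A \<Longrightarrow> cmod (f x) \<le> g x"
  shows "cmod (LINT x:A|lebesgue. f x) \<le> (LINT x:A|lebesgue. g x)"
proof -
  have "cmod (LINT x:A|lebesgue. f x) \<le> (LINT x|lebesgue. cmod (indicat_real A x *\<^sub>R f x))"
    unfolding set_lebesgue_integral_def by (rule integral_norm_bound)
  also have "\<dots> \<le> (LINT x|lebesgue. indicat_real A x *\<^sub>R g x)"
    using f g le unfolding set_integrable_def
    by (intro integral_mono integrable_norm) (auto simp: indicator_def)
  finally show ?thesis by (simp add: set_lebesgue_integral_def)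
qed

text \<open>With \<open>y x = exp (- \<mu> * x) * m x\<close>, the equation \<open>y'' = (p + \<mu>\<^sup>2) * y\<close> becomes
  \<open>m'' - 2 * \<mu> * m' = p * m\<close>. With the boundary condition \<open>m x \<longlongrightarrow> 1\<close> at \<open>\<infinity>\<close> this is the
  Volterra equation \<open>m = 1 + jost_op \<mu> (p * m)\<close>.\<close>

definition jost_kernel :: "complex \<Rightarrow> real \<Rightarrow> complex" where
  "jost_kernel \<mu> t = (1 - exp (- 2 * \<mu> * complex_of_real t)) / (2 * \<mu>)"

definition jost_op :: "complex \<Rightarrow> (real \<Rightarrow> complex) \<Rightarrow> real \<Rightarrow> complex" where
  "jost_op \<mu> q x = (LINT s:{x..}|lebesgue. jost_kernel \<mu> (s - x) * q s)"

text \<open>The variable in which the Volterra iteration is measured: for integrable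
  \<open>q\<close> it tends to 0 at \<infinity> and has density \<open>- cmod (q x)\<close>,
  whatever the pointwise behaviour of \<open>q\<close>.\<close>

definition tail_norm :: "(real \<Rightarrow> complex) \<Rightarrow> real \<Rightarrow> real" where
  "tail_norm q x = (LINT s:{x..}|lebesgue. cmod (q s))"

lemma tail_norm_integrable:
  fixes q :: "real \<Rightarrow> complex"
  shows "integrable lebesgue q \<Longrightarrow> set_integrable lebesgue {x..} (\<lambda>s. cmod (q s))"
  unfolding set_integrable_def by (intro integrable_mult_indicator) auto

lemma tail_norm_nonneg: "0 \<le> tail_norm q x"
  unfolding tail_norm_def set_lebesgue_integral_def by simp

lemma tail_norm_le: "integrable lebesgue q \<Longrightarrow> tail_norm q x \<le> (LINT s|lebesgue. cmod (q s))"
  unfolding tail_norm_def set_lebesgue_integral_def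
  by (intro integral_mono integrable_mult_indicator) (auto simp: indicator_def)

text \<open>The derivative of \<open>jost_op\<close>: in \<open>x\<close> the kernel differentiates
  to \<open>- exp (- 2 \<mu> (s - x))\<close>, and no boundary term arises because
  \<open>jost_kernel \<mu> 0 = 0\<close>.\<close>

definition jost_op_deriv :: "complex \<Rightarrow> (real \<Rightarrow> complex) \<Rightarrow> real \<Rightarrow> complex" where
  "jost_op_deriv \<mu> q x = - (LINT s:{x..}|lebesgue. exp (- 2 * \<mu> * complex_of_real (s - x)) * q s)"

lemma norm_exp_le_one:
  assumes "0 \<le> Re \<mu>" "0 \<le> t"
  shows "cmod (exp (- 2 * \<mu> * complex_of_real t)) \<le> 1"
  using assms by (simp add: norm_exp_eq_Re)

lemma norm_jost_kernel_le:
  assumes "0 < Re \<mu>" "0 \<le> t"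
  shows "cmod (jost_kernel \<mu> t) \<le> 1 / cmod \<mu>"
proof -
  have "cmod (1 - exp (- 2 * \<mu> * complex_of_real t)) \<le> cmod 1 + cmod (exp (- 2 * \<mu> * complex_of_real t))"
    by (rule norm_triangle_ineq4)
  also have "\<dots> \<le> 2"
    using norm_exp_le_one[of \<mu> t] assms by simp
  finally have "cmod (1 - exp (- 2 * \<mu> * complex_of_real t)) / (2 * cmod \<mu>) \<le> 2 / (2 * cmod \<mu>)"
    by (intro divide_right_mono) auto
  then show ?thesis by (simp add: jost_kernel_def norm_divide norm_mult)
qed

lemma exp_affine_measurable: "(\<lambda>s. exp (c * complex_of_real (s - x))) \<in> borel_measurable lebesgue"
  by (intro continuous_on_lebesgue_measurable continuous_intros)

lemma jost_kernel_measurable: "(\<lambda>s. jost_kernel \<mu> (s - x)) \<in> borel_measurable lebesgue"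
  unfolding jost_kernel_def by (cases "\<mu> = 0") (auto intro!: continuous_on_lebesgue_measurable continuous_intros)

context
  fixes \<mu> :: complex and q :: "real \<Rightarrow> complex"
  assumes \<mu>: "0 < Re \<mu>" and q: "integrable lebesgue q"
begin

lemma jost_op_deriv_integrable:
  "(\<lambda>s. exp (- 2 * \<mu> * complex_of_real (s - x)) * q s) absolutely_integrable_on {x..}"
  by (rule set_integrable_tail_mult[OF q exp_affine_measurable, of _ _ _ 1])
     (use \<mu> norm_exp_le_one in auto)

lemma jost_op_integrable:
  "(\<lambda>s. jost_kernel \<mu> (s - x) * q s) absolutely_integrable_on {x..}"
  by (rule set_integrable_tail_mult[OF q jost_kernel_measurable norm_jost_kernel_le[OF \<mu>]]) simp

text \<open>The exponential separates into a factor in \<open>x\<close> and one in \<open>s\<close>,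
  so the integral is an exponential times a tail integral; the product rule takes the place of
  differentiation under the integral sign.\<close>

lemma primitive_jost_op_deriv:
  "primitive (jost_op_deriv \<mu> q) (\<lambda>x. 2 * \<mu> * jost_op_deriv \<mu> q x + q x)"
proof -
  let ?e = "\<lambda>s. exp (- 2 * \<mu> * complex_of_real s)"
  have split: "exp (- 2 * \<mu> * complex_of_real (s - x)) = exp (2 * \<mu> * complex_of_real x) * ?e s" for s x
    by (simp add: exp_add[symmetric] algebra_simps)
  have i: "(\<lambda>s. ?e s * q s) absolutely_integrable_on {a..}" for a
  proof -
    have "(\<lambda>s. exp (- (2 * \<mu> * complex_of_real a)) * (exp (- 2 * \<mu> * complex_of_real (s - a)) * q s)) absolutely_integrable_on {a..}"
      by (intro set_integrable_mult_right jost_op_deriv_integrable)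
    then show ?thesis unfolding split by (simp add: exp_minus field_simps)
  qed
  have n: "jost_op_deriv \<mu> q x = exp (2 * \<mu> * complex_of_real x) * - (LINT s:{x..}|lebesgue. ?e s * q s)" for x
    unfolding jost_op_deriv_def split by (simp add: mult.assoc)
  have "primitive (\<lambda>x. exp (2 * \<mu> * complex_of_real x) * - (LINT s:{x..}|lebesgue. ?e s * q s))
      (\<lambda>x. 2 * \<mu> * exp (2 * \<mu> * complex_of_real x) * - (LINT s:{x..}|lebesgue. ?e s * q s) +
        exp (2 * \<mu> * complex_of_real x) * (?e x * q x))"
    by (intro primitive_mult primitive_exp primitive_tail(1) i)
  moreover have "2 * \<mu> * exp (2 * \<mu> * complex_of_real x) * - (LINT s:{x..}|lebesgue. ?e s * q s) +
        exp (2 * \<mu> * complex_of_real x) * (?e x * q x) = 2 * \<mu> * jost_op_deriv \<mu> q x + q x" for x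
    unfolding n by (simp add: exp_minus)
  ultimately show ?thesis
    unfolding n[symmetric] by simp
qed

text \<open>Splitting the kernel into its constant and its exponential part writes
  \<open>jost_op\<close> as a combination of the tail integral of \<open>q\<close> and
  \<open>jost_op_deriv\<close>; in the derivative the two occurrences of \<open>q\<close>
  cancel.\<close>

lemma primitive_jost_op: "primitive (jost_op \<mu> q) (jost_op_deriv \<mu> q)"
proof -
  have l0: "\<mu> \<noteq> 0" using \<mu> by auto
  have qi: "q absolutely_integrable_on {a..}" for a
    by (rule integrable_set_integrable[OF q]) simp
  have eq: "jost_op \<mu> q x = 1 / (2 * \<mu>) * (jost_op_deriv \<mu> q x - - (LINT s:{x..}|lebesgue. q s))" for x
  proof -
    have "jost_op \<mu> q x = (LINT s:{x..}|lebesgue. 1 / (2 * \<mu>) * (q s - exp (- 2 * \<mu> * complex_of_real (s - x)) * q s))"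
      unfolding jost_op_def jost_kernel_def using l0 by (simp add: field_simps)
    also have "\<dots> = 1 / (2 * \<mu>) * (LINT s:{x..}|lebesgue. q s - exp (- 2 * \<mu> * complex_of_real (s - x)) * q s)"
      by (rule set_integral_mult_right)
    also have "(LINT s:{x..}|lebesgue. q s - exp (- 2 * \<mu> * complex_of_real (s - x)) * q s) =
        (LINT s:{x..}|lebesgue. q s) + jost_op_deriv \<mu> q x"
      unfolding jost_op_deriv_def by (subst set_integral_diff(2)[OF qi jost_op_deriv_integrable]) simp
    finally show ?thesis by simp
  qed
  have "primitive (\<lambda>x. 1 / (2 * \<mu>) * (jost_op_deriv \<mu> q x - - (LINT s:{x..}|lebesgue. q s)))
      (\<lambda>x. 1 / (2 * \<mu>) * ((2 * \<mu> * jost_op_deriv \<mu> q x + q x) - q x))"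
    by (intro primitive_cmult primitive_diff primitive_jost_op_deriv primitive_tail(1) qi)
  then show ?thesis
    using l0 unfolding eq[symmetric] by simp
qed

lemma norm_jost_op_le:
  "cmod (jost_op \<mu> q x) \<le> tail_norm q x / cmod \<mu>"
proof -
  have "cmod (jost_op \<mu> q x) \<le> (LINT s:{x..}|lebesgue. 1 / cmod \<mu> * cmod (q s))"
    unfolding jost_op_def
  proof (rule set_integral_norm_le[OF jost_op_integrable])
    show "set_integrable lebesgue {x..} (\<lambda>s. 1 / cmod \<mu> * cmod (q s))"
      by (intro set_integrable_mult_right tail_norm_integrable q)
    show "cmod (jost_kernel \<mu> (s - x) * q s) \<le> 1 / cmod \<mu> * cmod (q s)" if "s \<in> {x..}" for s
      unfolding norm_mult using that by (intro mult_right_mono norm_jost_kernel_le \<mu>) auto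
  qed
  also have "\<dots> = 1 / cmod \<mu> * (LINT s:{x..}|lebesgue. cmod (q s))"
    by (rule set_integral_mult_right)
  finally show ?thesis by (simp add: tail_norm_def)
qed

lemma norm_jost_op_deriv_le:
  "cmod (jost_op_deriv \<mu> q x) \<le> (LINT s|lebesgue. cmod (q s))"
proof -
  have "cmod (jost_op_deriv \<mu> q x) \<le> tail_norm q x"
    unfolding jost_op_deriv_def norm_minus_cancel tail_norm_def
  proof (rule set_integral_norm_le[OF jost_op_deriv_integrable tail_norm_integrable[OF q]])
    show "cmod (exp (- 2 * \<mu> * complex_of_real (s - x)) * q s) \<le> cmod (q s)" if "s \<in> {x..}" for s
      unfolding norm_mult using that norm_exp_le_one[of \<mu> "s - x"] \<mu>
      by (intro mult_left_le_one_le) auto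
  qed
  also have "\<dots> \<le> (LINT s|lebesgue. cmod (q s))"
    by (rule tail_norm_le[OF q])
  finally show ?thesis .
qed

end

section \<open>Solving the Volterra equation\<close>

lemma tail_norm_tendsto_zero:
  assumes q: "integrable lebesgue q"
  shows "(tail_norm q \<longlongrightarrow> 0) at_top"
    and "primitive (\<lambda>x. - complex_of_real (tail_norm q x)) (\<lambda>x. complex_of_real (cmod (q x)))"
proof -
  have eq: "(LINT s:{x..}|lebesgue. complex_of_real (cmod (q s))) = complex_of_real (tail_norm q x)" for x
    unfolding tail_norm_def by (rule set_integral_complex_of_real)
  have i: "(\<lambda>s. complex_of_real (cmod (q s))) absolutely_integrable_on {a..}" for a
    by (rule integrable_set_integrable) (use q in auto)
  have "((\<lambda>x. complex_of_real (tail_norm q x)) \<longlongrightarrow> 0) at_top"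
    using primitive_tail(2)[OF i] unfolding eq .
  from tendsto_Re[OF this] show "(tail_norm q \<longlongrightarrow> 0) at_top"
    by simp
  show "primitive (\<lambda>x. - complex_of_real (tail_norm q x)) (\<lambda>x. complex_of_real (cmod (q x)))"
    using primitive_tail(1)[OF i] unfolding eq .
qed

text \<open>Iterating this identity produces the factorials that make the Neumann series of the Volterra
  equation converge for every integrable potential.\<close>

lemma tail_power_integral:
  assumes p: "integrable lebesgue p"
  defines "P \<equiv> tail_norm p"
  shows "set_integrable lebesgue {x..} (\<lambda>s. cmod (p s) * P s ^ n)"
    and "(LINT s:{x..}|lebesgue. cmod (p s) * P s ^ n) = P x ^ Suc n / real (Suc n)"
proof -
  let ?c = complex_of_real
  have P0: "primitive (\<lambda>x. ?c (P x)) (\<lambda>x. - ?c (cmod (p x)))"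
    using primitive_uminus[OF tail_norm_tendsto_zero(2)[OF p]] by (simp add: P_def)
  \<comment> \<open>The power rule for an absolutely continuous function. At \<open>n = 0\<close>
    the exponent \<open>n - 1\<close> truncates to 0, harmlessly because of the factor
    \<open>of_nat n\<close>.\<close>
  have prim: "primitive (\<lambda>x. ?c (P x) ^ n) (\<lambda>x. - of_nat n * ?c (cmod (p x)) * ?c (P x) ^ (n - 1))" for n
  proof (induction n)
    case 0
    show ?case using primitive_const[of 1] by simp
  next
    case (Suc n)
    have "primitive (\<lambda>x. ?c (P x) * ?c (P x) ^ n)
      (\<lambda>x. - ?c (cmod (p x)) * ?c (P x) ^ n + ?c (P x) * (- of_nat n * ?c (cmod (p x)) * ?c (P x) ^ (n - 1)))"
      by (intro primitive_mult P0 Suc)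
    moreover have "- ?c (cmod (p x)) * ?c (P x) ^ n + ?c (P x) * (- of_nat n * ?c (cmod (p x)) * ?c (P x) ^ (n - 1)) =
        - of_nat (Suc n) * ?c (cmod (p x)) * ?c (P x) ^ (Suc n - 1)" for x
      by (cases n) (auto simp: algebra_simps)
    ultimately show ?case by simp
  qed
  have "integrable lebesgue (\<lambda>s. ?c (P s) ^ n * ?c (cmod (p s)))"
  proof (rule integrable_mult_bounded)
    show "(\<lambda>s. ?c (P s) ^ n) \<in> borel_measurable lebesgue"
      by (rule primitive_measurable[OF prim])
    show "cmod (?c (P s) ^ n) \<le> (LINT s|lebesgue. cmod (p s)) ^ n" for s
      by (simp add: P_def norm_power power_mono tail_norm_nonneg tail_norm_le p)
  qed (use p in simp)
  then have "integrable lebesgue (\<lambda>s. ?c (cmod (p s) * P s ^ n))"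
    by (simp add: mult.commute)
  then have int: "integrable lebesgue (\<lambda>s. cmod (p s) * P s ^ n)"
    by (simp only: complex_of_real_integrable_eq)
  then show si: "set_integrable lebesgue {x..} (\<lambda>s. cmod (p s) * P s ^ n)" for x
    unfolding set_integrable_def by (intro integrable_mult_indicator) auto
  have ci: "(\<lambda>s. ?c (cmod (p s) * P s ^ n)) absolutely_integrable_on {x..}" for x
    by (rule integrable_set_integrable) (use int in \<open>simp_all only: complex_of_real_integrable_eq, simp\<close>)
  have "((\<lambda>b. LINT s:{x..b}|lebesgue. ?c (cmod (p s) * P s ^ n)) \<longlongrightarrow> (LINT s:{x..}|lebesgue. ?c (cmod (p s) * P s ^ n))) at_top"
    by (rule set_integrable_at_top_limit[OF ci])
  moreover have "((\<lambda>b. LINT s:{x..b}|lebesgue. ?c (cmod (p s) * P s ^ n)) \<longlongrightarrow> ?c (P x ^ Suc n / real (Suc n))) at_top"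
  proof (rule Lim_transform_eventually)
    have "((\<lambda>b. ?c ((P x ^ Suc n - P b ^ Suc n) / real (Suc n))) \<longlongrightarrow> ?c ((P x ^ Suc n - 0 ^ Suc n) / real (Suc n))) at_top"
      using tail_norm_tendsto_zero(1)[OF p] unfolding P_def by (intro tendsto_intros) auto
    then show "((\<lambda>b. ?c ((P x ^ Suc n - P b ^ Suc n) / real (Suc n))) \<longlongrightarrow> ?c (P x ^ Suc n / real (Suc n))) at_top"
      by simp
    show "\<forall>\<^sub>F b in at_top. ?c ((P x ^ Suc n - P b ^ Suc n) / real (Suc n)) = (LINT s:{x..b}|lebesgue. ?c (cmod (p s) * P s ^ n))"
      using eventually_ge_at_top[of x]
    proof eventually_elim
      case (elim b)
      have "primitive (\<lambda>x. (- 1 / of_nat (Suc n)) * ?c (P x) ^ Suc n)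
          (\<lambda>x. (- 1 / of_nat (Suc n)) * (- of_nat (Suc n) * ?c (cmod (p x)) * ?c (P x) ^ (Suc n - 1)))"
        by (intro primitive_cmult prim)
      moreover have "(- 1 / of_nat (Suc n)) * (- of_nat (Suc n) * ?c (cmod (p x)) * ?c (P x) ^ (Suc n - 1)) =
          ?c (cmod (p x) * P x ^ n)" for x
        by (simp del: of_nat_Suc)
      ultimately have "primitive (\<lambda>x. (- 1 / of_nat (Suc n)) * ?c (P x) ^ Suc n) (\<lambda>x. ?c (cmod (p x) * P x ^ n))"
        by simp
      from primitive_integral[OF this elim] show ?case
        by (simp add: diff_divide_distrib del: of_nat_Suc power_Suc)
    qed
  qed
  ultimately have "(LINT s:{x..}|lebesgue. ?c (cmod (p s) * P s ^ n)) = ?c (P x ^ Suc n / real (Suc n))"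
    using tendsto_unique trivial_limit_at_top_linorder by blast
  then have "?c (LINT s:{x..}|lebesgue. cmod (p s) * P s ^ n) = ?c (P x ^ Suc n / real (Suc n))"
    by (simp only: set_integral_complex_of_real)
  then show "(LINT s:{x..}|lebesgue. cmod (p s) * P s ^ n) = P x ^ Suc n / real (Suc n)"
    by (simp only: of_real_eq_iff)
qed

fun jost_iterate :: "complex \<Rightarrow> (real \<Rightarrow> complex) \<Rightarrow> nat \<Rightarrow> real \<Rightarrow> complex" where
  "jost_iterate \<mu> p 0 = (\<lambda>_. 1)"
| "jost_iterate \<mu> p (Suc n) = jost_op \<mu> (\<lambda>s. p s * jost_iterate \<mu> p n s)"

text \<open>The bound has to keep the tail norm at \<open>x\<close> instead of the full norm of
  \<open>p\<close>: integrating \<open>cmod (p s)\<close> against the \<open>n\<close>-th power of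
  the tail norm gains \<open>1 / (n + 1)\<close>, which is how the factorial builds up.\<close>

lemma jost_iterate_bound:
  assumes \<mu>: "0 < Re \<mu>" and p: "integrable lebesgue p"
  shows "jost_iterate \<mu> p n \<in> borel_measurable lebesgue \<and>
    (\<forall>x. cmod (jost_iterate \<mu> p n x) \<le> (tail_norm p x / cmod \<mu>) ^ n / fact n)"
proof (induction n)
  case (Suc n)
  let ?P = "tail_norm p" and ?m = "jost_iterate \<mu> p n"
  have q: "integrable lebesgue (\<lambda>s. p s * ?m s)"
  proof -
    have "integrable lebesgue (\<lambda>s. ?m s * p s)"
    proof (rule integrable_mult_bounded[OF p])
      show "cmod (?m x) \<le> ((LINT s|lebesgue. cmod (p s)) / cmod \<mu>) ^ n / fact n" for x
      proof -
        have "(?P x / cmod \<mu>) ^ n / fact n \<le> ((LINT s|lebesgue. cmod (p s)) / cmod \<mu>) ^ n / fact n"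
          by (intro divide_right_mono power_mono tail_norm_le p) (auto simp: tail_norm_nonneg)
        with Suc show ?thesis using order_trans by blast
      qed
    qed (use Suc in blast)
    then show ?thesis by (simp add: mult.commute)
  qed
  have "jost_iterate \<mu> p (Suc n) \<in> borel_measurable lebesgue"
    using primitive_measurable[OF primitive_jost_op[OF \<mu> q]] by simp
  moreover have "cmod (jost_iterate \<mu> p (Suc n) x) \<le> (?P x / cmod \<mu>) ^ Suc n / fact (Suc n)" for x
  proof -
    have "cmod (jost_iterate \<mu> p (Suc n) x) \<le> (LINT s:{x..}|lebesgue. cmod (p s * ?m s)) / cmod \<mu>"
      using norm_jost_op_le[OF \<mu> q] by (simp add: tail_norm_def)
    also have "(LINT s:{x..}|lebesgue. cmod (p s * ?m s)) \<le>
        (LINT s:{x..}|lebesgue. 1 / (cmod \<mu> ^ n * fact n) * (cmod (p s) * ?P s ^ n))"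
    proof (rule set_integral_mono)
      show "set_integrable lebesgue {x..} (\<lambda>s. cmod (p s * ?m s))"
        by (rule tail_norm_integrable[OF q])
      show "set_integrable lebesgue {x..} (\<lambda>s. 1 / (cmod \<mu> ^ n * fact n) * (cmod (p s) * ?P s ^ n))"
        by (intro set_integrable_mult_right tail_power_integral(1)[OF p])
      show "cmod (p s * ?m s) \<le> 1 / (cmod \<mu> ^ n * fact n) * (cmod (p s) * ?P s ^ n)" for s
        using mult_left_mono[of "cmod (?m s)" "(?P s / cmod \<mu>) ^ n / fact n" "cmod (p s)"] Suc
        by (simp add: norm_mult power_divide field_simps)
    qed
    also have "\<dots> = 1 / (cmod \<mu> ^ n * fact n) * (LINT s:{x..}|lebesgue. cmod (p s) * ?P s ^ n)"
      by (rule set_integral_mult_right)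
    also have "\<dots> = 1 / (cmod \<mu> ^ n * fact n) * (?P x ^ Suc n / real (Suc n))"
      by (simp only: tail_power_integral(2)[OF p])
    also have "\<dots> / cmod \<mu> = (?P x / cmod \<mu>) ^ Suc n / fact (Suc n)"
      by (simp add: power_divide field_simps)
    finally show ?thesis by (simp add: divide_right_mono)
  qed
  ultimately show ?case by blast
qed simp

text \<open>The solution is the sum of all iterates. An exponential series majorises it uniformly in
  \<open>x\<close>, for \<open>p\<close> of any size, and also justifies exchanging sum and
  integral; shifting the series by one term is the fixed-point equation.\<close>

lemma jost_function:
  assumes \<mu>: "0 < Re \<mu>" and p: "integrable lebesgue p"
  obtains m C where "m \<in> borel_measurable lebesgue" "\<And>x. cmod (m x) \<le> C"
    "\<And>x. m x = 1 + jost_op \<mu> (\<lambda>s. p s * m s) x"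
proof -
  define c where "c = (LINT s|lebesgue. cmod (p s)) / cmod \<mu>"
  let ?m = "jost_iterate \<mu> p" and ?M = "\<lambda>n. c ^ n / fact n"
  have M: "cmod (?m n x) \<le> ?M n" for n x
  proof -
    have "cmod (?m n x) \<le> (tail_norm p x / cmod \<mu>) ^ n / fact n"
      using jost_iterate_bound[OF \<mu> p] by blast
    also have "\<dots> \<le> ?M n"
      unfolding c_def by (intro divide_right_mono power_mono tail_norm_le p) (auto simp: tail_norm_nonneg)
    finally show ?thesis .
  qed
  have sM: "summable ?M"
    using summable_exp[of c] by (simp add: divide_inverse mult.commute)
  have sm: "summable (\<lambda>n. cmod (?m n x))" for x
    by (rule summable_comparison_test'[OF sM, of 0]) (use M in simp)
  define m where "m x = (\<Sum>n. ?m n x)" for x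
  have m_sums: "(\<lambda>n. ?m n x) sums m x" for x
    unfolding m_def by (rule summable_sums[OF summable_norm_cancel[OF sm]])
  have meas: "?m n \<in> borel_measurable lebesgue" for n
    using jost_iterate_bound[OF \<mu> p] by blast
  have m_meas: "m \<in> borel_measurable lebesgue"
  proof (rule borel_measurable_LIMSEQ_metric)
    show "(\<lambda>x. \<Sum>n<k. ?m n x) \<in> borel_measurable lebesgue" for k
      using meas by (intro borel_measurable_sum) auto
    show "(\<lambda>k. \<Sum>n<k. ?m n x) \<longlonglongrightarrow> m x" for x
      using m_sums[of x] by (simp add: sums_def)
  qed
  have m_bound: "cmod (m x) \<le> (\<Sum>n. ?M n)" for x
    unfolding m_def using suminf_le[OF M sm sM] summable_norm[OF sm] by (rule order_trans[rotated])
  have qn: "integrable lebesgue (\<lambda>s. p s * ?m n s)" for n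
    using integrable_mult_bounded[OF p meas M] by (simp add: mult.commute)
  have "m x = 1 + jost_op \<mu> (\<lambda>s. p s * m s) x" for x
  proof -
    define f where "f n s = indicat_real {x..} s *\<^sub>R (jost_kernel \<mu> (s - x) * (p s * ?m n s))" for n s
    have f_le: "cmod (f n s) \<le> 1 / cmod \<mu> * cmod (p s) * ?M n" for n s
    proof (cases "x \<le> s")
      case True
      have "cmod (f n s) = cmod (jost_kernel \<mu> (s - x)) * (cmod (p s) * cmod (?m n s))"
        using True by (simp add: f_def norm_mult)
      also have "\<dots> \<le> 1 / cmod \<mu> * (cmod (p s) * ?M n)"
        using True by (intro mult_mono norm_jost_kernel_le \<mu> M order_refl) auto
      finally show ?thesis by (simp only: mult.assoc)
    next
      case False
      have "0 \<le> c" unfolding c_def by simp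
      with False show ?thesis by (simp add: f_def)
    qed
    have fi: "integrable lebesgue (f n)" for n
      using jost_op_integrable[OF \<mu> qn] unfolding f_def set_integrable_def .
    have s1: "AE s in lebesgue. summable (\<lambda>n. norm (f n s))"
    proof (rule AE_I2)
      fix s
      show "summable (\<lambda>n. norm (f n s))"
        by (rule summable_comparison_test'[OF summable_mult[OF sM, of "1 / cmod \<mu> * cmod (p s)"], of 0])
           (simp only: real_norm_def abs_norm_cancel f_le)
    qed
    have s2: "summable (\<lambda>n. LINT s|lebesgue. norm (f n s))"
    proof (rule summable_comparison_test'[OF summable_mult[OF sM, of "1 / cmod \<mu> * (LINT s|lebesgue. cmod (p s))"], of 0])
      fix n :: nat
      have "(LINT s|lebesgue. norm (f n s)) \<le> (LINT s|lebesgue. 1 / cmod \<mu> * cmod (p s) * ?M n)"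
        by (rule integral_mono[OF integrable_norm[OF fi] _ f_le]) (use p in simp)
      also have "\<dots> = (1 / cmod \<mu> * (LINT s|lebesgue. cmod (p s))) * ?M n"
        by (subst integral_mult_left_zero, subst integral_mult_right_zero) simp
      finally show "norm (LINT s|lebesgue. norm (f n s)) \<le> (1 / cmod \<mu> * (LINT s|lebesgue. cmod (p s))) * ?M n"
        by simp
    qed
    have "(LINT s|lebesgue. (\<Sum>n. f n s)) = (\<Sum>n. LINT s|lebesgue. f n s)"
      by (rule integral_suminf[OF fi s1 s2])
    moreover have "(\<Sum>n. f n s) = indicat_real {x..} s *\<^sub>R (jost_kernel \<mu> (s - x) * (p s * m s))" for s
      unfolding f_def by (rule sums_unique[symmetric]) (intro sums_scaleR_right sums_mult m_sums)
    moreover have "(LINT s|lebesgue. f n s) = ?m (Suc n) x" for n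
      by (simp add: f_def jost_op_def set_lebesgue_integral_def)
    ultimately have "jost_op \<mu> (\<lambda>s. p s * m s) x = (\<Sum>n. ?m (Suc n) x)"
      unfolding jost_op_def set_lebesgue_integral_def by simp
    moreover have "(\<Sum>n. ?m (Suc n) x) = m x - ?m 0 x"
      unfolding m_def by (rule suminf_split_head[OF summable_norm_cancel[OF sm]])
    ultimately show ?thesis by simp
  qed
  with m_meas m_bound show thesis by (rule that)
qed

text \<open>As \<open>m\<close> and its derivative are bounded on the whole line, the exponential
  bounds hold for all \<open>x\<close>, so that \<open>y\<close> also grows at most exponentially
  towards \<open>- \<infinity>\<close>; the Green's function needs both. The limit at \<infinity>
  serves to exclude the zero solution.\<close>

lemma jost_solution:
  assumes \<mu>: "0 < Re \<mu>" and p: "integrable lebesgue p"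
  obtains y y' C where "primitive y y'" "primitive y' (\<lambda>x. (p x + \<mu>\<^sup>2) * y x)"
    "\<And>x. cmod (y x) \<le> C * exp (- (Re \<mu> * x))" "\<And>x. cmod (y' x) \<le> C * exp (- (Re \<mu> * x))"
    "((\<lambda>x. exp (\<mu> * complex_of_real x) * y x) \<longlongrightarrow> 1) at_top"
proof -
  obtain m C where m: "m \<in> borel_measurable lebesgue" "\<And>x. cmod (m x) \<le> C"
    "\<And>x. m x = 1 + jost_op \<mu> (\<lambda>s. p s * m s) x"
    using jost_function[OF \<mu> p] by blast
  define q where "q s = p s * m s" for s
  define n where "n = jost_op_deriv \<mu> q"
  have q: "integrable lebesgue q"
    unfolding q_def using integrable_mult_bounded[OF p m(1,2)] by (simp add: mult.commute)
  have m_eq: "m x = 1 + jost_op \<mu> q x" for x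
    unfolding q_def by (rule m(3))
  have "primitive (\<lambda>x. 1 + jost_op \<mu> q x) (\<lambda>x. 0 + n x)"
    unfolding n_def by (intro primitive_add primitive_const primitive_jost_op \<mu> q)
  then have pm: "primitive m n"
    by (simp add: m_eq[symmetric])
  have pn: "primitive n (\<lambda>x. 2 * \<mu> * n x + q x)"
    unfolding n_def by (rule primitive_jost_op_deriv[OF \<mu> q])
  define D where "D = (LINT s|lebesgue. cmod (q s))"
  have n_bound: "cmod (n x) \<le> D" for x
    unfolding n_def D_def by (rule norm_jost_op_deriv_le[OF \<mu> q])
  let ?e = "\<lambda>x. exp (- \<mu> * complex_of_real x)"
  have norm_e: "cmod (?e x) = exp (- (Re \<mu> * x))" for x
    by (simp add: norm_exp_eq_Re)
  define y where "y x = ?e x * m x" for x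
  define y' where "y' x = ?e x * (n x - \<mu> * m x)" for x
  have "primitive y (\<lambda>x. - \<mu> * ?e x * m x + ?e x * n x)"
    unfolding y_def by (intro primitive_mult primitive_exp pm)
  then have 1: "primitive y y'"
    by (simp add: y'_def[abs_def] algebra_simps)
  have "primitive y' (\<lambda>x. - \<mu> * ?e x * (n x - \<mu> * m x) + ?e x * ((2 * \<mu> * n x + q x) - \<mu> * n x))"
    unfolding y'_def by (intro primitive_mult primitive_exp primitive_diff primitive_cmult pm pn)
  moreover have "- \<mu> * ?e x * (n x - \<mu> * m x) + ?e x * ((2 * \<mu> * n x + q x) - \<mu> * n x) = (p x + \<mu>\<^sup>2) * y x" for x
    by (simp add: y_def q_def power2_eq_square algebra_simps)
  ultimately have 2: "primitive y' (\<lambda>x. (p x + \<mu>\<^sup>2) * y x)"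
    by simp
  have C0: "0 \<le> C" using m(2)[of 0] norm_ge_zero order_trans by blast
  have D0: "0 \<le> D" using n_bound[of 0] norm_ge_zero order_trans by blast
  \<comment> \<open>One constant for both bounds: \<open>C\<close> controls \<open>m\<close>, and
    \<open>D + cmod \<mu> * C\<close> controls \<open>n - \<mu> * m\<close>.\<close>
  define B where "B = D + C + cmod \<mu> * C"
  have 3: "cmod (y x) \<le> B * exp (- (Re \<mu> * x))" for x
  proof -
    have "cmod (m x) \<le> B" using m(2)[of x] D0 C0 by (simp add: B_def add_increasing add_increasing2)
    then show ?thesis unfolding y_def norm_mult norm_e by (simp add: mult.commute)
  qed
  have 4: "cmod (y' x) \<le> B * exp (- (Re \<mu> * x))" for x
  proof -
    have "cmod (n x - \<mu> * m x) \<le> cmod (n x) + cmod \<mu> * cmod (m x)"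
      using norm_triangle_ineq4[of "n x" "\<mu> * m x"] by (simp add: norm_mult)
    also have "\<dots> \<le> D + cmod \<mu> * C"
      by (intro add_mono mult_left_mono n_bound m(2)) simp
    finally have "cmod (n x - \<mu> * m x) \<le> B" using C0 by (simp add: B_def)
    then show ?thesis unfolding y'_def norm_mult norm_e by (simp add: mult.commute)
  qed
  have "(jost_op \<mu> q \<longlongrightarrow> 0) at_top"
  proof (rule Lim_null_comparison)
    have "\<mu> \<noteq> 0" using \<mu> by auto
    then show "((\<lambda>x. tail_norm q x / cmod \<mu>) \<longlongrightarrow> 0) at_top"
      using tendsto_divide[OF tail_norm_tendsto_zero(1)[OF q] tendsto_const[of "cmod \<mu>"]] by auto
  qed (use norm_jost_op_le[OF \<mu> q] in auto)
  then have "((\<lambda>x. 1 + jost_op \<mu> q x) \<longlongrightarrow> 1 + 0) at_top"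
    by (intro tendsto_add tendsto_const)
  moreover have "exp (\<mu> * complex_of_real x) * y x = 1 + jost_op \<mu> q x" for x
    unfolding m_eq[symmetric] y_def by (simp add: exp_minus)
  ultimately have 5: "((\<lambda>x. exp (\<mu> * complex_of_real x) * y x) \<longlongrightarrow> 1) at_top"
    by simp
  show thesis by (rule that[OF 1 2 3 4 5])
qed

text \<open>The Weyl function \<open>y' / y\<close> of the decaying solution lies in the upper half-plane.\<close>

lemma jost_solution_positive:
  fixes V :: "real \<Rightarrow> real" and y y' :: "real \<Rightarrow> complex" and z :: complex
  assumes z: "Im z > 0" and h: "h > 0" and \<kappa>: "\<kappa> > 0"
    and y: "primitive y y'" "primitive y' (\<lambda>x. (V x * y x - z * y x) / complex_of_real (h\<^sup>2))"
    and bound: "\<And>x. cmod (y x) \<le> C * exp (- (\<kappa> * x))" "\<And>x. cmod (y' x) \<le> C * exp (- (\<kappa> * x))"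
    and lim: "((\<lambda>x. exp (\<mu> * complex_of_real x) * y x) \<longlongrightarrow> 1) at_top"
  shows "0 < Im (cnj (y 0) * y' 0)"
proof -
  define W where "W x = cnj (y x) * y' x - y x * cnj (y' x)" for x
  \<comment> \<open>\<open>J\<close> decreases at the rate \<open>Im z |y|^2 / h^2\<close> and tends
    to 0 at \<infinity>, hence is nonnegative; strictness comes from an interval on which
    \<open>y\<close> does not vanish identically.\<close>
  define J where "J x = Im (cnj (y x) * y' x)" for x
  define r where "r x = 2 * (Im z * (cmod (y x))\<^sup>2 / h\<^sup>2)" for x
  have W: "W x = 2 * \<i> * complex_of_real (J x)" for x
    using complex_diff_cnj[of "cnj (y x) * y' x"] unfolding W_def J_def by (simp add: mult.commute)
  have "primitive W (\<lambda>x. - 2 * \<i> * complex_of_real ((Im z * (cmod (y x))\<^sup>2 + Im (cnj (y x) * 0)) / h\<^sup>2))"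
    unfolding W_def by (rule primitive_cnj_wronskian[OF y(1)]) (use y(2) in simp)
  then have "primitive (\<lambda>x. (\<i> / 2) * W x) (\<lambda>x. (\<i> / 2) * (- 2 * \<i> * complex_of_real ((Im z * (cmod (y x))\<^sup>2 + Im (cnj (y x) * 0)) / h\<^sup>2)))"
    by (rule primitive_cmult)
  moreover have "(\<i> / 2) * W x = - complex_of_real (J x)" for x
    unfolding W by simp
  moreover have "(\<i> / 2) * (- 2 * \<i> * complex_of_real ((Im z * (cmod (y x))\<^sup>2 + Im (cnj (y x) * 0)) / h\<^sup>2)) =
      complex_of_real (Im z * (cmod (y x))\<^sup>2 / h\<^sup>2)" for x
    by simp
  ultimately have PJ: "primitive (\<lambda>x. - complex_of_real (J x)) (\<lambda>x. complex_of_real (Im z * (cmod (y x))\<^sup>2 / h\<^sup>2))"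
    by (simp only:)
  have cy: "continuous_on UNIV y" by (rule primitive_continuous[OF y(1)])
  have diff: "J a - J b = (LINT x:{a..b}|lebesgue. Im z * (cmod (y x))\<^sup>2 / h\<^sup>2)" if "a \<le> b" for a b
  proof -
    have "complex_of_real (LINT x:{a..b}|lebesgue. Im z * (cmod (y x))\<^sup>2 / h\<^sup>2) = complex_of_real (J a - J b)"
      using primitive_integral[OF PJ that] unfolding set_integral_complex_of_real by simp
    then show ?thesis by (simp only: of_real_eq_iff)
  qed
  have mono: "J b \<le> J a" if "a \<le> b" for a b
  proof -
    have "0 \<le> (LINT x:{a..b}|lebesgue. Im z * (cmod (y x))\<^sup>2 / h\<^sup>2)"
      unfolding set_lebesgue_integral_def using z by (intro integral_nonneg_AE AE_I2) simp
    with diff[OF that] show ?thesis by simp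
  qed
  have "(J \<longlongrightarrow> 0) at_top"
  proof (rule Lim_null_comparison)
    have "\<bar>J x\<bar> \<le> C\<^sup>2 * exp (- (2 * \<kappa> * x))" for x
    proof -
      have "\<bar>J x\<bar> \<le> cmod (y x) * cmod (y' x)"
        using abs_Im_le_cmod[of "cnj (y x) * y' x"] by (simp add: J_def norm_mult)
      also have "\<dots> \<le> (C * exp (- (\<kappa> * x))) * (C * exp (- (\<kappa> * x)))"
        using bound[of x] order_trans[OF norm_ge_zero bound(1)[of x]] by (intro mult_mono) auto
      also have "\<dots> = C\<^sup>2 * exp (- (2 * \<kappa> * x))"
        by (simp add: power2_eq_square exp_add[symmetric] mult_ac)
      finally show ?thesis .
    qed
    then show "\<forall>\<^sub>F x in at_top. norm (J x) \<le> C\<^sup>2 * exp (- (2 * \<kappa> * x))"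
      by simp
    have "filterlim (\<lambda>x. (2 * \<kappa>) * x) at_top at_top"
      using \<kappa> by (intro filterlim_tendsto_pos_mult_at_top[OF tendsto_const] filterlim_ident) auto
    then have "((\<lambda>x. exp (- (2 * \<kappa> * x))) \<longlongrightarrow> 0) at_top"
      by (intro filterlim_compose[OF exp_at_bot] filterlim_uminus_at_top[THEN iffD1])
    then show "((\<lambda>x. C\<^sup>2 * exp (- (2 * \<kappa> * x))) \<longlongrightarrow> 0) at_top"
      using tendsto_mult_right_zero by blast
  qed
  then have nonneg: "0 \<le> J a" for a
    by (rule tendsto_upperbound) (auto intro: eventually_mono[OF eventually_ge_at_top[of a]] mono)
  have "\<forall>\<^sub>F x in at_top. exp (\<mu> * complex_of_real x) * y x \<noteq> 0"
    by (rule tendsto_imp_eventually_ne[OF lim]) simp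
  then obtain N where N: "\<And>x. N \<le> x \<Longrightarrow> y x \<noteq> 0"
    unfolding eventually_at_top_linorder by auto
  \<comment> \<open>The strict drop of \<open>J\<close> has to be located to the right of 0 to be
    felt at 0.\<close>
  define X where "X = max 0 N"
  have X: "0 \<le> X" "y X \<noteq> 0"
    using N[of X] by (auto simp: X_def)
  have "J X - J (X + 1) \<noteq> 0"
  proof
    assume *: "J X - J (X + 1) = 0"
    have cont: "continuous_on {X..X + 1} (\<lambda>x. Im z * (cmod (y x))\<^sup>2 / h\<^sup>2)"
      using continuous_on_subset[OF cy, of "{X..X + 1}"] h by (intro continuous_intros) auto
    have "integral {X..X + 1} (\<lambda>x. Im z * (cmod (y x))\<^sup>2 / h\<^sup>2) = 0"
      unfolding set_lebesgue_integral_eq_integral(2)[OF absolutely_integrable_continuous_real[OF cont], symmetric]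
      using diff[of X "X + 1"] * by linarith
    with cont have "Im z * (cmod (y X))\<^sup>2 / h\<^sup>2 = 0"
      using integral_eq_0_iff[of X "X + 1" "\<lambda>x. Im z * (cmod (y x))\<^sup>2 / h\<^sup>2"] z by auto
    with z h X(2) show False by simp
  qed
  then have "J (X + 1) < J X" using mono[of X "X + 1"] by simp
  then have "0 < J X" using nonneg[of "X + 1"] by linarith
  with mono[OF X(1)] show ?thesis unfolding J_def by linarith
qed

section \<open>Green's function and surjectivity\<close>

lemma integrable_exp_abs:
  assumes \<kappa>: "\<kappa> > 0"
  shows "integrable lebesgue (\<lambda>s::real. exp (- (\<kappa> * \<bar>s\<bar>)))"
proof -
  let ?g = "\<lambda>s. indicat_real {0..} s * exp (- (\<kappa> * s))"
  have "set_integrable lebesgue {0..} (\<lambda>s. exp (- (\<kappa> * s)))"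
    using has_integral_exp_minus_to_infinity[OF \<kappa>, of 0]
    by (intro nonnegative_absolutely_integrable_1) (auto simp: integrable_on_def)
  then have g: "integrable lebesgue ?g" by (simp add: set_integrable_def)
  then have g': "integrable lebesgue (\<lambda>s. ?g (- s))"
    using lebesgue_integrable_real_affine[of ?g "-1" 0] by simp
  show ?thesis
  proof (rule Bochner_Integration.integrable_bound[OF Bochner_Integration.integrable_add[OF g g']])
    show "(\<lambda>s::real. exp (- (\<kappa> * \<bar>s\<bar>))) \<in> borel_measurable lebesgue"
      by (intro continuous_on_lebesgue_measurable continuous_intros)
    have "norm (exp (- (\<kappa> * \<bar>s\<bar>))) \<le> norm (?g s + ?g (- s))" for s
      by (cases "0 \<le> s"; cases "s = 0") (auto simp: indicator_def)
    then show "AE s in lebesgue. norm (exp (- (\<kappa> * \<bar>s\<bar>))) \<le> norm (?g s + ?g (- s))" by simp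
  qed
qed

abbreviation exp_dist :: "real \<Rightarrow> real \<Rightarrow> real \<Rightarrow> real" where
  "exp_dist \<kappa> x s \<equiv> exp (- (\<kappa> * \<bar>x - s\<bar>))"

lemma integrable_exp_abs_shift:
  fixes x \<kappa> :: real
  assumes \<kappa>: "\<kappa> > 0"
  shows "integrable lebesgue (\<lambda>s. exp_dist \<kappa> x s)"
    and "(LINT s|lebesgue. exp_dist \<kappa> x s) = (LINT s|lebesgue. exp (- (\<kappa> * \<bar>s\<bar>)))"
  using lebesgue_integrable_real_affine[OF integrable_exp_abs[OF \<kappa>], of "-1" x]
    lebesgue_integral_real_affine[of "-1" "\<lambda>s. exp (- (\<kappa> * \<bar>s\<bar>))" x] by simp_all

lemma square_integrable_exp_abs_shift:
  assumes \<kappa>: "\<kappa> > 0"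
  shows "square_integrable (\<lambda>s. complex_of_real (exp_dist \<kappa> x s))"
proof -
  have "(cmod (complex_of_real (exp_dist \<kappa> x s)))\<^sup>2 = exp (- ((2 * \<kappa>) * \<bar>x - s\<bar>))" for s
    by (simp add: power2_eq_square exp_add[symmetric])
  then show ?thesis
    unfolding square_integrable_def using integrable_exp_abs_shift(1)[of "2 * \<kappa>" x] \<kappa>
    by (auto intro!: continuous_on_lebesgue_measurable continuous_intros)
qed

text \<open>Up to a constant this dominates both the solution built from the two decaying solutions
  and its derivative, so that square-integrability and boundedness are established for it
  alone.\<close>

definition exp_conv :: "real \<Rightarrow> (real \<Rightarrow> complex) \<Rightarrow> real \<Rightarrow> real" where
  "exp_conv \<kappa> f x = (LINT s|lebesgue. exp_dist \<kappa> x s * cmod (f s))"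

context
  fixes \<kappa> :: real and f :: "real \<Rightarrow> complex"
  assumes \<kappa>: "\<kappa> > 0" and f: "square_integrable f"
begin

lemma exp_conv_integrable: "integrable lebesgue (\<lambda>s. exp_dist \<kappa> x s * cmod (f s))"
  using square_integrable_norm_mult[OF square_integrable_exp_abs_shift[OF \<kappa>] f, of x] by simp

lemma exp_conv_nonneg: "0 \<le> exp_conv \<kappa> f x"
  unfolding exp_conv_def by (intro integral_nonneg_AE AE_I2) simp

text \<open>Split the kernel into two factors of rate \<open>\<kappa> / 2\<close> and apply the
  Cauchy-Schwarz inequality: one factor integrates to a constant, and the other keeps
  \<open>(cmod (f s))^2\<close> under a kernel that is integrable in \<open>x\<close>.\<close>

lemma exp_conv_power2_le:
  "(exp_conv \<kappa> f x)\<^sup>2 \<le> (LINT s|lebesgue. exp (- (\<kappa> * \<bar>s\<bar>))) *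
     (LINT s|lebesgue. exp_dist \<kappa> x s * (cmod (f s))\<^sup>2)"
proof -
  let ?e = "\<lambda>s. complex_of_real (exp (- (\<kappa> / 2 * \<bar>x - s\<bar>)))"
  have e2: "(cmod (?e s))\<^sup>2 = exp_dist \<kappa> x s" for s
    by (simp add: power2_eq_square exp_add[symmetric])
  have e: "square_integrable ?e"
    by (rule square_integrable_exp_abs_shift) (use \<kappa> in simp)
  have me: "?e \<in> borel_measurable lebesgue"
    by (rule square_integrable_measurable[OF e])
  have "bounded (range ?e)"
    using \<kappa> by (auto simp: bounded_iff intro!: exI[of _ 1])
  then have ef: "square_integrable (\<lambda>s. ?e s * f s)"
    by (rule square_integrable_mult_bounded[OF f me])
  have "exp_conv \<kappa> f x = (LINT s|lebesgue. cmod (?e s) * cmod (?e s * f s))"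
    unfolding exp_conv_def norm_mult mult.assoc[symmetric] power2_eq_square[symmetric] e2 ..
  also have "\<dots> \<le> l2norm ?e * l2norm (\<lambda>s. ?e s * f s)"
    by (rule l2norm_Cauchy_Schwarz[OF e ef])
  finally have "(exp_conv \<kappa> f x)\<^sup>2 \<le> (l2norm ?e * l2norm (\<lambda>s. ?e s * f s))\<^sup>2"
    using exp_conv_nonneg by (intro power_mono)
  also have "\<dots> = (LINT s|lebesgue. exp_dist \<kappa> x s) *
      (LINT s|lebesgue. exp_dist \<kappa> x s * (cmod (f s))\<^sup>2)"
    unfolding power_mult_distrib l2norm_power2 norm_mult power_mult_distrib e2 ..
  finally show ?thesis unfolding integrable_exp_abs_shift(2)[OF \<kappa>] .
qed

text \<open>Bounding the remaining kernel by 1 makes the estimate independent of \<open>x\<close>;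
  membership in the domain of the operator asks for bounded functions.\<close>

lemma exp_conv_bounded:
  "(exp_conv \<kappa> f x)\<^sup>2 \<le> (LINT s|lebesgue. exp (- (\<kappa> * \<bar>s\<bar>))) * (l2norm f)\<^sup>2"
proof -
  have i: "integrable lebesgue (\<lambda>s. exp_dist \<kappa> x s * (cmod (f s))\<^sup>2)"
  proof (rule Bochner_Integration.integrable_bound[OF square_integrable_norm_power2[OF f]])
    have [measurable]: "(\<lambda>s. exp_dist \<kappa> x s) \<in> borel_measurable lebesgue"
      by (intro continuous_on_lebesgue_measurable continuous_intros)
    have [measurable]: "f \<in> borel_measurable lebesgue" by (rule square_integrable_measurable[OF f])
    show "(\<lambda>s. exp_dist \<kappa> x s * (cmod (f s))\<^sup>2) \<in> borel_measurable lebesgue" by measurable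
    show "AE s in lebesgue. norm (exp_dist \<kappa> x s * (cmod (f s))\<^sup>2) \<le> norm ((cmod (f s))\<^sup>2)"
      using \<kappa> by (auto intro!: mult_left_le_one_le)
  qed
  have "(LINT s|lebesgue. exp_dist \<kappa> x s * (cmod (f s))\<^sup>2) \<le> (l2norm f)\<^sup>2"
    unfolding l2norm_power2
    by (rule integral_mono[OF i square_integrable_norm_power2[OF f]])
       (use \<kappa> in \<open>auto intro!: mult_left_le_one_le\<close>)
  then have "(LINT s|lebesgue. exp (- (\<kappa> * \<bar>s\<bar>))) * (LINT s|lebesgue. exp_dist \<kappa> x s * (cmod (f s))\<^sup>2)
      \<le> (LINT s|lebesgue. exp (- (\<kappa> * \<bar>s\<bar>))) * (l2norm f)\<^sup>2"
    by (rule mult_left_mono) (intro integral_nonneg_AE AE_I2, simp)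
  with exp_conv_power2_le show ?thesis by (rule order_trans)
qed

text \<open>Integrating over \<open>x\<close> first leaves a constant times
  \<open>(cmod (f s))^2\<close>; Fubini's theorem then gives integrability in
  \<open>x\<close>.\<close>

lemma integrable_exp_conv_square:
  "integrable lebesgue (\<lambda>x. LINT s|lebesgue. exp_dist \<kappa> x s * (cmod (f s))\<^sup>2)"
proof -
  define M where "M = (lebesgue :: real measure)"
  interpret sigma_finite_measure M
    unfolding M_def by (rule sigma_finite_lebesgue)
  interpret P: pair_sigma_finite M M ..
  have [measurable]: "f \<in> borel_measurable M"
    unfolding M_def by (rule square_integrable_measurable[OF f])
  have [measurable]: "(\<lambda>x. x) \<in> measurable M borel"
    unfolding M_def by (rule borel_measurable_lebesgueI) simp
  have flip: "\<bar>x - s\<bar> = \<bar>s - x\<bar>" for x s :: real by simp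
  have "integrable (M \<Otimes>\<^sub>M M) (\<lambda>(s, x). exp_dist \<kappa> x s * (cmod (f s))\<^sup>2)"
  proof (rule P.Fubini_integrable)
    show "(\<lambda>(s, x). exp_dist \<kappa> x s * (cmod (f s))\<^sup>2) \<in> borel_measurable (M \<Otimes>\<^sub>M M)"
      by measurable
    have "(LINT x|M. norm (case (s, x) of (s, x) \<Rightarrow> exp_dist \<kappa> x s * (cmod (f s))\<^sup>2)) =
        (LINT t|lebesgue. exp (- (\<kappa> * \<bar>t\<bar>))) * (cmod (f s))\<^sup>2" for s
      using integrable_exp_abs_shift(2)[OF \<kappa>, of s] by (simp add: M_def flip[of _ s])
    then show "integrable M (\<lambda>s. LINT x|M. norm (case (s, x) of (s, x) \<Rightarrow> exp_dist \<kappa> x s * (cmod (f s))\<^sup>2))"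
      unfolding M_def by (simp only: integrable_mult_right[OF square_integrable_norm_power2[OF f]])
    show "AE s in M. integrable M (\<lambda>x. case (s, x) of (s, x) \<Rightarrow> exp_dist \<kappa> x s * (cmod (f s))\<^sup>2)"
      using integrable_exp_abs_shift(1)[OF \<kappa>] by (simp add: M_def flip)
  qed
  from P.integrable_snd[OF this] show ?thesis by (simp add: M_def)
qed

lemma square_integrable_exp_conv_bound:
  assumes U: "U \<in> borel_measurable lebesgue" "\<And>x. cmod (U x) \<le> B * exp_conv \<kappa> f x"
  shows "square_integrable U"
  unfolding square_integrable_def
proof
  have [measurable]: "U \<in> borel_measurable lebesgue" by fact
  let ?I = "LINT s|lebesgue. exp (- (\<kappa> * \<bar>s\<bar>))"
  show "integrable lebesgue (\<lambda>x. (cmod (U x))\<^sup>2)"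
  proof (rule Bochner_Integration.integrable_bound)
    show "integrable lebesgue (\<lambda>x. B\<^sup>2 * (?I * (LINT s|lebesgue. exp_dist \<kappa> x s * (cmod (f s))\<^sup>2)))"
      by (intro integrable_mult_right integrable_exp_conv_square)
    have "(cmod (U x))\<^sup>2 \<le> B\<^sup>2 * (?I * (LINT s|lebesgue. exp_dist \<kappa> x s * (cmod (f s))\<^sup>2))" for x
    proof -
      have "(cmod (U x))\<^sup>2 \<le> (B * exp_conv \<kappa> f x)\<^sup>2"
        by (intro power_mono U) simp
      also have "\<dots> \<le> B\<^sup>2 * (?I * (LINT s|lebesgue. exp_dist \<kappa> x s * (cmod (f s))\<^sup>2))"
        unfolding power_mult_distrib by (intro mult_left_mono exp_conv_power2_le) simp
      finally show ?thesis .
    qed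
    then show "AE x in lebesgue. norm ((cmod (U x))\<^sup>2) \<le>
        norm (B\<^sup>2 * (?I * (LINT s|lebesgue. exp_dist \<kappa> x s * (cmod (f s))\<^sup>2)))"
      by (auto intro!: AE_I2 order_trans[OF _ abs_ge_self])
  qed measurable
qed (rule U(1))

text \<open>For \<open>s \<ge> x\<close> one has \<open>exp (- \<kappa> s) = exp (- \<kappa> x) exp
  (- \<kappa> |x - s|)\<close>. The prefactor \<open>exp (- \<kappa> x)\<close> is later compensated
  by the growth of the other solution.\<close>

lemma decaying_tail_estimate:
  assumes y: "continuous_on UNIV y" "\<And>x. cmod (y x) \<le> C * exp (- (\<kappa> * x))"
  shows "(\<lambda>s. y s * f s) absolutely_integrable_on {a..}"
    and "cmod (LINT s:{x..}|lebesgue. y s * f s) \<le> C * exp (- (\<kappa> * x)) * exp_conv \<kappa> f x"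
proof -
  have le: "cmod (y s * f s) \<le> C * exp (- (\<kappa> * a)) * (exp_dist \<kappa> a s * cmod (f s))" if "a \<le> s" for a s
  proof -
    have "cmod (y s * f s) \<le> C * exp (- (\<kappa> * s)) * cmod (f s)"
      unfolding norm_mult by (intro mult_right_mono y) simp
    also have "exp (- (\<kappa> * s)) = exp (- (\<kappa> * a)) * exp_dist \<kappa> a s"
      using that by (simp add: exp_add[symmetric] algebra_simps)
    finally show ?thesis by (simp only: mult.assoc)
  qed
  have bi: "integrable lebesgue (\<lambda>s. C * exp (- (\<kappa> * a)) * (exp_dist \<kappa> a s * cmod (f s)))" for a
    by (intro integrable_mult_right exp_conv_integrable)
  have bsi: "set_integrable lebesgue {a..} (\<lambda>s. C * exp (- (\<kappa> * a)) * (exp_dist \<kappa> a s * cmod (f s)))" for a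
    unfolding set_integrable_def by (intro integrable_mult_indicator bi) simp
  show i: "(\<lambda>s. y s * f s) absolutely_integrable_on {a..}" for a
  proof (rule set_integrable_bound[OF bsi])
    have [measurable]: "f \<in> borel_measurable lebesgue" "y \<in> borel_measurable lebesgue"
      by (rule square_integrable_measurable[OF f], rule continuous_on_lebesgue_measurable[OF y(1)])
    have "(\<lambda>s. y s * f s) \<in> borel_measurable lebesgue" by measurable
    then show "set_borel_measurable lebesgue {a..} (\<lambda>s. y s * f s)"
      unfolding set_borel_measurable_def by (intro borel_measurable_scaleR borel_measurable_indicator) simp_all
    show "AE s in lebesgue. s \<in> {a..} \<longrightarrow> norm (y s * f s) \<le>
        norm (C * exp (- (\<kappa> * a)) * (exp_dist \<kappa> a s * cmod (f s)))"
      by (intro AE_I2 impI order_trans[OF le]) (auto simp del: abs_mult)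
  qed
  have C: "0 \<le> C * exp (- (\<kappa> * x))" for x using y(2)[of x] norm_ge_zero order_trans by blast
  have "cmod (LINT s:{x..}|lebesgue. y s * f s) \<le>
      (LINT s:{x..}|lebesgue. C * exp (- (\<kappa> * x)) * (exp_dist \<kappa> x s * cmod (f s)))"
    by (rule set_integral_norm_le[OF i bsi le]) simp
  also have "\<dots> \<le> (LINT s|lebesgue. C * exp (- (\<kappa> * x)) * (exp_dist \<kappa> x s * cmod (f s)))"
    unfolding set_lebesgue_integral_def
  proof (rule integral_mono[OF _ bi])
    show "integrable lebesgue (\<lambda>s. indicat_real {x..} s *\<^sub>R (C * exp (- (\<kappa> * x)) * (exp_dist \<kappa> x s * cmod (f s))))"
      using bsi unfolding set_integrable_def .
    show "indicat_real {x..} s *\<^sub>R (C * exp (- (\<kappa> * x)) * (exp_dist \<kappa> x s * cmod (f s))) \<le>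
        C * exp (- (\<kappa> * x)) * (exp_dist \<kappa> x s * cmod (f s))" for s
      using mult_nonneg_nonneg[OF C, of "exp_dist \<kappa> x s * cmod (f s)" x]
      by (cases "x \<le> s") auto
  qed
  also have "\<dots> = C * exp (- (\<kappa> * x)) * exp_conv \<kappa> f x"
    unfolding exp_conv_def by (rule integral_mult_right_zero)
  finally show "cmod (LINT s:{x..}|lebesgue. y s * f s) \<le> C * exp (- (\<kappa> * x)) * exp_conv \<kappa> f x" .
qed

end

section \<open>Variation of constants\<close>

lemma square_integrable_reflect:
  assumes "square_integrable f"
  shows "square_integrable (\<lambda>x. f (- x))"
proof -
  have "integrable lebesgue (\<lambda>x. (cmod (f (- x)))\<^sup>2)"
    using lebesgue_integrable_real_affine[OF square_integrable_norm_power2[OF assms], of "-1" 0] by simp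
  moreover have "(\<lambda>x. f (- x)) \<in> borel_measurable lebesgue"
    using borel_measurable_affine[of f "-1" 0] square_integrable_measurable[OF assms] by simp
  ultimately show ?thesis by (simp add: square_integrable_def)
qed

lemma exp_conv_reflect: "exp_conv \<kappa> (\<lambda>s. f (- s)) (- x) = exp_conv \<kappa> f x"
proof -
  have flip: "\<bar>- x + s\<bar> = \<bar>x - s\<bar>" for s by simp
  show ?thesis
    using lebesgue_integral_real_affine[of "-1" "\<lambda>s. exp_dist \<kappa> x s * cmod (f s)" 0]
    by (simp add: exp_conv_def flip abs_minus_commute add.commute)
qed

text \<open>Here \<open>y\<close> decays at \<infinity> and \<open>w\<close> at
  \<open>- \<infinity>\<close>. Put \<open>U = S y + T w\<close>, where \<open>S\<close> integrates
  \<open>w g\<close> from \<open>- \<infinity>\<close> up to \<open>x\<close> and \<open>T\<close>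
  integrates \<open>y g\<close> from \<open>x\<close> to \<infinity>. The derivatives of
  \<open>S\<close> and \<open>T\<close> cancel in \<open>U'\<close> and contribute \<open>f\<close>
  to \<open>U''\<close> when \<open>g\<close> is \<open>f\<close> divided by the Wronskian.\<close>

lemma green_solution:
  fixes q y y' w w' f :: "real \<Rightarrow> complex"
  assumes \<kappa>: "\<kappa> > 0"
    and y: "primitive y y'" "primitive y' (\<lambda>x. q x * y x)"
      "\<And>x. cmod (y x) \<le> C * exp (- (\<kappa> * x))" "\<And>x. cmod (y' x) \<le> C * exp (- (\<kappa> * x))"
    and w: "primitive w w'" "primitive w' (\<lambda>x. q x * w x)"
      "\<And>x. cmod (w x) \<le> C * exp (\<kappa> * x)" "\<And>x. cmod (w' x) \<le> C * exp (\<kappa> * x)"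
    and W: "y' 0 * w 0 - y 0 * w' 0 \<noteq> 0" and f: "square_integrable f"
  obtains U U' B where "primitive U U'" "primitive U' (\<lambda>x. q x * U x + f x)"
    "square_integrable U" "square_integrable U'" "\<And>x. cmod (U x) \<le> B" "\<And>x. cmod (U' x) \<le> B"
proof -
  define K where "K = y' 0 * w 0 - y 0 * w' 0"
  have K0: "K \<noteq> 0" using W by (simp add: K_def)
  have "primitive (\<lambda>x. y' x * w x - y x * w' x)
      (\<lambda>x. (q x * y x * w x + y' x * w' x) - (y' x * w' x + y x * (q x * w x)))"
    by (intro primitive_diff primitive_mult y w)
  then have "(y' x * w x - y x * w' x) - 0 = (y' 0 * w 0 - y 0 * w' 0) - 0" for x
    by (rule primitive_unique[OF _ primitive_const]) simp
  then have K: "y' x * w x - y x * w' x = K" for x by (simp add: K_def)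
  define g where "g x = f x / K" for x
  have g: "square_integrable g"
    using square_integrable_cmult[OF f, of "1 / K"] by (simp add: g_def[abs_def])
  have gr: "square_integrable (\<lambda>x. g (- x))" by (rule square_integrable_reflect[OF g])
  have cy: "continuous_on UNIV y" by (rule primitive_continuous[OF y(1)])
  have cw: "continuous_on UNIV (\<lambda>x. w (- x))"
    by (rule primitive_continuous[OF primitive_reflect[OF w(1)]])
  have wr: "cmod (w (- x)) \<le> C * exp (- (\<kappa> * x))" for x using w(3)[of "- x"] by simp
  define T where "T x = (LINT s:{x..}|lebesgue. y s * g s)" for x
  \<comment> \<open>The integral of \<open>w g\<close> over \<open>{..x}\<close>, reflected to a
    right half-line so that the tail lemmas apply.\<close>
  define S where "S x = (LINT s:{- x..}|lebesgue. w (- s) * g (- s))" for x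
  have pT: "primitive T (\<lambda>x. - (y x * g x))"
    using primitive_uminus[OF primitive_tail(1)[OF decaying_tail_estimate(1)[OF \<kappa> g cy y(3)]]]
    by (simp add: T_def[abs_def])
  have pS: "primitive S (\<lambda>x. w x * g x)"
    using primitive_uminus[OF primitive_reflect[OF primitive_tail(1)[OF decaying_tail_estimate(1)[OF \<kappa> gr cw wr]]]]
    by (simp add: S_def[abs_def])
  have bT: "cmod (T x) \<le> C * exp (- (\<kappa> * x)) * exp_conv \<kappa> g x" for x
    unfolding T_def by (rule decaying_tail_estimate(2)[OF \<kappa> g cy y(3)])
  have bS: "cmod (S x) \<le> C * exp (\<kappa> * x) * exp_conv \<kappa> g x" for x
    using decaying_tail_estimate(2)[OF \<kappa> gr cw wr, of "- x"] by (simp add: S_def exp_conv_reflect)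
  have k0: "0 \<le> exp_conv \<kappa> g x" for x by (rule exp_conv_nonneg[OF \<kappa> g])
  have sum_bound: "cmod (S x * a + T x * b) \<le> 2 * C\<^sup>2 * exp_conv \<kappa> g x"
    if "cmod a \<le> C * exp (- (\<kappa> * x))" "cmod b \<le> C * exp (\<kappa> * x)" for a b x
  proof -
    have e: "exp (\<kappa> * x) * exp (- (\<kappa> * x)) = 1" by (simp add: exp_add[symmetric])
    have "cmod (S x * a + T x * b) \<le> cmod (S x) * cmod a + cmod (T x) * cmod b"
      using norm_triangle_ineq[of "S x * a" "T x * b"] by (simp add: norm_mult)
    also have "\<dots> \<le> (C * exp (\<kappa> * x) * exp_conv \<kappa> g x) * (C * exp (- (\<kappa> * x))) +
        (C * exp (- (\<kappa> * x)) * exp_conv \<kappa> g x) * (C * exp (\<kappa> * x))"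
      using order_trans[OF norm_ge_zero bS] order_trans[OF norm_ge_zero bT]
      by (intro add_mono mult_mono bS bT that) auto
    also have "\<dots> = 2 * C\<^sup>2 * exp_conv \<kappa> g x * (exp (\<kappa> * x) * exp (- (\<kappa> * x)))"
      by (simp only: power2_eq_square) (simp only: algebra_simps)
    finally show ?thesis unfolding e by simp
  qed
  define U where "U x = S x * y x + T x * w x" for x
  define U' where "U' x = S x * y' x + T x * w' x" for x
  have "primitive U (\<lambda>x. (w x * g x * y x + S x * y' x) + (- (y x * g x) * w x + T x * w' x))"
    unfolding U_def by (intro primitive_add primitive_mult pS pT y w)
  moreover have "(w x * g x * y x + S x * y' x) + (- (y x * g x) * w x + T x * w' x) = U' x" for x
    by (simp add: U'_def algebra_simps)
  ultimately have 1: "primitive U U'" by simp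
  have "primitive U' (\<lambda>x. (w x * g x * y' x + S x * (q x * y x)) + (- (y x * g x) * w' x + T x * (q x * w x)))"
    unfolding U'_def by (intro primitive_add primitive_mult pS pT y w)
  moreover have "(w x * g x * y' x + S x * (q x * y x)) + (- (y x * g x) * w' x + T x * (q x * w x)) =
      q x * U x + f x" for x
  proof -
    have "(w x * g x * y' x + S x * (q x * y x)) + (- (y x * g x) * w' x + T x * (q x * w x)) =
        q x * U x + g x * (y' x * w x - y x * w' x)"
      by (simp add: U_def algebra_simps)
    also have "g x * (y' x * w x - y x * w' x) = f x"
      using K0 by (simp add: K g_def)
    finally show ?thesis .
  qed
  ultimately have 2: "primitive U' (\<lambda>x. q x * U x + f x)" by simp
  have bU: "cmod (U x) \<le> 2 * C\<^sup>2 * exp_conv \<kappa> g x" "cmod (U' x) \<le> 2 * C\<^sup>2 * exp_conv \<kappa> g x" for x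
    unfolding U_def U'_def using y w by (auto intro!: sum_bound)
  have 3: "square_integrable U" "square_integrable U'"
    using square_integrable_exp_conv_bound[OF \<kappa> g primitive_measurable[OF 1] bU(1)]
      square_integrable_exp_conv_bound[OF \<kappa> g primitive_measurable[OF 2] bU(2)] .
  define B where "B = 2 * C\<^sup>2 * sqrt ((LINT s|lebesgue. exp (- (\<kappa> * \<bar>s\<bar>))) * (l2norm g)\<^sup>2)"
  have "2 * C\<^sup>2 * exp_conv \<kappa> g x \<le> B" for x
    unfolding B_def by (intro mult_left_mono real_le_rsqrt exp_conv_bounded \<kappa> g) simp
  then have "cmod (U x) \<le> B" "cmod (U' x) \<le> B" for x
    using bU[of x] order_trans by blast+
  with 1 2 3 show thesis by (rule that)
qed

lemma Re_csqrt_pos: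
  assumes "Im z \<noteq> 0"
  shows "0 < Re (csqrt z)"
proof (rule ccontr)
  assume "\<not> 0 < Re (csqrt z)"
  then have "Re (csqrt z) = 0" using csqrt_principal[of z] by auto
  then have "Im ((csqrt z)\<^sup>2) = 0" by (simp add: power2_eq_square)
  with assms show False by simp
qed

text \<open>The solution decaying at \<open>- \<infinity>\<close> is the reflection of the decaying
  solution \<open>v\<close> for the potential \<open>V (- x)\<close>. The root of \<open>- z\<close>
  is taken so that \<mu> has positive real part and \<open>\<mu>^2 = - z / h^2\<close>.\<close>

lemma resolvent_equation_solvable:
  fixes V :: "real \<Rightarrow> real" and z :: complex
  assumes V: "integrable lebesgue V" and h: "h > 0" and z: "Im z > 0"
  shows "\<exists>u\<in>schroedinger_domain h V. schroedinger h V u - mult_op (\<lambda>_. z) u = f"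
proof -
  define \<mu> where "\<mu> = csqrt (- z) / complex_of_real h"
  have \<mu>2: "\<mu>\<^sup>2 = - z / complex_of_real (h\<^sup>2)"
    by (simp add: \<mu>_def power_divide)
  have \<kappa>: "0 < Re \<mu>"
    using Re_csqrt_pos[of "- z"] z h by (simp add: \<mu>_def Re_divide_of_real)
  have jost: "\<exists>(y :: real \<Rightarrow> complex) y' C. primitive y y' \<and> primitive y' (\<lambda>x. (V x * y x - z * y x) / complex_of_real (h\<^sup>2)) \<and>
      (\<forall>x. cmod (y x) \<le> C * exp (- (Re \<mu> * x))) \<and> (\<forall>x. cmod (y' x) \<le> C * exp (- (Re \<mu> * x))) \<and>
      0 < Im (cnj (y 0) * y' 0)"
    if V: "integrable lebesgue V" for V :: "real \<Rightarrow> real"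
  proof -
    have "integrable lebesgue (\<lambda>x. complex_of_real (V x / h\<^sup>2))"
      using V by simp
    then obtain y y' C where y: "primitive y y'" "primitive y' (\<lambda>x. (complex_of_real (V x / h\<^sup>2) + \<mu>\<^sup>2) * y x)"
      "\<And>x. cmod (y x) \<le> C * exp (- (Re \<mu> * x))" "\<And>x. cmod (y' x) \<le> C * exp (- (Re \<mu> * x))"
      "((\<lambda>x. exp (\<mu> * complex_of_real x) * y x) \<longlongrightarrow> 1) at_top"
      using jost_solution[OF \<kappa>] by blast
    have "(complex_of_real (V x / h\<^sup>2) + \<mu>\<^sup>2) * y x = (V x * y x - z * y x) / complex_of_real (h\<^sup>2)" for x
      unfolding \<mu>2 using h by (simp add: field_simps)
    then have y2: "primitive y' (\<lambda>x. (V x * y x - z * y x) / complex_of_real (h\<^sup>2))"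
      using y(2) by simp
    have "0 < Im (cnj (y 0) * y' 0)"
      by (rule jost_solution_positive[OF z h \<kappa> y(1) y2 y(3,4,5)])
    with y y2 show ?thesis by blast
  qed
  obtain y y' :: "real \<Rightarrow> complex" and C1 where y: "primitive y y'" "primitive y' (\<lambda>x. (V x * y x - z * y x) / complex_of_real (h\<^sup>2))"
    "\<And>x. cmod (y x) \<le> C1 * exp (- (Re \<mu> * x))" "\<And>x. cmod (y' x) \<le> C1 * exp (- (Re \<mu> * x))"
    "0 < Im (cnj (y 0) * y' 0)"
    using jost[OF V] by blast
  have "integrable lebesgue (\<lambda>x. V (- x))"
    using lebesgue_integrable_real_affine[OF V, of "-1" 0] by simp
  from jost[OF this] obtain v v' :: "real \<Rightarrow> complex" and C2 where v: "primitive v v'"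
    "primitive v' (\<lambda>x. (V (- x) * v x - z * v x) / complex_of_real (h\<^sup>2))"
    "\<And>x. cmod (v x) \<le> C2 * exp (- (Re \<mu> * x))" "\<And>x. cmod (v' x) \<le> C2 * exp (- (Re \<mu> * x))"
    "0 < Im (cnj (v 0) * v' 0)"
    by blast
  define q where "q x = (V x - z) / complex_of_real (h\<^sup>2)" for x
  define C where "C = max C1 C2"
  define F where "F x = (- 1 / complex_of_real (h\<^sup>2)) * rep_L2 f x" for x
  \<comment> \<open>The Wronskian of \<open>y\<close> and the reflected \<open>v\<close> at 0;
    reflection accounts for the plus sign. After multiplication by
    \<open>cnj (y 0) * cnj (v 0)\<close> its imaginary part is a sum of the positive quantities of
    \<open>jost_solution_positive\<close>, weighted by \<open>|v 0|^2\<close> and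
    \<open>|y 0|^2\<close>, hence positive.\<close>
  have "y' 0 * v 0 + y 0 * v' 0 \<noteq> 0"
  proof
    assume 0: "y' 0 * v 0 + y 0 * v' 0 = 0"
    have "(cnj (y 0) * y' 0) * complex_of_real ((cmod (v 0))\<^sup>2) + complex_of_real ((cmod (y 0))\<^sup>2) * (cnj (v 0) * v' 0) =
        cnj (y 0) * cnj (v 0) * (y' 0 * v 0 + y 0 * v' 0)"
      unfolding complex_norm_square by (simp add: algebra_simps)
    also have "\<dots> = 0" unfolding 0 by simp
    finally have 1: "(cnj (y 0) * y' 0) * complex_of_real ((cmod (v 0))\<^sup>2) +
        complex_of_real ((cmod (y 0))\<^sup>2) * (cnj (v 0) * v' 0) = 0" .
    have "Im (a * complex_of_real r + complex_of_real s * b) = Im a * r + s * Im b" for a b r s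
      by simp
    from this[of "cnj (y 0) * y' 0" _ _ "cnj (v 0) * v' 0", symmetric]
    have "Im (cnj (y 0) * y' 0) * (cmod (v 0))\<^sup>2 + (cmod (y 0))\<^sup>2 * Im (cnj (v 0) * v' 0) = 0"
      unfolding 1 by (simp only: 1 zero_complex.sel)
    moreover have "v 0 \<noteq> 0" using v(5) by auto
    moreover have "0 \<le> (cmod (y 0))\<^sup>2 * Im (cnj (v 0) * v' 0)" using v(5) by simp
    moreover have "0 < Im (cnj (y 0) * y' 0) * (cmod (v 0))\<^sup>2" using y(5) \<open>v 0 \<noteq> 0\<close> by simp
    ultimately show False by linarith
  qed
  then obtain U U' B where U: "primitive U U'" "primitive U' (\<lambda>x. q x * U x + F x)"
    "square_integrable U" "square_integrable U'" "\<And>x. cmod (U x) \<le> B" "\<And>x. cmod (U' x) \<le> B"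
  proof -
    assume W: "y' 0 * v 0 + y 0 * v' 0 \<noteq> 0"
      and that: "\<And>U U' B. primitive U U' \<Longrightarrow> primitive U' (\<lambda>x. q x * U x + F x) \<Longrightarrow>
        square_integrable U \<Longrightarrow> square_integrable U' \<Longrightarrow> (\<And>x. cmod (U x) \<le> B) \<Longrightarrow> (\<And>x. cmod (U' x) \<le> B) \<Longrightarrow> thesis"
    have y2: "primitive y' (\<lambda>x. q x * y x)"
      using y(2) by (simp add: q_def algebra_simps)
    have w1: "primitive (\<lambda>x. v (- x)) (\<lambda>x. - v' (- x))"
      by (rule primitive_reflect[OF v(1)])
    have w2: "primitive (\<lambda>x. - v' (- x)) (\<lambda>x. q x * v (- x))"
      using primitive_uminus[OF primitive_reflect[OF v(2)]] by (simp add: q_def algebra_simps)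
    have C: "C1 * exp t \<le> C * exp t" "C2 * exp t \<le> C * exp t" for t
      by (auto simp: C_def)
    have bdy: "cmod (y x) \<le> C * exp (- (Re \<mu> * x))" "cmod (y' x) \<le> C * exp (- (Re \<mu> * x))" for x
      using y(3,4)[of x] C(1) order_trans by blast+
    have bw: "cmod (v (- x)) \<le> C * exp (Re \<mu> * x)" "cmod (- v' (- x)) \<le> C * exp (Re \<mu> * x)" for x
      using order_trans[OF v(3)[of "- x"] C(2)] order_trans[OF v(4)[of "- x"] C(2)] by simp_all
    have F: "square_integrable F"
      unfolding F_def by (intro square_integrable_cmult square_integrable_rep_L2)
    show thesis
      by (rule green_solution[OF \<kappa> y(1) y2 bdy w1 w2 bw _ F that]) (use W in simp)
  qed
  \<comment> \<open>\<open>primitive_in_domain\<close> concerns \<open>P\<close> rather than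
    \<open>P - z\<close>, so the term \<open>z u\<close> is moved to the right-hand side.\<close>
  define g where "g = f + mult_op (\<lambda>_. z) (abs_L2 U)"
  have rz: "AE x in lebesgue. rep_L2 (mult_op (\<lambda>_. z) (abs_L2 U)) x = z * rep_L2 (abs_L2 U) x"
    by (rule rep_mult_op) auto
  have rg: "AE x in lebesgue. rep_L2 g x = rep_L2 f x + z * U x"
    unfolding g_def
    using rep_plus_L2[of f "mult_op (\<lambda>_. z) (abs_L2 U)"] rz rep_abs_L2[OF U(3)]
    by eventually_elim simp
  have "primitive U' (\<lambda>x. (V x * U x - rep_L2 g x) / complex_of_real (h\<^sup>2))"
  proof (rule primitive_AE_cong[OF U(2)])
    have [measurable]: "(\<lambda>x. complex_of_real (V x)) \<in> borel_measurable lebesgue" "U \<in> borel_measurable lebesgue"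
      "rep_L2 g \<in> borel_measurable lebesgue"
      by (rule potential_measurable(1)[OF V], rule primitive_measurable[OF U(1)],
          rule square_integrable_measurable[OF square_integrable_rep_L2])
    show "(\<lambda>x. (V x * U x - rep_L2 g x) / complex_of_real (h\<^sup>2)) \<in> borel_measurable lebesgue"
      by measurable
    show "AE x in lebesgue. q x * U x + F x = (V x * U x - rep_L2 g x) / complex_of_real (h\<^sup>2)"
      using rg by eventually_elim (use h in \<open>simp add: q_def F_def field_simps\<close>)
  qed
  from primitive_in_domain[OF V h U(1,3,5) this U(4,6)]
  have "abs_L2 U \<in> schroedinger_domain h V" "schroedinger h V (abs_L2 U) = g" .
  then show ?thesis
    by (intro bexI[of _ "abs_L2 U"]) (simp_all add: g_def)
qed

section \<open>The resolvent\<close>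

text \<open>\<open>U\<close> represents the resolvent applied to \<open>F\<close>. Working with
  functions in place of classes keeps linear combinations pointwise.\<close>

definition resolvent_pair ::
  "real \<Rightarrow> (real \<Rightarrow> real) \<Rightarrow> complex \<Rightarrow> (real \<Rightarrow> complex) \<Rightarrow> (real \<Rightarrow> complex) \<Rightarrow> (real \<Rightarrow> complex) \<Rightarrow> bool" where
  "resolvent_pair h V z F U U' \<longleftrightarrow> primitive U U' \<and>
     primitive U' (\<lambda>x. (V x * U x - z * U x - F x) / complex_of_real (h\<^sup>2)) \<and>
     square_integrable U \<and> square_integrable U'"

lemma resolvent_pair_lincomb:
  assumes "resolvent_pair h V z F U U'" "resolvent_pair h V z G W W'"
  shows "resolvent_pair h V z (\<lambda>x. F x - c * G x) (\<lambda>x. U x - c * W x) (\<lambda>x. U' x - c * W' x)"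
proof -
  have "primitive (\<lambda>x. U' x - c * W' x) (\<lambda>x. (V x * U x - z * U x - F x) / complex_of_real (h\<^sup>2) -
      c * ((V x * W x - z * W x - G x) / complex_of_real (h\<^sup>2)))"
    using assms unfolding resolvent_pair_def by (intro primitive_diff primitive_cmult) auto
  moreover have "(V x * U x - z * U x - F x) / complex_of_real (h\<^sup>2) -
      c * ((V x * W x - z * W x - G x) / complex_of_real (h\<^sup>2)) =
      (V x * (U x - c * W x) - z * (U x - c * W x) - (F x - c * G x)) / complex_of_real (h\<^sup>2)" for x
    unfolding times_divide_eq_right diff_divide_distrib[symmetric] by (simp add: algebra_simps)
  ultimately show ?thesis
    using assms unfolding resolvent_pair_def
    by (auto intro!: primitive_diff primitive_cmult square_integrable_diff square_integrable_cmult)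
qed

lemma resolvent_pair_AE_cong:
  assumes V: "integrable lebesgue V" and "resolvent_pair h V z F U U'"
    and G: "G \<in> borel_measurable lebesgue" "AE x in lebesgue. F x = G x"
  shows "resolvent_pair h V z G U U'"
proof -
  have U: "primitive U U'" "primitive U' (\<lambda>x. (V x * U x - z * U x - F x) / complex_of_real (h\<^sup>2))"
    "square_integrable U" "square_integrable U'"
    using assms by (auto simp: resolvent_pair_def)
  have "primitive U' (\<lambda>x. (V x * U x - z * U x - G x) / complex_of_real (h\<^sup>2))"
  proof (rule primitive_AE_cong[OF U(2)])
    have [measurable]: "(\<lambda>x. complex_of_real (V x)) \<in> borel_measurable lebesgue"
      "U \<in> borel_measurable lebesgue" "G \<in> borel_measurable lebesgue"
      by (rule potential_measurable(1)[OF V], rule primitive_measurable[OF U(1)], rule G(1))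
    show "(\<lambda>x. (V x * U x - z * U x - G x) / complex_of_real (h\<^sup>2)) \<in> borel_measurable lebesgue"
      by measurable
    show "AE x in lebesgue. (V x * U x - z * U x - F x) / complex_of_real (h\<^sup>2) =
        (V x * U x - z * U x - G x) / complex_of_real (h\<^sup>2)"
      using G(2) by eventually_elim simp
  qed
  with U show ?thesis by (simp add: resolvent_pair_def)
qed

text \<open>With a vanishing source the absorption estimate reads
  \<open>Im z * (l2norm U)^2 \<le> 0\<close>. This uniqueness is what makes the resolvent
  linear.\<close>

lemma resolvent_pair_zero:
  assumes pair: "resolvent_pair h V z F U U'" and F: "square_integrable F" "AE x in lebesgue. F x = 0"
    and h: "h > 0" and z: "Im z > 0"
  shows "AE x in lebesgue. U x = 0"
proof -
  have U: "primitive U U'" "primitive U' (\<lambda>x. (V x * U x - z * U x - F x) / complex_of_real (h\<^sup>2))"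
    "square_integrable U" "square_integrable U'"
    using pair by (auto simp: resolvent_pair_def)
  have "Im z * (l2norm U)\<^sup>2 \<le> (LINT x|lebesgue. cmod (U x) * cmod (F x))"
    by (rule absorption_estimate[OF U F(1) h])
  also have "\<dots> = 0"
    by (rule integral_eq_zero_AE) (use F(2) in \<open>auto elim: eventually_mono\<close>)
  finally have "(l2norm U)\<^sup>2 \<le> 0"
    using z by (simp add: mult_le_0_iff)
  then have "(LINT x|lebesgue. (cmod (U x))\<^sup>2) = 0"
    unfolding l2norm_power2[symmetric] by simp
  then have "AE x in lebesgue. (cmod (U x))\<^sup>2 = 0"
    by (subst (asm) integral_nonneg_eq_0_iff_AE) (use square_integrable_norm_power2[OF U(3)] in auto)
  then show ?thesis by simp
qed

text \<open>\<open>inv_into\<close> is meaningful only on the image of \<open>P - z\<close>;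
  solvability places every \<open>f\<close> there, and the chosen preimage then satisfies the
  equation.\<close>

lemma resolvent_solution:
  assumes V: "integrable lebesgue V" and h: "h > 0" and z: "Im z > 0"
  obtains U U' where "resolvent_pair h V z (rep_L2 f) U U'"
    "AE x in lebesgue. rep_L2 (resolvent h V z f) x = U x"
proof -
  let ?P = "\<lambda>u. schroedinger h V u - mult_op (\<lambda>_. z) u"
  define u where "u = resolvent h V z f"
  obtain v where v: "v \<in> schroedinger_domain h V" "?P v = f"
    using resolvent_equation_solvable[OF V h z, of f] by blast
  have im: "f \<in> ?P ` schroedinger_domain h V"
    by (rule image_eqI[where f = ?P and x = v]) (simp_all add: v)
  have u: "u \<in> schroedinger_domain h V"
    unfolding u_def resolvent_def by (rule inv_into_into[OF im])
  have Pu: "?P u = f"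
    unfolding u_def resolvent_def by (rule f_inv_into_f[OF im])
  obtain U U' :: "real \<Rightarrow> complex" where U: "primitive U U'"
    "primitive U' (\<lambda>x. (V x * U x - rep_L2 (schroedinger h V u) x) / complex_of_real (h\<^sup>2))"
    "AE x in lebesgue. rep_L2 u x = U x" "square_integrable U" "square_integrable U'"
    by (rule domain_primitive[OF V h u])
  have "AE x in lebesgue. rep_L2 (mult_op (\<lambda>_. z) u) x = z * rep_L2 u x"
    by (rule rep_mult_op) auto
  then have eq: "AE x in lebesgue. rep_L2 (schroedinger h V u) x - z * U x = rep_L2 f x"
    using rep_diff_L2[of "schroedinger h V u" "mult_op (\<lambda>_. z) u"] U(3) unfolding Pu
    by eventually_elim simp
  have "(V x * U x - z * U x - (rep_L2 (schroedinger h V u) x - z * U x)) / complex_of_real (h\<^sup>2) =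
      (V x * U x - rep_L2 (schroedinger h V u) x) / complex_of_real (h\<^sup>2)" for x
    by simp
  then have "resolvent_pair h V z (\<lambda>x. rep_L2 (schroedinger h V u) x - z * U x) U U'"
    using U by (simp add: resolvent_pair_def)
  then have pair: "resolvent_pair h V z (rep_L2 f) U U'"
    by (rule resolvent_pair_AE_cong[OF V _ square_integrable_measurable[OF square_integrable_rep_L2] eq])
  show thesis
    by (rule that[OF pair U(3)[unfolded u_def]])
qed

text \<open>Preimages are chosen separately for each right-hand side, so linearity is deduced from
  uniqueness: its defect solves the homogeneous equation.\<close>

lemma resolvent_lincomb:
  assumes V: "integrable lebesgue V" and h: "h > 0" and z: "Im z > 0"
  shows "resolvent h V z (f + c *\<^sub>R g) = resolvent h V z f + c *\<^sub>R resolvent h V z g"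
proof (rule L2_eqI)
  obtain U U' where U: "resolvent_pair h V z (rep_L2 f) U U'"
    "AE x in lebesgue. rep_L2 (resolvent h V z f) x = U x"
    using resolvent_solution[OF assms] by blast
  obtain W W' where W: "resolvent_pair h V z (rep_L2 g) W W'"
    "AE x in lebesgue. rep_L2 (resolvent h V z g) x = W x"
    using resolvent_solution[OF assms] by blast
  obtain Y Y' where Y: "resolvent_pair h V z (rep_L2 (f + c *\<^sub>R g)) Y Y'"
    "AE x in lebesgue. rep_L2 (resolvent h V z (f + c *\<^sub>R g)) x = Y x"
    using resolvent_solution[OF assms] by blast
  \<comment> \<open>The factor 1 gives the expression the shape to which
    \<open>resolvent_pair_lincomb\<close> applies twice.\<close>
  define F where "F x = (rep_L2 (f + c *\<^sub>R g) x - 1 * rep_L2 f x) - complex_of_real c * rep_L2 g x" for x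
  have "AE x in lebesgue. (Y x - 1 * U x) - complex_of_real c * W x = 0"
  proof (rule resolvent_pair_zero[OF _ _ _ h z])
    show "resolvent_pair h V z F (\<lambda>x. (Y x - 1 * U x) - complex_of_real c * W x)
        (\<lambda>x. (Y' x - 1 * U' x) - complex_of_real c * W' x)"
      unfolding F_def by (intro resolvent_pair_lincomb U W Y)
    show "square_integrable F"
      unfolding F_def by (intro square_integrable_diff square_integrable_cmult square_integrable_rep_L2)
    show "AE x in lebesgue. F x = 0"
      using rep_plus_L2[of f "c *\<^sub>R g"] rep_scaleR_L2[of c g]
      by eventually_elim (simp add: F_def scaleR_conv_of_real)
  qed
  then show "AE x in lebesgue. rep_L2 (resolvent h V z (f + c *\<^sub>R g)) x =
      rep_L2 (resolvent h V z f + c *\<^sub>R resolvent h V z g) x"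
    using U(2) W(2) Y(2) rep_plus_L2[of "resolvent h V z f" "c *\<^sub>R resolvent h V z g"]
      rep_scaleR_L2[of c "resolvent h V z g"]
    by eventually_elim (simp add: scaleR_conv_of_real diff_eq_eq add.commute)
qed

section \<open>Multiplication operators and the operator norm\<close>

lemma mult_op_lincomb:
  assumes m: "m \<in> borel_measurable lebesgue" "bounded (range m)"
  shows "mult_op m (f + c *\<^sub>R g) = mult_op m f + c *\<^sub>R mult_op m g"
proof (rule L2_eqI)
  show "AE x in lebesgue. rep_L2 (mult_op m (f + c *\<^sub>R g)) x = rep_L2 (mult_op m f + c *\<^sub>R mult_op m g) x"
    using rep_mult_op[OF m, of "f + c *\<^sub>R g"] rep_mult_op[OF m, of f] rep_mult_op[OF m, of g]
      rep_plus_L2[of f "c *\<^sub>R g"] rep_scaleR_L2[of c g]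
      rep_plus_L2[of "mult_op m f" "c *\<^sub>R mult_op m g"] rep_scaleR_L2[of c "mult_op m g"]
    by eventually_elim (simp add: algebra_simps)
qed

text \<open>\<open>mult_op\<close> is the zero operator unless its multiplier is measurable and
  bounded, so both must be checked before it acts as multiplication.\<close>

lemma exterior_admissible:
  "exterior R \<in> borel_measurable lebesgue" "bounded (range (exterior R))"
proof -
  have "exterior R = (\<lambda>x. complex_of_real (indicat_real {x. R < \<bar>x\<bar>} x))"
    by (auto simp: exterior_def indicator_def)
  moreover have "indicat_real {x. R < \<bar>x\<bar>} \<in> borel_measurable lebesgue"
    by (intro borel_measurable_lebesgueI) measurable
  ultimately show "exterior R \<in> borel_measurable lebesgue"
    by (simp add: of_real_measurable)
  show "bounded (range (exterior R))"
    by (auto simp: bounded_iff exterior_def indicator_def intro!: exI[of _ 1])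
qed

lemma weight_admissible:
  assumes "\<delta> > 0"
  shows "weight \<delta> \<in> borel_measurable lebesgue" "bounded (range (weight \<delta>))"
proof -
  show "weight \<delta> \<in> borel_measurable lebesgue"
    unfolding weight_def by (intro of_real_measurable borel_measurable_lebesgueI) measurable
  have "cmod (weight \<delta> x) \<le> 1" for x
    using assms powr_mono[of "- ((1 + \<delta>) / 2)" 0 "1 + \<bar>x\<bar>"]
    by (simp add: weight_def add_nonneg_eq_0_iff split: if_splits)
  then show "bounded (range (weight \<delta>))"
    by (auto simp: bounded_iff)
qed

lemma exterior_times_weight: "exterior R x * weight \<delta> x = complex_of_real (exterior_weight R \<delta> x)"
  by (simp add: exterior_def weight_def exterior_weight_def indicator_def)

lemma norm_L2_eq_l2norm:
  assumes "AE x in lebesgue. rep_L2 f x = g x" "g \<in> borel_measurable lebesgue"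
  shows "norm f = l2norm g"
proof -
  have [measurable]: "g \<in> borel_measurable lebesgue" "rep_L2 f \<in> borel_measurable lebesgue"
    using assms(2) square_integrable_measurable[OF square_integrable_rep_L2] by auto
  have "(LINT x|lebesgue. (cmod (rep_L2 f x))\<^sup>2) = (LINT x|lebesgue. (cmod (g x))\<^sup>2)"
  proof (rule integral_cong_AE)
    show "AE x in lebesgue. (cmod (rep_L2 f x))\<^sup>2 = (cmod (g x))\<^sup>2"
      using assms(1) by eventually_elim simp
  qed measurable
  then show ?thesis by (simp add: norm_L2_rep l2norm_def)
qed

text \<open>The two multiplications on each side merge into one by \<open>exterior_weight\<close>,
  which brings the operator into the form treated by \<open>exterior_estimate\<close>.\<close>

lemma weighted_resolvent_bound:
  assumes R: "R \<ge> 0" and V: "integrable lebesgue V" "AE x in lebesgue. \<bar>x\<bar> > R \<longrightarrow> V x = 0"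
    and E: "E \<ge> 2 * \<epsilon>" "\<epsilon> > 0" and \<delta>: "\<delta> > 0" and h: "h > 0"
  shows "norm (weighted_resolvent R \<delta> h V (complex_of_real E + \<i> * complex_of_real \<epsilon>) g) \<le>
    8 / (\<delta> * (1 + R) powr \<delta> * sqrt E * h) * norm g"
proof -
  define z where "z = complex_of_real E + \<i> * complex_of_real \<epsilon>"
  have z: "Im z > 0" using E by (simp add: z_def)
  define f where "f = mult_op (weight \<delta>) (mult_op (exterior R) g)"
  have rf: "AE x in lebesgue. rep_L2 f x = exterior_weight R \<delta> x * rep_L2 g x"
    unfolding f_def
    using rep_mult_op[OF weight_admissible[OF \<delta>], of "mult_op (exterior R) g"]
      rep_mult_op[OF exterior_admissible, of R g]
    by eventually_elim (simp add: exterior_times_weight[symmetric])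
  obtain U U' where U: "resolvent_pair h V z (rep_L2 f) U U'"
    "AE x in lebesgue. rep_L2 (resolvent h V z f) x = U x"
    using resolvent_solution[OF V(1) h z] by blast
  have mw: "(\<lambda>x. complex_of_real (exterior_weight R \<delta> x)) \<in> borel_measurable lebesgue"
    by (rule of_real_measurable[OF exterior_weight_measurable])
  have [measurable]: "(\<lambda>x. complex_of_real (exterior_weight R \<delta> x)) \<in> borel_measurable lebesgue"
    "rep_L2 g \<in> borel_measurable lebesgue" "U \<in> borel_measurable lebesgue"
    using mw square_integrable_measurable[OF square_integrable_rep_L2] U(1)
    by (auto simp: resolvent_pair_def intro: primitive_measurable)
  have "(\<lambda>x. exterior_weight R \<delta> x * rep_L2 g x) \<in> borel_measurable lebesgue"
    by measurable
  then have pair: "resolvent_pair h V z (\<lambda>x. exterior_weight R \<delta> x * rep_L2 g x) U U'"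
    by (rule resolvent_pair_AE_cong[OF V(1) U(1) _ rf])
  let ?r = "weighted_resolvent R \<delta> h V z g"
  have "?r = mult_op (exterior R) (mult_op (weight \<delta>) (resolvent h V z f))"
    by (simp add: weighted_resolvent_def f_def)
  then have "AE x in lebesgue. rep_L2 ?r x = exterior_weight R \<delta> x * U x"
    using rep_mult_op[OF exterior_admissible, of R "mult_op (weight \<delta>) (resolvent h V z f)"]
      rep_mult_op[OF weight_admissible[OF \<delta>], of "resolvent h V z f"] U(2)
    by (auto elim!: eventually_elim2 simp: exterior_times_weight[symmetric] mult.assoc)
  then have "norm ?r = l2norm (\<lambda>x. exterior_weight R \<delta> x * U x)"
    by (rule norm_L2_eq_l2norm) measurable
  also have "\<dots> \<le> 8 * l2norm (rep_L2 g) / (\<delta> * (1 + R) powr \<delta> * sqrt E * h)"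
    using pair unfolding resolvent_pair_def
    by (intro exterior_estimate[OF R V(2) E \<delta> h z_def]) (auto intro: square_integrable_rep_L2)
  also have "l2norm (rep_L2 g) = norm g"
    by (simp add: norm_L2_rep l2norm_def)
  finally show ?thesis by (simp add: z_def)
qed

text \<open>The operator norm is \<^const>\<open>onorm\<close>; boundedness is asserted as well, since
  \<^const>\<open>onorm\<close> is only meaningful for bounded operators.\<close>

theorem theorem2:
  fixes R E \<epsilon> \<delta> h :: real and V :: "real \<Rightarrow> real"
  assumes "R \<ge> 0"
    and "integrable lebesgue V"
    and "AE x in lebesgue. \<bar>x\<bar> > R \<longrightarrow> V x = 0"
    and "E \<ge> 2 * \<epsilon>" and "\<epsilon> > 0" and "\<delta> > 0" and "h > 0"
  shows "bounded_linear (weighted_resolvent R \<delta> h V (complex_of_real E + \<i> * complex_of_real \<epsilon>)) \<and>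
         onorm (weighted_resolvent R \<delta> h V (complex_of_real E + \<i> * complex_of_real \<epsilon>))
           \<le> 8 * (1 + R) powr (- \<delta>) * inverse \<delta> * E powr (- (1 / 2)) / h"
proof -
  let ?z = "complex_of_real E + \<i> * complex_of_real \<epsilon>"
  let ?T = "weighted_resolvent R \<delta> h V ?z"
  define K where "K = 8 / (\<delta> * (1 + R) powr \<delta> * sqrt E * h)"
  have z: "Im ?z > 0" using assms(5) by simp
  have E: "E > 0" using assms(4,5) by linarith
  have bound: "norm (?T g) \<le> K * norm g" for g
    unfolding K_def by (rule weighted_resolvent_bound[OF assms])
  \<comment> \<open>One combined law passes through all five factors; additivity is its case
    \<open>c = 1\<close> and homogeneity its case \<open>f = 0\<close>.\<close>
  have lin: "?T (f + c *\<^sub>R g) = ?T f + c *\<^sub>R ?T g" for f g c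
    unfolding weighted_resolvent_def o_def
    by (simp only: mult_op_lincomb[OF exterior_admissible] mult_op_lincomb[OF weight_admissible[OF assms(6)]]
        resolvent_lincomb[OF assms(2,7) z])
  have add: "?T (f + g) = ?T f + ?T g" for f g
    using lin[of f 1 g] by simp
  have "?T 0 = 0"
    using add[of 0 0] by simp
  then have scale: "?T (c *\<^sub>R g) = c *\<^sub>R ?T g" for c g
    using lin[of 0 c g] by simp
  have "bounded_linear ?T"
    by (rule bounded_linear_intro[OF add scale, of K]) (use bound in \<open>simp add: mult.commute\<close>)
  moreover have "K = 8 * (1 + R) powr (- \<delta>) * inverse \<delta> * E powr (- (1 / 2)) / h"
    using E by (simp add: K_def powr_minus powr_half_sqrt field_simps)
  moreover have "onorm ?T \<le> K"
  proof (rule onorm_bound[OF _ bound])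
    show "0 \<le> K" using assms E by (simp add: K_def)
  qed
  ultimately show ?thesis by simp
qed

end
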